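(* Let $u=(r,\sigma,s)\in\mathbb R_+^3$, let $X=N+P\in\mathcal O^3_u$ with $N=(0,v(\mathrm I,y),\omega(\mathrm I,y))$, and let $w=(\rho,\tau,t)\in\mathbb R_+^3$. Put $$Q:=3\,\mathrm{diam}(\mathbb Y_\sigma)\left\|\frac1v\right\|_{r,\sigma}$$ and assume that for some $p\in\mathbb N$, $p\ge1$, and some $s_2\in\mathbb R_+$ the following inequalities are satisfied: $$0<\rho<\frac r8,\qquad 0<\tau<e^{-s_2}\frac\sigma8,\qquad 0<t<\frac s{10},$$ $$\chi:=\frac{\mathrm{diam}(\mathbb Y_\sigma)}{s_2}\left\|\frac{\partial_yv}{v}\right\|_{r,\sigma}\le1,$$ $$\theta_1:=2e^{s_2}\mathrm{diam}(\mathbb Y_\sigma)\left\|\frac{\partial_y\omega}{v}\right\|_{r,\sigma}\frac\tau t\le1,$$ $$\theta_2:=4\,\mathrm{diam}(\mathbb Y_\sigma)\left\|\frac{\partial_{\mathrm I}v}{v}\right\|_{r,\sigma}\frac\rho\tau\le1,$$ $$\theta_3:=8\,\mathrm{diam}(\mathbb Y_\sigma)\left\|\frac{\partial_{\mathrm I}\omega}{v}\right\|_{r,\sigma}\frac\rho t\le1,$$ $$\eta^2:=\max\left\{\frac{\mathrm{diam}(\mathbb Y_\sigma)}{t}\left\|\frac\omega v\right\|_{r,\sigma},\ 2^7e^{2s_2}Q^2\big(|||P|||_u^w\big)^2\right\}<\frac1p .$$ Then, with $$u_\star=(r_\star,\sigma_\star,s_\star),\qquad r_\star:=r-8\rho,\quad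 \sigma_\star:=\sigma-8e^{s_2}\tau,\quad s_\star:=s-10t,$$ there exists a real-analytic change of coordinates $\Phi_\star$ which carries $X$ to a vector field $X_\star\in\mathcal O^3_{u_\star}$ (denoted $X_\star=\Phi_\star X$) of the form $X_\star=N+P_\star$, with $$|||P_\star|||^w_{u_\star}<2^{-(p+1)}|||P|||^w_u .$$
   Context: Let $\mathbb I\subset\mathbb R$, $\mathbb Y\subset\mathbb R$ be open and connected and $\mathbb T=\mathbb R/(2\pi\mathbb Z)$. For $A\subset\mathbb R$ and $r>0$, $A_r:=\bigcup_{x\in A}B_r(x)$ with $B_r(x)\subset\mathbb C$ the complex ball of radius $r$ centred at $x$; $\mathbb T_s:=\{\varphi_1+\mathrm i\varphi_2:\varphi_1\in\mathbb T,\ |\varphi_2|<s\}$. For $u=(r,\sigma,s)$ put $\mathbb P_u:=\mathbb I_r\times\mathbb Y_\sigma\times\mathbb T_s\ni(\mathrm I,y,\varphi)$. $\mathrm{diam}$ denotes the diameter of a set. For a function $f=\sum_{k\in\mathbb Z}f_k(\mathrm I,y)e^{\mathrm ik\varphi}$ holomorphic on $\mathbb P_u$, $\|f\|_u:=\sum_{k\in\mathbb Z}\sup_{\mathbb I_r\times\mathbb Y_\sigma}|f_k(\mathrm I,y)|\,e^{|k|s}$; $\mathcal O_u=\mathcal O_{r,\sigma,s}$ is the set of holomorphic $f$ on $\mathbb P_u$ with finite norm. For $\varphi$-independent functions the norm is written $\|\cdot\|_{r,\sigma}$ (it is the sup norm on $\mathbb I_r\times\mathbb Y_\sigma$). For a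 vector field $X=(X_1,X_2,X_3)$ (components along $\mathrm I,y,\varphi$ respectively), $X\in\mathcal O^3_u$ means $X_i\in\mathcal O_u$ for $i=1,2,3$, and for weights $w=(w_1,w_2,w_3)\in\mathbb R_+^3$ the weighted norm is $|||X|||_u^w:=\sum_{i=1}^3w_i^{-1}\|X_i\|_u$. The quantities appearing in the hypotheses are understood to be finite. A change of coordinates $x=\Phi(z)$ carries the ODE $\dot x=X(x)$ to $\dot z=Z(z)$ with $Z(z)=(D\Phi(z))^{-1}X(\Phi(z))$, $D\Phi$ being the Jacobian matrix; $\Phi_\star X$ denotes the vector field so obtained from $X$ via $\Phi_\star$.
   Formalization: If P = 0 the strict inequality |||P_*||| < 2^{-(p+1)}|||P||| would read |||P_*||| < 0 and cannot hold; the formal theorem asserts it when |||P||| is nonzero, and asserts |||P_*||| = 0 when |||P||| = 0. *)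

theory Defs
  imports "HOL-Analysis.Analysis"
begin

definition cnbhd :: "real set \<Rightarrow> real \<Rightarrow> complex set" where
  "cnbhd A r = (\<Union>x\<in>A. ball (complex_of_real x) r)"

definition base_dom :: "real set \<Rightarrow> real set \<Rightarrow> real \<Rightarrow> real \<Rightarrow> (complex \<times> complex) set" where
  "base_dom II YY r \<sigma> = cnbhd II r \<times> cnbhd YY \<sigma>"

(* The domain I_r x Y_sigma x T_s, lifted to the universal cover: the angle is a complex
   number in the strip |Im phi| < s, and objects on the torus are those which respect
   translations of the angle by multiples of 2*pi. *)
definition phase_dom :: "real set \<Rightarrow> real set \<Rightarrow> real \<Rightarrow> real \<Rightarrow> real \<Rightarrow> (complex^3) set" where
  "phase_dom II YY r \<sigma> s = {z. (z$1, z$2) \<in> base_dom II YY r \<sigma> \<and> \<bar>Im (z$3)\<bar> < s}"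

definition torus_eq :: "complex^3 \<Rightarrow> complex^3 \<Rightarrow> bool" where
  "torus_eq z z' \<longleftrightarrow> z$1 = z'$1 \<and> z$2 = z'$2 \<and> (\<exists>m::int. z$3 - z'$3 = of_real (2 * pi * of_int m))"

(* Holomorphy in several variables: complex-linear Frechet derivative at every point
   (used on open sets only). *)
definition holo3 :: "(complex^3 \<Rightarrow> complex) \<Rightarrow> (complex^3) set \<Rightarrow> bool" where
  "holo3 f D \<longleftrightarrow> (\<forall>z\<in>D. \<exists>a::complex^3. (f has_derivative (\<lambda>h. \<Sum>i\<in>UNIV. a$i * h$i)) (at z))"

definition sup_bdd :: "(complex \<times> complex) set \<Rightarrow> (complex \<Rightarrow> complex \<Rightarrow> complex) \<Rightarrow> bool" where
  "sup_bdd B g \<longleftrightarrow> bdd_above ((\<lambda>(a, y). cmod (g a y)) ` B)"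

(* Meaningful only when sup_bdd B g and B is nonempty. *)
definition sup_norm :: "(complex \<times> complex) set \<Rightarrow> (complex \<Rightarrow> complex \<Rightarrow> complex) \<Rightarrow> real" where
  "sup_norm B g = (SUP (a, y)\<in>B. cmod (g a y))"

definition fourier_coeff :: "(complex^3 \<Rightarrow> complex) \<Rightarrow> int \<Rightarrow> complex \<Rightarrow> complex \<Rightarrow> complex" where
  "fourier_coeff f k a y =
     integral {0..2*pi} (\<lambda>x::real. f (vector [a, y, of_real x]) * exp (- \<i> * of_int k * of_real x))
       / of_real (2 * pi)"

(* Meaningful for members of O_space, which have finite norm. *)
definition fourier_norm ::
  "real set \<Rightarrow> real set \<Rightarrow> real \<Rightarrow> real \<Rightarrow> real \<Rightarrow> (complex^3 \<Rightarrow> complex) \<Rightarrow> real" where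
  "fourier_norm II YY r \<sigma> s f =
     (\<Sum>\<^sub>\<infinity>k\<in>(UNIV::int set). sup_norm (base_dom II YY r \<sigma>) (fourier_coeff f k) * exp (\<bar>of_int k\<bar> * s))"

definition O_space ::
  "real set \<Rightarrow> real set \<Rightarrow> real \<Rightarrow> real \<Rightarrow> real \<Rightarrow> (complex^3 \<Rightarrow> complex) set" where
  "O_space II YY r \<sigma> s = {f.
     holo3 f (phase_dom II YY r \<sigma> s) \<and>
     (\<forall>z\<in>phase_dom II YY r \<sigma> s. \<forall>z'\<in>phase_dom II YY r \<sigma> s. torus_eq z z' \<longrightarrow> f z = f z') \<and>
     (\<forall>k. sup_bdd (base_dom II YY r \<sigma>) (fourier_coeff f k)) \<and>
     (\<lambda>k::int. sup_norm (base_dom II YY r \<sigma>) (fourier_coeff f k) * exp (\<bar>of_int k\<bar> * s))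
       summable_on UNIV}"

definition O3_space ::
  "real set \<Rightarrow> real set \<Rightarrow> real \<Rightarrow> real \<Rightarrow> real \<Rightarrow> (complex^3 \<Rightarrow> complex^3) set" where
  "O3_space II YY r \<sigma> s = {X. \<forall>i. (\<lambda>z. X z $ i) \<in> O_space II YY r \<sigma> s}"

definition weighted_norm ::
  "real set \<Rightarrow> real set \<Rightarrow> real \<Rightarrow> real \<Rightarrow> real \<Rightarrow> real \<Rightarrow> real \<Rightarrow> real
     \<Rightarrow> (complex^3 \<Rightarrow> complex^3) \<Rightarrow> real" where
  "weighted_norm II YY r \<sigma> s w1 w2 w3 X =
     inverse w1 * fourier_norm II YY r \<sigma> s (\<lambda>z. X z $ 1) +
     inverse w2 * fourier_norm II YY r \<sigma> s (\<lambda>z. X z $ 2) +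
     inverse w3 * fourier_norm II YY r \<sigma> s (\<lambda>z. X z $ 3)"

definition normal_field ::
  "(complex \<Rightarrow> complex \<Rightarrow> complex) \<Rightarrow> (complex \<Rightarrow> complex \<Rightarrow> complex) \<Rightarrow> complex^3 \<Rightarrow> complex^3" where
  "normal_field v \<omega> z = vector [0, v (z$1) (z$2), \<omega> (z$1) (z$2)]"

definition d_I :: "(complex \<Rightarrow> complex \<Rightarrow> complex) \<Rightarrow> complex \<Rightarrow> complex \<Rightarrow> complex" where
  "d_I g a y = deriv (\<lambda>a. g a y) a"

definition d_y :: "(complex \<Rightarrow> complex \<Rightarrow> complex) \<Rightarrow> complex \<Rightarrow> complex \<Rightarrow> complex" where
  "d_y g a y = deriv (\<lambda>y. g a y) y"

(* For maps with holomorphic components the Frechet derivative is complex-linear, so the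
   library's jacobian is the matrix of complex partial derivatives.
   The equivalence in the last clause says that Phi descends to the quotient by 2*pi-translations
   of the angle and that the induced map is injective. *)
definition coord_change :: "(complex^3 \<Rightarrow> complex^3) \<Rightarrow> (complex^3) set \<Rightarrow> (complex^3) set \<Rightarrow> bool" where
  "coord_change \<Phi> D D' \<longleftrightarrow>
     (\<forall>i. holo3 (\<lambda>z. \<Phi> z $ i) D) \<and> \<Phi> ` D \<subseteq> D' \<and>
     (\<forall>z\<in>D. invertible (jacobian \<Phi> (at z))) \<and>
     (\<forall>z\<in>D. \<forall>z'\<in>D. torus_eq (\<Phi> z) (\<Phi> z') \<longleftrightarrow> torus_eq z z')"

definition transform_field ::
  "(complex^3 \<Rightarrow> complex^3) \<Rightarrow> (complex^3 \<Rightarrow> complex^3) \<Rightarrow> complex^3 \<Rightarrow> complex^3" where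
  "transform_field \<Phi> X z = matrix_inv (jacobian \<Phi> (at z)) *v X (\<Phi> z)"

definition real_on_reals :: "(complex^3) set \<Rightarrow> (complex^3 \<Rightarrow> complex^3) \<Rightarrow> bool" where
  "real_on_reals D F \<longleftrightarrow> (\<forall>z\<in>D. (\<forall>i. z$i \<in> \<real>) \<longrightarrow> (\<forall>i. F z $ i \<in> \<real>))"

end

theory Submission
  imports Defs "HOL-Complex_Analysis.Conformal_Mappings"
begin

text \<open>
  The field \<open>X\<close> is conjugated to \<open>N\<close> exactly, so that the new perturbation vanishes. Fix a real \<open>y0\<close>
  in \<open>YY\<close>. Since \<open>v\<close> has no zeros, both fields are transversal to the section \<open>y = y0\<close>, and the orbit
  of \<open>N\<close> through \<open>(I, y0, \<psi>)\<close> is \<open>(I, y, \<psi> + \<Omega>(I, y))\<close> with \<open>\<Omega>\<close> the integral of \<open>\<omega> / v\<close> from \<open>y0\<close> to \<open>y\<close>.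
  Let \<open>\<Psi>(I, y, \<psi>)\<close> be the orbit of \<open>X\<close> through the same point, with the time of \<open>N\<close>: it solves
  \<open>\<partial>\<Psi>/\<partial>y = X(\<Psi>) / v(I, y)\<close> with \<open>\<Psi>(I, y0, \<psi>) = (I, y0, \<psi>)\<close>. This equation has a holomorphic solution by
  Picard iteration, because the complex neighbourhood of \<open>YY\<close> is convex. Then
  \<open>\<Phi>(I, y, \<phi>) = \<Psi>(I, y, \<phi> - \<Omega>(I, y))\<close> satisfies \<open>D\<Phi> N = X \<circ> \<Phi>\<close>.

  The smallness conditions keep \<open>\<Phi>\<close> within \<open>(\<rho>, \<tau>, t) / 16\<close> of the identity, on a domain which exceeds the
  target domain by \<open>(\<rho>, \<tau>, t)\<close>. By Cauchy's estimate \<open>\<Phi> - id\<close> is then a contraction in the weighted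
  maximum norm, whence \<open>\<Phi>\<close> is injective and its Jacobian is invertible.
\<close>

subsection \<open>Holomorphic functions of several variables\<close>

text \<open>The path from the section to a point is as long as d = diam(Y_\<sigma>) allows, so
  closeness to the identity is a Gronwall matter. Along this path an error in \<open>y\<close> grows
  at rate |\<partial>_y v / v| \<le> s2 / d, in total by about e^s2. This is where e^s2 in the
  domain loss and in the smallness condition comes from: the source terms must carry a factor
  e^(-s2) to be amplified only to a fraction of \<tau>. The available budget is 33 e^s2 d V |||P|||
  \<le> 1 with V = sup |1/v|, which is the condition on \<eta> together with 1/p \<le> 1; the
  numerical constants below are adjusted to it. The Lipschitz constant of X has no smallness. Hence
  closeness is proved as invariance of a tube under the Picard operator, while convergence of the
  iteration rests on factorials. The Fourier norm has to be turned into pointwise bounds, which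
  requires that a function on the strip be the sum of its Fourier series. Holomorphy is handled as
  continuity plus holomorphy in each variable (\<open>sep_holo\<close>): integrals and uniform
  limits visibly preserve this form, and Osgood's lemma gives back the total derivative.\<close>

definition sep_holo :: "(complex^'n::finite \<Rightarrow> complex) \<Rightarrow> (complex^'n) set \<Rightarrow> bool" where
  "sep_holo f D \<longleftrightarrow>
     continuous_on D f \<and> (\<forall>z\<in>D. \<forall>i. (\<lambda>\<zeta>. f (z + axis i \<zeta>)) field_differentiable at 0)"

definition partial :: "'n::finite \<Rightarrow> (complex^'n \<Rightarrow> complex) \<Rightarrow> complex^'n \<Rightarrow> complex" where
  "partial i f z = deriv (\<lambda>\<zeta>. f (z + axis i \<zeta>)) 0"

lemma norm_axis_complex [simp]: "norm (axis i (\<zeta>::complex)) = norm \<zeta>"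
proof -
  have "(\<Sum>j\<in>UNIV. (norm (axis i \<zeta> $ j))\<^sup>2) = (\<Sum>j\<in>UNIV. if j = i then (norm \<zeta>)\<^sup>2 else 0)"
    by (intro sum.cong) (auto simp: axis_def)
  then show ?thesis
    by (simp add: norm_vec_def L2_set_def)
qed

lemma axis_add: "axis i (a + b) = axis i a + axis i (b::'a::monoid_add)"
  by (simp add: vec_eq_iff axis_def)

lemma axis_zero [simp]: "axis i (0::'a::zero) = 0"
  by (simp add: vec_eq_iff axis_def)

lemma vec_eq_sum_axis: "(x::'a::comm_monoid_add^'n) = (\<Sum>i\<in>UNIV. axis i (x $ i))"
  by (simp add: vec_eq_iff axis_def if_distrib cong: if_cong)

lemma bounded_linear_axis: "bounded_linear (axis i :: complex \<Rightarrow> complex^'n::finite)"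
proof (rule bounded_linear_intro[where K = 1])
  show "axis i (r *\<^sub>R x) = r *\<^sub>R (axis i x :: complex^'n)" for r and x :: complex
    by (simp add: vec_eq_iff axis_def)
qed (auto simp: axis_add)

lemma continuous_on_axis [continuous_intros]:
  "continuous_on S g \<Longrightarrow> continuous_on S (\<lambda>x. axis i (g x :: complex))"
  by (rule bounded_linear.continuous_on[OF bounded_linear_axis])

lemma sep_holo_has_field_derivative:
  assumes "sep_holo f D" "z + axis i \<zeta> \<in> D"
  shows "((\<lambda>\<eta>. f (z + axis i \<eta>)) has_field_derivative partial i f (z + axis i \<zeta>)) (at \<zeta>)"
proof -
  have "((\<lambda>\<eta>. f (z + axis i \<zeta> + axis i \<eta>)) has_field_derivative partial i f (z + axis i \<zeta>)) (at 0)"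
    using assms by (simp add: sep_holo_def partial_def field_differentiable_derivI)
  then have "((\<lambda>\<eta>. f (z + axis i (\<eta> + \<zeta>))) has_field_derivative partial i f (z + axis i \<zeta>)) (at 0)"
    by (simp add: axis_add algebra_simps)
  then show ?thesis
    using DERIV_shift[of "\<lambda>\<eta>. f (z + axis i \<eta>)" _ 0 \<zeta>] by simp
qed

lemma sep_holo_line_holomorphic:
  assumes "sep_holo f D" "\<And>\<zeta>. \<zeta> \<in> S \<Longrightarrow> z + axis i \<zeta> \<in> D"
  shows "(\<lambda>\<zeta>. f (z + axis i \<zeta>)) holomorphic_on S"
  unfolding holomorphic_on_def
  using sep_holo_has_field_derivative[OF assms(1) assms(2)]
  by (meson field_differentiable_at_within field_differentiable_def)

section \<open>Cauchy's estimate and Osgood's lemma\<close>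

lemma cauchy_deriv_bound:
  assumes "f holomorphic_on (cball w e)" "0 < e" "\<And>x. norm (w - x) = e \<Longrightarrow> norm (f x) \<le> M"
  shows "norm (deriv f w) \<le> M / e"
proof -
  have "norm ((deriv ^^ 1) f w) \<le> fact 1 * M / e ^ 1"
    using assms
    by (intro Cauchy_inequality)
      (auto intro: holomorphic_on_subset holomorphic_on_imp_continuous_on)
  then show ?thesis
    by simp
qed

text \<open>Uniform continuity of \<open>f\<close> on a compact ball makes the difference of its
  restrictions to two parallel complex lines at most \<open>\<epsilon> * e\<close> on a circle of
  radius \<open>e\<close>. Cauchy's estimate divides this by \<open>e\<close>.\<close>

lemma continuous_on_partial:
  assumes f: "sep_holo f D" and D: "open D"
  shows "continuous_on D (partial i f)"
proof (rule continuous_onI)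
  fix z0 and \<epsilon> :: real
  assume z0: "z0 \<in> D" and "\<epsilon> > 0"
  obtain e0 where e0: "e0 > 0" "cball z0 e0 \<subseteq> D"
    using D z0 open_contains_cball by blast
  \<comment> \<open>One half of the radius is for moving the base point from \<open>z0\<close> to
    \<open>z\<close>, the other for the circle around it.\<close>
  define e where "e = e0 / 2"
  have e: "e > 0" "2 * e = e0"
    using e0 by (auto simp: e_def)
  have "uniformly_continuous_on (cball z0 e0) f"
    using f e0 by (intro compact_uniformly_continuous)
      (auto simp: sep_holo_def intro: continuous_on_subset)
  then obtain d where d: "d > 0"
    "\<And>x x'. x \<in> cball z0 e0 \<Longrightarrow> x' \<in> cball z0 e0 \<Longrightarrow> dist x' x < d \<Longrightarrow> dist (f x') (f x) < \<epsilon> * e"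
    unfolding uniformly_continuous_on_def using e \<open>\<epsilon> > 0\<close>
    by (metis mult_pos_pos)
  show "\<exists>d>0. \<forall>x'\<in>D. dist x' z0 < d \<longrightarrow> dist (partial i f x') (partial i f z0) \<le> \<epsilon>"
  proof (intro exI[of _ "min d e"] conjI ballI impI)
    show "min d e > 0"
      using d e by auto
    fix z
    assume z: "z \<in> D" "dist z z0 < min d e"
    let ?u = "\<lambda>\<zeta>. f (z + axis i \<zeta>) - f (z0 + axis i \<zeta>)"
    have in0: "z0 + axis i \<zeta> \<in> cball z0 e0" if "norm \<zeta> \<le> e" for \<zeta>
      using that e by (simp add: dist_norm)
    have in1: "z + axis i \<zeta> \<in> cball z0 e0" if "norm \<zeta> \<le> e" for \<zeta>
    proof -
      have "norm (z0 - (z + axis i \<zeta>)) \<le> norm (z0 - z) + norm (axis i \<zeta>)"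
        by (metis diff_diff_add norm_triangle_ineq4)
      with that z e show ?thesis
        by (simp add: dist_norm norm_minus_commute)
    qed
    have hol: "?u holomorphic_on cball 0 e"
      using in0 in1 e0 by (intro holomorphic_on_diff sep_holo_line_holomorphic[OF f]) auto
    have "norm (deriv ?u 0) \<le> \<epsilon> * e / e"
    proof (rule cauchy_deriv_bound[OF hol \<open>e > 0\<close>])
      fix x :: complex
      assume "norm (0 - x) = e"
      then have "dist (f (z + axis i x)) (f (z0 + axis i x)) < \<epsilon> * e"
        using z by (intro d in0 in1) auto
      then show "norm (?u x) \<le> \<epsilon> * e"
        by (simp add: dist_norm)
    qed
    moreover have "deriv ?u 0 = partial i f z - partial i f z0"
      unfolding partial_def
      using f z(1) z0 by (intro deriv_diff) (auto simp: sep_holo_def)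
    ultimately show "dist (partial i f z) (partial i f z0) \<le> \<epsilon>"
      using e by (simp add: dist_norm)
  qed
qed

text \<open>From \<open>z\<close> to \<open>z + h\<close> one coordinate is moved at a time. On each
  leg the mean value inequality is applied to \<open>f\<close> minus its linear part, whose
  derivative is small because the partial derivatives are continuous; here this continuity is a
  consequence of Cauchy's estimate, not an assumption.\<close>

theorem osgood:
  fixes f :: "complex^'n::finite \<Rightarrow> complex"
  assumes f: "sep_holo f D" and D: "open D" and z: "z \<in> D"
  shows "(f has_derivative (\<lambda>h. \<Sum>i\<in>UNIV. partial i f z * h$i)) (at z)"
proof -
  let ?L = "\<lambda>h::complex^'n. \<Sum>i\<in>UNIV. partial i f z * h$i"
  have "bounded_linear ?L"
    by (intro bounded_linear_sum bounded_linear_const_mult bounded_linear_vec_nth)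
  moreover have "\<exists>d>0. \<forall>y. norm (y - z) < d \<longrightarrow> norm (f y - f z - ?L (y - z)) \<le> \<epsilon> * norm (y - z)"
    if "\<epsilon> > 0" for \<epsilon> :: real
  proof -
    \<comment> \<open>Each coordinate leg costs at most \<open>\<delta> * norm h\<close>, and there
      are \<open>CARD('n')\<close> legs.\<close>
    define \<delta> where "\<delta> = \<epsilon> / real CARD('n)"
    have "\<delta> > 0"
      using that by (simp add: \<delta>_def)
    have "\<exists>d>0. \<forall>w\<in>D. dist w z < d \<longrightarrow> dist (partial i f w) (partial i f z) < \<delta>" for i
      by (rule continuous_on_iff[THEN iffD1, rule_format, OF continuous_on_partial[OF f D] z \<open>\<delta> > 0\<close>])
    then obtain d' where d': "\<And>i. d' i > 0"
      "\<And>i w. w \<in> D \<Longrightarrow> dist w z < d' i \<Longrightarrow> dist (partial i f w) (partial i f z) < \<delta>"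
      by metis
    obtain e0 where e0: "e0 > 0" "ball z e0 \<subseteq> D"
      using D z open_contains_ball by blast
    define d where "d = Min (insert e0 (range d'))"
    have d: "d > 0" "d \<le> e0" "\<And>i. d \<le> d' i"
      unfolding d_def using d' e0 by (auto intro: min.coboundedI2)
    show ?thesis
    proof (intro exI[of _ d] conjI allI impI d)
      fix y
      assume y: "norm (y - z) < d"
      define h where "h = y - z"
      \<comment> \<open>\<open>A\<close> is the set of coordinates already moved. Intermediate
        points stay within \<open>norm h\<close> of \<open>z\<close>, since their displacement is
        \<open>h\<close> with some coordinates shrunk or set to zero.\<close>
      have "norm (f (z + (\<Sum>i\<in>A. axis i (h$i))) - f z - (\<Sum>i\<in>A. partial i f z * h$i))
              \<le> (\<Sum>i\<in>A. \<delta> * norm (h$i))" for A :: "'n set"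
        using finite[of A]
      proof (induction A)
        case empty
        then show ?case by simp
      next
        case (insert i A)
        define q where "q = z + (\<Sum>i\<in>A. axis i (h$i))"
        let ?u = "\<lambda>\<zeta>. f (q + axis i \<zeta>) - partial i f z * \<zeta>"
        have q: "norm (q + axis i \<zeta> - z) < d" if "\<zeta> \<in> cball 0 (norm (h$i))" for \<zeta>
        proof -
          have "norm (q + axis i \<zeta> - z) \<le> norm h"
            unfolding q_def using that insert.hyps
            by (intro norm_le_componentwise_cart) (auto simp: axis_def sum.delta if_distrib cong: if_cong)
          then show ?thesis
            using y by (simp add: h_def)
        qed
        have der: "(?u has_field_derivative partial i f (q + axis i \<zeta>) - partial i f z)
                     (at \<zeta> within cball 0 (norm (h$i)))"
          if "\<zeta> \<in> cball 0 (norm (h$i))" for \<zeta>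
        proof -
          have "q + axis i \<zeta> \<in> D"
            using q[OF that] d e0 by (auto simp: dist_norm norm_minus_commute subset_eq)
          then show ?thesis
            by (auto intro!: derivative_eq_intros
                has_field_derivative_at_within[OF sep_holo_has_field_derivative[OF f]])
        qed
        have bd: "norm (partial i f (q + axis i \<zeta>) - partial i f z) \<le> \<delta>"
          if "\<zeta> \<in> cball 0 (norm (h$i))" for \<zeta>
        proof -
          have "q + axis i \<zeta> \<in> D"
            using q[OF that] d e0 by (auto simp: dist_norm norm_minus_commute subset_eq)
          then show ?thesis
            using q[OF that] d(3)[of i] d'(2)[of "q + axis i \<zeta>" i] by (simp add: dist_norm)
        qed
        have "norm (?u (h$i) - ?u 0) \<le> \<delta> * norm (h$i - 0)"
          by (rule field_differentiable_bound[OF convex_cball der bd]) auto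
        note tri = norm_triangle_mono[OF this insert.IH]
        have eq: "f (z + (\<Sum>i\<in>insert i A. axis i (h$i))) - f z - (\<Sum>i\<in>insert i A. partial i f z * h$i)
             = (?u (h$i) - ?u 0) + (f (z + (\<Sum>i\<in>A. axis i (h$i))) - f z - (\<Sum>i\<in>A. partial i f z * h$i))"
          using insert.hyps by (simp add: q_def algebra_simps)
        have "norm (f (z + (\<Sum>i\<in>insert i A. axis i (h$i))) - f z - (\<Sum>i\<in>insert i A. partial i f z * h$i))
            \<le> \<delta> * norm (h$i - 0) + (\<Sum>i\<in>A. \<delta> * norm (h$i))"
          unfolding eq by (rule tri)
        then show ?case
          by (simp only: sum.insert[OF insert.hyps] diff_zero)
      qed
      from this[of UNIV] have "norm (f (z + h) - f z - ?L h) \<le> (\<Sum>i\<in>UNIV. \<delta> * norm (h$i))"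
        by (simp only: vec_eq_sum_axis[symmetric])
      then have "norm (f y - f z - ?L h) \<le> (\<Sum>i\<in>UNIV. \<delta> * norm (h$i))"
        by (simp add: h_def)
      also have "\<dots> \<le> (\<Sum>i\<in>(UNIV::'n set). \<delta> * norm h)"
        using \<open>\<delta> > 0\<close> by (intro sum_mono mult_left_mono Finite_Cartesian_Product.norm_nth_le) auto
      also have "\<dots> = \<epsilon> * norm h"
        by (simp add: \<delta>_def)
      finally show "norm (f y - f z - ?L (y - z)) \<le> \<epsilon> * norm (y - z)"
        by (simp add: h_def)
    qed
  qed
  ultimately show ?thesis
    unfolding has_derivative_at_alt by blast
qed

section \<open>Total complex derivatives and closure properties of \<open>holo3\<close>\<close>

lemma bounded_linear_vector_smult: "bounded_linear (\<lambda>\<zeta>::complex. \<zeta> *s k)" for k :: "complex^'n::finite"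
  by (rule bounded_linear_intro[where K = "norm k"])
    (auto simp: vec_eq_iff algebra_simps norm_vec_def L2_set_def norm_mult power_mult_distrib
       real_sqrt_mult simp flip: sum_distrib_left)

lemma has_derivative_line:
  assumes "(f has_derivative (\<lambda>h. \<Sum>i\<in>UNIV. a$i * h$i)) (at (z + \<zeta> *s k))"
  shows "((\<lambda>\<eta>. f (z + \<eta> *s k)) has_field_derivative (\<Sum>i\<in>UNIV. a$i * k$i)) (at (\<zeta>::complex))"
proof -
  have "((\<lambda>\<eta>. z + \<eta> *s k) has_derivative (\<lambda>\<eta>. 0 + \<eta> *s k)) (at \<zeta>)"
    by (intro has_derivative_add has_derivative_const bounded_linear.has_derivative[OF bounded_linear_vector_smult] has_derivative_ident)
  from has_derivative_compose[OF this assms]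
  have "((\<lambda>\<eta>. f (z + \<eta> *s k)) has_derivative (\<lambda>\<eta>. \<Sum>i\<in>UNIV. a$i * (\<eta> * k$i))) (at \<zeta>)"
    by simp
  moreover have "(\<lambda>\<eta>. \<Sum>i\<in>UNIV. a$i * (\<eta> * k$i)) = (*) (\<Sum>i\<in>UNIV. a$i * k$i)"
    by (rule ext) (simp add: sum_distrib_left mult_ac)
  ultimately show ?thesis
    by (simp add: has_field_derivative_def)
qed

text \<open>Allows the closure properties below to be checked in one variable at a time.\<close>

lemma holo3_iff_sep_holo:
  assumes "open D"
  shows "holo3 f D \<longleftrightarrow> sep_holo f D"
proof
  assume f: "holo3 f D"
  have "continuous_on D f"
    using f unfolding holo3_def
    by (meson continuous_at_imp_continuous_on has_derivative_continuous)
  moreover have "(\<lambda>\<zeta>. f (z + axis i \<zeta>)) field_differentiable at 0" if "z \<in> D" for z i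
  proof -
    obtain a where "(f has_derivative (\<lambda>h. \<Sum>i\<in>UNIV. a$i * h$i)) (at z)"
      using bspec[OF f[unfolded holo3_def] \<open>z \<in> D\<close>] by (rule exE)
    then have "(f has_derivative (\<lambda>h. \<Sum>i\<in>UNIV. a$i * h$i)) (at (z + 0 *s axis i 1))"
      by simp
    note der = has_derivative_line[OF this]
    have "(\<lambda>\<zeta>. f (z + \<zeta> *s axis i 1)) = (\<lambda>\<zeta>. f (z + axis i \<zeta>))"
      by (rule ext, rule arg_cong[where f = f]) (simp add: vec_eq_iff axis_def)
    from der[unfolded this] show ?thesis
      unfolding field_differentiable_def by (rule exI)
  qed
  ultimately show "sep_holo f D"
    by (auto simp: sep_holo_def)
next
  assume "sep_holo f D"
  from osgood[OF this assms] show "holo3 f D"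
    unfolding holo3_def
    by (intro ballI exI[of _ "\<chi> i. partial i f z" for z]) simp
qed

lemma holo3_has_derivative:
  assumes "holo3 f D" "open D" "z \<in> D"
  shows "(f has_derivative (\<lambda>h. \<Sum>i\<in>UNIV. partial i f z * h$i)) (at z)"
  using assms osgood holo3_iff_sep_holo by blast

lemma holo3_line:
  assumes "holo3 f D" "open D" "z + \<zeta> *s k \<in> D"
  shows "((\<lambda>\<eta>. f (z + \<eta> *s k)) has_field_derivative
           (\<Sum>i\<in>UNIV. partial i f (z + \<zeta> *s k) * k$i)) (at \<zeta>)"
  using has_derivative_line[of f "\<chi> i. partial i f (z + \<zeta> *s k)"] holo3_has_derivative[OF assms] by simp

lemma holo3_imp_continuous_on: "holo3 f D \<Longrightarrow> open D \<Longrightarrow> continuous_on D f"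
  by (simp add: holo3_iff_sep_holo sep_holo_def)

lemma holo3_subset: "holo3 f D \<Longrightarrow> E \<subseteq> D \<Longrightarrow> holo3 f E"
  by (auto simp: holo3_def)

lemma holo3_const: "open D \<Longrightarrow> holo3 (\<lambda>z. c) D"
  by (simp add: holo3_iff_sep_holo sep_holo_def)

lemma holo3_nth: "open D \<Longrightarrow> holo3 (\<lambda>z. z $ i) D"
proof -
  have "(\<lambda>\<zeta>. (z + axis j \<zeta>) $ i) field_differentiable at 0" for z :: "complex^3" and j
    by (cases "i = j") (auto simp: axis_def intro!: derivative_intros)
  then show "open D \<Longrightarrow> ?thesis"
    by (auto simp: holo3_iff_sep_holo sep_holo_def intro!: continuous_intros)
qed

lemma holo3_add: "open D \<Longrightarrow> holo3 f D \<Longrightarrow> holo3 g D \<Longrightarrow> holo3 (\<lambda>z. f z + g z) D"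
  by (auto simp: holo3_iff_sep_holo sep_holo_def intro!: continuous_intros derivative_intros)

lemma holo3_diff: "open D \<Longrightarrow> holo3 f D \<Longrightarrow> holo3 g D \<Longrightarrow> holo3 (\<lambda>z. f z - g z) D"
  by (auto simp: holo3_iff_sep_holo sep_holo_def intro!: continuous_intros derivative_intros)

lemma holo3_divide:
  "open D \<Longrightarrow> holo3 f D \<Longrightarrow> holo3 g D \<Longrightarrow> (\<And>z. z \<in> D \<Longrightarrow> g z \<noteq> 0) \<Longrightarrow> holo3 (\<lambda>z. f z / g z) D"
  by (auto simp: holo3_iff_sep_holo sep_holo_def intro!: continuous_intros derivative_intros)

lemma has_derivative_vec:
  fixes F :: "'a::real_normed_vector \<Rightarrow> complex^'n::finite"
  assumes "\<And>i. ((\<lambda>z. F z $ i) has_derivative (\<lambda>h. G h $ i)) (at z)"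
  shows "(F has_derivative G) (at z)"
proof -
  have "((\<lambda>z. \<Sum>i\<in>UNIV. axis i (F z $ i)) has_derivative (\<lambda>h. \<Sum>i\<in>UNIV. axis i (G h $ i))) (at z)"
    by (intro has_derivative_sum bounded_linear.has_derivative[OF bounded_linear_axis] assms)
  then show ?thesis
    by (simp flip: vec_eq_sum_axis)
qed

text \<open>\<open>jacobian\<close> is read off from the Frechet derivative, while this matrix is
  built from the partial derivatives; for maps with holomorphic components the two agree.\<close>

definition jac :: "(complex^3 \<Rightarrow> complex^3) \<Rightarrow> complex^3 \<Rightarrow> complex^3^3" where
  "jac F z = (\<chi> i j. partial j (\<lambda>z. F z $ i) z)"

lemma has_derivative_jac:
  assumes "\<And>i. holo3 (\<lambda>z. F z $ i) D" "open D" "z \<in> D"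
  shows "(F has_derivative (\<lambda>h. jac F z *v h)) (at z)"
  by (rule has_derivative_vec)
    (use holo3_has_derivative[OF assms] in \<open>simp add: jac_def matrix_vector_mult_def\<close>)

lemma jacobian_eq_jac:
  assumes "\<And>i. holo3 (\<lambda>z. F z $ i) D" "open D" "z \<in> D"
  shows "jacobian F (at z) = jac F z"
  using frechet_derivative_at[OF has_derivative_jac[OF assms]]
  by (metis jacobian_def matrix_of_matrix_vector_mul)

lemma holo3_compose:
  assumes F: "\<And>i. holo3 (\<lambda>z. F z $ i) D" and D: "open D" and FD: "F ` D \<subseteq> E"
    and g: "holo3 g E" and E: "open E"
  shows "holo3 (\<lambda>z. g (F z)) D"
  unfolding holo3_def
proof
  fix z
  assume z: "z \<in> D"
  have "((\<lambda>z. g (F z)) has_derivative (\<lambda>h. \<Sum>i\<in>UNIV. partial i g (F z) * (jac F z *v h)$i)) (at z)"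
    using FD z by (intro has_derivative_compose[OF has_derivative_jac[OF F D z]] holo3_has_derivative[OF g E]) auto
  also have "(\<lambda>h. \<Sum>i\<in>UNIV. partial i g (F z) * (jac F z *v h)$i) =
     (\<lambda>h. \<Sum>j\<in>UNIV. (\<chi> j. \<Sum>i\<in>UNIV. partial i g (F z) * jac F z $ i $ j) $ j * h$j)"
    by (rule ext, simp add: matrix_vector_mult_def sum_distrib_left sum_distrib_right mult.assoc)
      (rule sum.swap)
  finally show "\<exists>a. ((\<lambda>z. g (F z)) has_derivative (\<lambda>h. \<Sum>i\<in>UNIV. a$i * h$i)) (at z)"
    by blast
qed

text \<open>On each complex coordinate line this is the one-variable theorem of Weierstrass, and
  joint continuity passes to the uniform limit.\<close>

lemma holo3_uniform_limit:
  assumes f: "\<And>n. holo3 (f n) D" and D: "open D" and lim: "uniform_limit D f g sequentially"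
  shows "holo3 g D"
proof -
  have f': "sep_holo (f n) D" for n
    using f D holo3_iff_sep_holo by blast
  have "continuous_on D g"
    using f' by (intro uniform_limit_theorem[OF _ lim]) (auto simp: sep_holo_def)
  moreover have "(\<lambda>\<zeta>. g (z + axis i \<zeta>)) field_differentiable at 0" if z: "z \<in> D" for z i
  proof -
    define S where "S = (\<lambda>\<zeta>. z + axis i \<zeta>) -` D"
    have S: "open S"
      unfolding S_def by (intro open_vimage D continuous_intros)
    have "(\<lambda>\<zeta>. g (z + axis i \<zeta>)) holomorphic_on S"
    proof (rule holomorphic_uniform_sequence[OF S])
      show "(\<lambda>\<zeta>. f n (z + axis i \<zeta>)) holomorphic_on S" for n
        by (rule sep_holo_line_holomorphic[OF f']) (simp add: S_def)
      fix x
      assume "x \<in> S"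
      then obtain d where d: "d > 0" "cball x d \<subseteq> S"
        using S open_contains_cball by blast
      have "uniform_limit (cball x d) (\<lambda>n \<zeta>. f n (z + axis i \<zeta>)) (\<lambda>\<zeta>. g (z + axis i \<zeta>)) sequentially"
        using d(2) by (intro uniform_limit_compose'[OF lim]) (auto simp: S_def)
      with d show "\<exists>d>0. cball x d \<subseteq> S \<and>
          uniform_limit (cball x d) (\<lambda>n \<zeta>. f n (z + axis i \<zeta>)) (\<lambda>\<zeta>. g (z + axis i \<zeta>)) sequentially"
        by blast
    qed
    then show ?thesis
      using S z by (intro holomorphic_on_imp_differentiable_at[OF _ S]) (auto simp: S_def)
  qed
  ultimately show ?thesis
    using D by (auto simp: holo3_iff_sep_holo sep_holo_def)
qed

text \<open>Cauchy's estimate on the disc of radius \<open>1 / c\<close> in the complex direction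
  \<open>k\<close>. The disc stays in the polydisc of radii \<open>w\<close> around
  \<open>z\<close>, so the bound is in the \<open>w\<close>-weighted maximum norm and contains no
  factor for the number of coordinates.\<close>

lemma holo3_directional_bound:
  assumes f: "holo3 f D" and D: "open D" and bd: "\<And>z. z \<in> D \<Longrightarrow> norm (f z) \<le> M"
    and zD: "\<And>h. (\<And>i. norm (h $ i) \<le> w i) \<Longrightarrow> z + h \<in> D"
    and c: "\<And>i. norm (k $ i) \<le> c * w i" and "c > 0"
  shows "norm (\<Sum>i\<in>UNIV. partial i f z * k$i) \<le> M * c"
proof -
  define u where "u = (\<lambda>\<zeta>. f (z + \<zeta> *s k))"
  have inD: "z + \<zeta> *s k \<in> D" if "\<zeta> \<in> cball 0 (1 / c)" for \<zeta>
  proof (rule zD)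
    fix i
    have "norm \<zeta> * norm (k $ i) \<le> (1 / c) * (c * w i)"
      using that c \<open>c > 0\<close> by (intro mult_mono) auto
    also have "(1 / c) * (c * w i) = w i"
      using \<open>c > 0\<close> by simp
    finally show "norm ((\<zeta> *s k) $ i) \<le> w i"
      by (simp only: vector_smult_component norm_mult)
  qed
  have u: "(u has_field_derivative (\<Sum>i\<in>UNIV. partial i f (z + \<zeta> *s k) * k$i)) (at \<zeta>)"
    if "\<zeta> \<in> cball 0 (1 / c)" for \<zeta>
    unfolding u_def by (rule holo3_line[OF f D inD[OF that]])
  have "norm (deriv u 0) \<le> M / (1 / c)"
  proof (rule cauchy_deriv_bound)
    show "u holomorphic_on cball 0 (1 / c)"
      unfolding holomorphic_on_def field_differentiable_def
      using u has_field_derivative_at_within by blast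
    show "norm (u x) \<le> M" if "norm (0 - x) = 1 / c" for x
      using inD[of x] that bd by (simp add: u_def)
  qed (use \<open>c > 0\<close> in auto)
  moreover have "deriv u 0 = (\<Sum>i\<in>UNIV. partial i f z * k$i)"
    using DERIV_imp_deriv[OF u[of 0]] \<open>c > 0\<close> by simp
  ultimately show ?thesis
    by simp
qed

text \<open>Mean value inequality along the segment from \<open>z\<close> to \<open>z'\<close>, with
  the directional Cauchy bound at each of its points. \<open>S\<close> is the shrunken domain around
  whose points the polydiscs of radii \<open>w\<close> still fit into \<open>D\<close>. The case
  \<open>c = 0\<close> is separate because the Cauchy disc has radius \<open>1 / c\<close>.\<close>

lemma holo3_lipschitz:
  assumes f: "holo3 f D" and D: "open D" and bd: "\<And>z. z \<in> D \<Longrightarrow> norm (f z) \<le> M"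
    and S: "convex S" and w: "\<And>i. w i \<ge> 0"
    and SD: "\<And>z h. z \<in> S \<Longrightarrow> (\<And>i. norm (h $ i) \<le> w i) \<Longrightarrow> z + h \<in> D"
    and z: "z \<in> S" "z' \<in> S" and c: "\<And>i. norm (z' $ i - z $ i) \<le> c * w i" and "c \<ge> 0"
  shows "norm (f z' - f z) \<le> M * c"
proof (cases "c = 0")
  case True
  then have "z' = z"
    using c by (simp add: vec_eq_iff)
  with True show ?thesis
    by simp
next
  case False
  with \<open>c \<ge> 0\<close> have "c > 0"
    by simp
  define k where "k = z' - z"
  let ?I = "closed_segment 0 (1::complex)"
  have inS: "z + \<zeta> *s k \<in> S" if "\<zeta> \<in> ?I" for \<zeta>
  proof -
    have "\<exists>x\<ge>0. x \<le> 1 \<and> \<zeta> = of_real x"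
      using that unfolding in_segment by (auto simp: scaleR_conv_of_real)
    then obtain x where x: "\<zeta> = of_real x" "0 \<le> x" "x \<le> 1"
      by blast
    have "z + \<zeta> *s k = (1 - x) *\<^sub>R z + x *\<^sub>R z'"
      unfolding vec_eq_iff k_def x(1) vector_add_component vector_scaleR_component
      by (simp add: scaleR_conv_of_real algebra_simps)
    moreover have "(1 - x) *\<^sub>R z + x *\<^sub>R z' \<in> S"
      by (rule convexD[OF S z]) (use x in auto)
    ultimately show ?thesis
      by simp
  qed
  have "norm (f (z + 1 *s k) - f (z + 0 *s k)) \<le> M * c * norm (1 - 0 :: complex)"
  proof (rule field_differentiable_bound[where S = ?I])
    fix \<zeta> :: complex
    assume \<zeta>: "\<zeta> \<in> ?I"
    have "z + \<zeta> *s k \<in> D"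
      using SD[OF inS[OF \<zeta>], of 0] w by simp
    then show "((\<lambda>\<zeta>. f (z + \<zeta> *s k)) has_field_derivative (\<Sum>i\<in>UNIV. partial i f (z + \<zeta> *s k) * k$i)) (at \<zeta> within ?I)"
      by (rule has_field_derivative_at_within[OF holo3_line[OF f D]])
    show "norm (\<Sum>i\<in>UNIV. partial i f (z + \<zeta> *s k) * k$i) \<le> M * c"
      by (rule holo3_directional_bound[OF f D bd SD[OF inS[OF \<zeta>]] _ \<open>c > 0\<close>])
        (use c in \<open>auto simp: k_def\<close>)
  qed auto
  then show ?thesis
    by (simp add: k_def)
qed

subsection \<open>Fourier series on a strip\<close>

text \<open>Generated by the characters in the form used in \<open>fourier_coeff\<close>, so that
  vanishing of all Fourier coefficients extends to all trigonometric polynomials by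
  induction.\<close>

inductive trig_poly :: "(real \<Rightarrow> complex) \<Rightarrow> bool" where
  monomial: "trig_poly (\<lambda>x. c * exp (- \<i> * of_int k * of_real x))"
| add: "trig_poly f \<Longrightarrow> trig_poly g \<Longrightarrow> trig_poly (\<lambda>x. f x + g x)"

lemma trig_poly_mult:
  assumes "trig_poly f" "trig_poly g"
  shows "trig_poly (\<lambda>x. f x * g x)"
  using assms(1)
proof induction
  case (monomial c k)
  show ?case
    using assms(2)
  proof induction
    case (monomial c' k')
    have "(\<lambda>x. c * exp (- \<i> * of_int k * of_real x) * (c' * exp (- \<i> * of_int k' * of_real x))) =
        (\<lambda>x. c * c' * exp (- \<i> * of_int (k + k') * of_real x))"
      by (rule ext) (simp add: algebra_simps mult_exp_exp)
    then show ?case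
      using trig_poly.monomial[of "c * c'" "k + k'"] by simp
  next
    case (add f g)
    then show ?case
      using trig_poly.add[OF add.IH] by (simp add: ring_distribs)
  qed
next
  case (add f f')
  then show ?case
    using trig_poly.add[OF add.IH] by (simp add: ring_distribs)
qed

lemma trig_poly_const: "trig_poly (\<lambda>x. c)"
  using trig_poly.monomial[of c 0] by simp

lemma trig_poly_cos: "trig_poly (\<lambda>x. of_real (cos x))"
proof -
  have "complex_of_real (cos x) = 1/2 * exp (- \<i> * of_int 1 * of_real x) + 1/2 * exp (- \<i> * of_int (-1) * of_real x)" for x
    by (simp add: cos_exp_eq flip: cos_of_real)
  then show ?thesis
    by (simp only:) (intro trig_poly.intros)
qed

lemma trig_poly_sin: "trig_poly (\<lambda>x. of_real (sin x))"
proof -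
  have "complex_of_real (sin x) = \<i>/2 * exp (- \<i> * of_int 1 * of_real x) + (-\<i>/2) * exp (- \<i> * of_int (-1) * of_real x)" for x
    by (simp add: sin_exp_eq field_simps flip: sin_of_real)
  then show ?thesis
    by (simp only:) (intro trig_poly.intros)
qed

text \<open>A real linear form on the plane is determined by its values at 1 and
  \<open>\<i>\<close>, so on the circle it is a combination of cos and sin.\<close>

lemma trig_poly_real_polynomial:
  assumes "real_polynomial_function p"
  shows "trig_poly (\<lambda>x. of_real (p (cis x)))"
  using assms
proof induction
  case (linear f)
  have "f (cis x) = cos x * f 1 + sin x * f \<i>" for x
  proof -
    have "cis x = cos x *\<^sub>R 1 + sin x *\<^sub>R \<i>"
      by (simp add: complex_eq_iff)
    then show ?thesis
      using linear by (simp add: linear_simps)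
  qed
  then show ?case
    by (simp only: of_real_add of_real_mult)
      (intro trig_poly.add trig_poly_mult trig_poly_const trig_poly_cos trig_poly_sin)
qed (simp_all add: trig_poly_const trig_poly.add trig_poly_mult)

lemma trig_poly_polynomial:
  fixes g :: "complex \<Rightarrow> complex"
  assumes "polynomial_function g"
  shows "trig_poly (\<lambda>x. g (cis x))"
proof -
  have "real_polynomial_function (\<lambda>z. Re (g z))" "real_polynomial_function (\<lambda>z. Im (g z))"
    using assms bounded_linear_Re bounded_linear_Im unfolding polynomial_function_def o_def by auto
  then have "trig_poly (\<lambda>x. of_real (Re (g (cis x))) + \<i> * of_real (Im (g (cis x))))"
    by (intro trig_poly.add trig_poly_mult trig_poly_const trig_poly_real_polynomial)
  then show ?thesis
    by (simp flip: complex_eq)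
qed

text \<open>The function on the circle is \<open>h\<close> applied to the principal argument. Across
  the cut on the negative axis its continuity comes from a second expression, through the argument
  of \<open>- w\<close> shifted by \<pi>, which has its cut on the positive axis.\<close>

lemma continuous_on_circle:
  fixes h :: "real \<Rightarrow> 'a::topological_space"
  assumes h: "continuous_on UNIV h" and per: "\<And>x (m::int). h (x + 2 * pi * of_int m) = h x"
  obtains H where "continuous_on (sphere 0 1) H" "\<And>x. H (cis x) = h x"
proof
  define H where "H = (\<lambda>w. h (Im (Ln w)))"
  have *: "h a = h b" if eq: "exp (\<i> * of_real a) = exp (\<i> * of_real b)" for a b
  proof -
    obtain n :: int where "\<i> * of_real a = \<i> * of_real b + 2 * of_int n * of_real pi * \<i>"
      using eq unfolding exp_eq by auto
    then have "\<i> * of_real a = \<i> * of_real (b + 2 * pi * of_int n)"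
      by (simp add: algebra_simps)
    then have "a = b + 2 * pi * of_int n"
      by (metis complex_i_not_zero mult_left_cancel of_real_eq_iff)
    then show ?thesis
      using per by simp
  qed
  have exp_Im: "exp (\<i> * of_real (Im (Ln w))) = w" if "w \<in> sphere 0 1" for w
  proof -
    have "w \<noteq> 0"
      using that by auto
    then have "Ln w = \<i> * of_real (Im (Ln w))"
      using that by (intro complex_eqI) (auto simp: Re_Ln)
    then show ?thesis
      using that by (metis exp_Ln norm_zero mem_sphere_0 zero_neq_one)
  qed
  show "H (cis x) = h x" for x
    unfolding H_def by (rule *) (simp add: exp_Im, simp add: cis_conv_exp)
  have H': "H w = h (Im (Ln (- w)) + pi)" if "w \<in> sphere 0 1" for w
    unfolding H_def
  proof (rule *)
    have "exp (\<i> * of_real (Im (Ln (- w)) + pi)) = exp (\<i> * of_real (Im (Ln (- w)))) * exp (\<i> * pi)"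
      by (simp add: ring_distribs exp_add)
    then show "exp (\<i> * of_real (Im (Ln w))) = exp (\<i> * of_real (Im (Ln (- w)) + pi))"
      using that exp_Im[of w] exp_Im[of "- w"] by simp
  qed
  show "continuous_on (sphere 0 1) H"
  proof (rule continuous_on_subset)
    let ?A = "sphere 0 1 - \<real>\<^sub>\<le>\<^sub>0 :: complex set" and ?B = "sphere 0 1 - \<real>\<^sub>\<ge>\<^sub>0 :: complex set"
    have "continuous_on ?A H"
      unfolding H_def by (intro continuous_intros continuous_on_compose2[OF h]) auto
    moreover have "continuous_on ?B (\<lambda>w. h (Im (Ln (- w)) + pi))"
      by (intro continuous_intros continuous_on_compose2[OF h]) auto
    then have "continuous_on ?B H"
      by (rule continuous_on_eq) (simp add: H')
    moreover have "openin (top_of_set (?A \<union> ?B)) ?A" "openin (top_of_set (?A \<union> ?B)) ?B"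
      unfolding openin_open
      by (intro exI[of _ "- \<real>\<^sub>\<le>\<^sub>0"] exI[of _ "- \<real>\<^sub>\<ge>\<^sub>0"] conjI open_Compl;
          auto simp: complex_nonpos_Reals_iff complex_nonneg_Reals_iff complex_eq_iff)+
    ultimately show "continuous_on (?A \<union> ?B) H"
      by (intro continuous_on_Un_local_open)
    show "sphere 0 1 \<subseteq> ?A \<union> ?B"
      by (auto simp: complex_nonpos_Reals_iff complex_nonneg_Reals_iff complex_eq_iff norm_complex_def)
  qed
qed

text \<open>By Stone-Weierstrass the conjugate of \<open>h\<close> is within \<open>e\<close> of a
  trigonometric polynomial \<open>q\<close> on the circle. Since \<open>h * q\<close> integrates to
  0, the integral of |h|^2 is at most \<open>e\<close> times that of |h|, for every
  \<open>e > 0\<close>.\<close>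

lemma fourier_uniqueness:
  fixes h :: "real \<Rightarrow> complex"
  assumes h: "continuous_on UNIV h" and per: "\<And>x (m::int). h (x + 2 * pi * of_int m) = h x"
    and coeff: "\<And>k::int. integral {0..2*pi} (\<lambda>x. h x * exp (- \<i> * of_int k * of_real x)) = 0"
  shows "h x = 0"
proof -
  obtain H where H: "continuous_on (sphere 0 1) H" "\<And>x. H (cis x) = h x"
    using continuous_on_circle[OF h per] by blast
  have int: "f integrable_on {0..2*pi}" if "continuous_on UNIV f" for f :: "real \<Rightarrow> 'b::banach"
    using that by (intro integrable_continuous_real) (rule continuous_on_subset, auto)
  have trig: "continuous_on UNIV q \<and> integral {0..2*pi} (\<lambda>x. h x * q x) = 0" if "trig_poly q" for q
    using that
  proof induction
    case (monomial c k)
    have "(\<lambda>x. h x * (c * exp (- \<i> * of_int k * of_real x))) = (\<lambda>x. c * (h x * exp (- \<i> * of_int k * of_real x)))"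
      by auto
    then show ?case
      using coeff[of k] by (auto intro!: continuous_intros)
  next
    case (add f g)
    have "integral {0..2*pi} (\<lambda>x. h x * f x + h x * g x) = 0"
      using add by (subst integral_add) (auto intro!: int continuous_intros h)
    with add show ?case
      by (auto intro!: continuous_intros simp: ring_distribs)
  qed
  let ?I = "integral {0..2*pi} (\<lambda>x. (norm (h x))\<^sup>2)" and ?J = "integral {0..2*pi} (\<lambda>x. norm (h x))"
  have bound: "?I \<le> e * ?J" if "e > 0" for e
  proof -
    have "continuous_on (sphere 0 1) (\<lambda>w. cnj (H w))"
      by (intro continuous_intros H)
    then obtain g where g: "polynomial_function g" "\<And>w. w \<in> sphere 0 1 \<Longrightarrow> norm (cnj (H w) - g w) < e"
      using Stone_Weierstrass_polynomial_function[OF _ _ \<open>e > 0\<close>] by (metis compact_sphere)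
    let ?q = "\<lambda>x. g (cis x)"
    have q: "continuous_on UNIV ?q" "integral {0..2*pi} (\<lambda>x. h x * ?q x) = 0"
      using trig[OF trig_poly_polynomial[OF g(1)]] by auto
    have hq: "continuous_on UNIV (\<lambda>x. h x * (cnj (h x) - ?q x))"
      by (intro continuous_intros h q)
    have "of_real ?I = integral {0..2*pi} (\<lambda>x. of_real ((norm (h x))\<^sup>2) :: complex)"
      by (rule integral_unique[symmetric])
        (intro has_integral_of_real integrable_integral int continuous_intros h)
    also have "\<dots> = integral {0..2*pi} (\<lambda>x. h x * (cnj (h x) - ?q x) + h x * ?q x)"
      by (intro arg_cong2[where f = integral] refl ext)
        (metis (no_types) complex_norm_square diff_add_cancel ring_class.ring_distribs(1))
    also have "\<dots> = integral {0..2*pi} (\<lambda>x. h x * (cnj (h x) - ?q x))"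
      using q(2) by (subst integral_add) (auto intro!: int hq continuous_intros h q)
    finally have I: "of_real ?I = integral {0..2*pi} (\<lambda>x. h x * (cnj (h x) - ?q x))" .
    have "norm (h x * (cnj (h x) - ?q x)) \<le> e * norm (h x)" for x
      using g(2)[of "cis x"] by (simp add: norm_mult H(2) mult.commute[of e] mult_left_mono)
    then have "norm (complex_of_real ?I) \<le> integral {0..2*pi} (\<lambda>x. e * norm (h x))"
      unfolding I
      by (intro Henstock_Kurzweil_Integration.integral_norm_bound_integral int hq continuous_intros h)
    then show ?thesis
      by simp
  qed
  have "?I \<le> 0"
  proof (rule ccontr)
    assume "\<not> ?I \<le> 0"
    moreover have "?J \<ge> 0"
      by (intro integral_nonneg int continuous_intros h) auto
    \<comment> \<open>\<open>e\<close> is taken so small that \<open>e * ?J\<close> is less than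
      \<open>?I\<close>; the \<open>+ 1\<close> avoids dividing by zero.\<close>
    ultimately have "?I \<le> ?I / (2 * (?J + 1)) * ?J"
      by (intro bound) (auto intro!: divide_pos_pos)
    also have "\<dots> < ?I"
      using \<open>\<not> ?I \<le> 0\<close> \<open>?J \<ge> 0\<close> by (simp add: field_simps add_pos_nonneg)
    finally show False
      by simp
  qed
  moreover have "?I \<ge> 0"
    by (intro integral_nonneg int continuous_intros h) auto
  ultimately have "?I = 0"
    by linarith
  have zero: "h x = 0" if "x \<in> {0..2*pi}" for x
  proof -
    have "\<forall>x\<in>{0..2*pi}. (norm (h x))\<^sup>2 = 0"
      using \<open>?I = 0\<close> by (subst integral_eq_0_iff[symmetric])
        (auto intro!: continuous_intros continuous_on_subset[OF h])
    then show ?thesis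
      using that by simp
  qed
  define m where "m = \<lfloor>x / (2 * pi)\<rfloor>"
  have "of_int m \<le> x / (2 * pi)" "x / (2 * pi) \<le> of_int m + 1"
    unfolding m_def by linarith+
  then have "x + 2 * pi * of_int (- m) \<in> {0..2*pi}"
    by (simp add: field_simps)
  from zero[OF this] show ?thesis
    by (simp only: per)
qed

section \<open>Fourier series of holomorphic functions on a strip\<close>

lemma integral_exp_int:
  "integral {0..2*pi} (\<lambda>x. exp (\<i> * of_int n * complex_of_real x)) = (if n = 0 then of_real (2 * pi) else 0)"
proof (cases "n = 0")
  case False
  have "exp (\<i> * of_int n * complex_of_real (2 * pi)) = 1"
    using exp_integer_2pi[of "of_int n"] by (simp add: mult_ac)
  with False Kronecker_Approximation_Theorem.integral_exp[of "2*pi" "\<i> * of_int n"] show ?thesis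
    by simp
qed (simp add: scaleR_conv_of_real)

lemma norm_exp_strip:
  assumes "\<bar>Im z\<bar> < s"
  shows "norm (exp (\<i> * of_int k * z)) \<le> exp (\<bar>of_int k\<bar> * s)"
proof -
  have "- (of_int k * Im z) \<le> \<bar>of_int k\<bar> * \<bar>Im z\<bar>"
    by (metis abs_ge_minus_self abs_mult)
  also have "\<dots> \<le> \<bar>of_int k\<bar> * s"
    using assms by (intro mult_left_mono) auto
  finally show ?thesis
    by simp
qed

lemma open_strip: "open {z. \<bar>Im z\<bar> < s}"
  by (intro open_Collect_less continuous_intros)

lemma convex_strip: "convex {z. \<bar>Im z\<bar> < s}"
proof -
  have "{z. \<bar>Im z\<bar> < s} = {z. Im z < s} \<inter> {z. Im z > - s}"
    by auto
  then show ?thesis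
    by (simp add: convex_Int convex_halfspace_Im_lt convex_halfspace_Im_gt)
qed

text \<open>The weighted summability is an M-test on the whole strip, so the series of
  \<open>F\<close> converges uniformly to a holomorphic \<open>g\<close> with the same coefficients.
  Uniqueness gives \<open>F = g\<close> on the real line, and the identity theorem extends this to
  the strip; the bound is then taken term by term.\<close>

lemma fourier_series_bound:
  fixes F :: "complex \<Rightarrow> complex" and M :: "int \<Rightarrow> real" and s :: real
  defines "S \<equiv> {z. \<bar>Im z\<bar> < s}"
  defines "c \<equiv> \<lambda>k::int. integral {0..2*pi} (\<lambda>x::real. F x * exp (- \<i> * of_int k * x)) / of_real (2 * pi)"
  assumes F: "F holomorphic_on S" and per: "\<And>z (m::int). z \<in> S \<Longrightarrow> F (z + of_real (2 * pi * of_int m)) = F z"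
    and c_le: "\<And>k. norm (c k) \<le> M k" and summable: "(\<lambda>k. M k * exp (\<bar>of_int k\<bar> * s)) summable_on UNIV"
    and z: "z \<in> S"
  shows "norm (F z) \<le> (\<Sum>\<^sub>\<infinity>k. M k * exp (\<bar>of_int k\<bar> * s))"
proof -
  have S: "open S" "convex S"
    unfolding S_def by (rule open_strip convex_strip)+
  have "s > 0"
    using z by (auto simp: S_def)
  then have real_S: "of_real x \<in> S" for x
    by (simp add: S_def)
  define e where "e = (\<lambda>k z. c k * exp (\<i> * of_int k * z))"
  define g where "g = (\<lambda>z. \<Sum>\<^sub>\<infinity>k. e k z)"
  have e_le: "norm (e k z) \<le> M k * exp (\<bar>of_int k\<bar> * s)" if "z \<in> S" for k z
    unfolding e_def norm_mult
    by (intro mult_mono c_le norm_exp_strip) (use that c_le[of k] norm_ge_zero[of "c k"] in \<open>auto simp: S_def simp del: norm_ge_zero\<close>)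
  have lim: "uniform_limit S (\<lambda>X z. \<Sum>k\<in>X. e k z) g (finite_subsets_at_top UNIV)"
    unfolding g_def by (rule Weierstrass_m_test_general[OF e_le summable])
  have e_hol: "e k holomorphic_on A" for k A
    unfolding e_def by (intro holomorphic_intros)
  have g_hol: "g holomorphic_on S"
  proof -
    have "g field_differentiable at w" if w: "w \<in> S" for w
    proof -
      obtain r where r: "r > 0" "cball w r \<subseteq> S"
        using S(1) w open_contains_cball by blast
      have ev: "\<forall>\<^sub>F X in finite_subsets_at_top UNIV. continuous_on (cball w r) (\<lambda>z. \<Sum>k\<in>X. e k z) \<and> (\<lambda>z. \<Sum>k\<in>X. e k z) holomorphic_on ball w r"
        by (intro always_eventually allI conjI holomorphic_on_imp_continuous_on holomorphic_on_sum e_hol)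
      have "g holomorphic_on ball w r"
        by (rule holomorphic_uniform_limit[OF ev uniform_limit_on_subset[OF lim r(2)]]) simp_all
      then show ?thesis
        by (rule holomorphic_on_imp_differentiable_at) (use r in auto)
    qed
    then show ?thesis
      unfolding holomorphic_on_def by (blast intro: field_differentiable_at_within)
  qed
  have cont_real: "continuous_on A (\<lambda>x. f (of_real x))" if "f holomorphic_on S" for f :: "complex \<Rightarrow> complex" and A
    by (rule continuous_on_compose2[OF holomorphic_on_imp_continuous_on[OF that]])
      (auto intro!: continuous_intros simp: real_S)
  have g_coeff: "integral {0..2*pi} (\<lambda>x. g (of_real x) * exp (- \<i> * of_int k * of_real x)) = of_real (2*pi) * c k" for k
  proof -
    let ?E = "\<lambda>x::real. exp (- \<i> * of_int k * of_real x)"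
    let ?s = "\<lambda>X x. \<Sum>j\<in>X. e j (of_real x) * ?E x"
    have "uniform_limit {0..2*pi} (\<lambda>X x. \<Sum>j\<in>X. e j (of_real x)) (\<lambda>x. g (of_real x)) (finite_subsets_at_top UNIV)"
      by (rule uniform_limit_compose'[OF lim]) (auto simp: real_S)
    then have "uniform_limit {0..2*pi} (\<lambda>X x. (\<Sum>j\<in>X. e j (of_real x)) * ?E x) (\<lambda>x. g (of_real x) * ?E x) (finite_subsets_at_top UNIV)"
    proof (intro uniform_lim_mult uniform_limit_const)
      show "bounded ((\<lambda>x. g (of_real x)) ` {0..2*pi})"
        by (intro compact_imp_bounded compact_continuous_image cont_real g_hol) simp
      show "bounded (?E ` {0..2*pi})"
        by (intro compact_imp_bounded compact_continuous_image continuous_intros) simp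
    qed
    then have ul: "uniform_limit {0..2*pi} ?s (\<lambda>x. g (of_real x) * ?E x) (finite_subsets_at_top UNIV)"
      by (simp only: sum_distrib_right)
    have cont: "continuous_on {0..2*pi} (?s X)" for X
      by (intro continuous_intros cont_real e_hol)
    obtain I J where IJ: "\<And>X. (?s X has_integral I X) {0..2*pi}"
        "((\<lambda>x. g (of_real x) * ?E x) has_integral J) {0..2*pi}" "(I \<longlongrightarrow> J) (finite_subsets_at_top UNIV)"
      by (rule uniform_limit_integral[OF ul cont]) auto
    \<comment> \<open>Orthogonality leaves only the term \<open>j = k\<close>. The finite sets
      containing \<open>k\<close> are cofinal, so \<open>I\<close> is eventually constant.\<close>
    have "I X = of_real (2*pi) * c k" if X: "finite X" "k \<in> X" for X
    proof -
      have "(\<lambda>x. e j (of_real x) * ?E x) = (\<lambda>x. c j * exp (\<i> * of_int (j - k) * of_real x))" for j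
        by (rule ext) (simp add: e_def algebra_simps mult_exp_exp)
      then have "integral {0..2*pi} (\<lambda>x. e j (of_real x) * ?E x) = (if j = k then of_real (2*pi) * c k else 0)" for j
        using integral_exp_int[of "j - k"] by simp
      moreover have "I X = (\<Sum>j\<in>X. integral {0..2*pi} (\<lambda>x. e j (of_real x) * ?E x))"
        using integral_unique[OF IJ(1)[of X]] X
        by (subst (asm) integral_sum) (auto intro!: integrable_continuous_real cont_real e_hol holomorphic_intros)
      ultimately show ?thesis
        using X by simp
    qed
    then have "\<forall>\<^sub>F X in finite_subsets_at_top UNIV. I X = of_real (2*pi) * c k"
      by (auto simp: eventually_finite_subsets_at_top intro!: exI[of _ "{k}"])
    then have "(I \<longlongrightarrow> of_real (2*pi) * c k) (finite_subsets_at_top UNIV)"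
      by (rule tendsto_eventually)
    with IJ(3) have "J = of_real (2*pi) * c k"
      by (rule tendsto_unique[rotated]) simp
    with IJ(2) show ?thesis
      by (simp add: integral_unique)
  qed
  define h where "h = (\<lambda>x::real. F (of_real x) - g (of_real x))"
  have h0: "h x = 0" for x
  proof (rule fourier_uniqueness)
    show "continuous_on UNIV h"
      unfolding h_def by (intro continuous_intros cont_real F g_hol)
    show "h (x + 2 * pi * of_int m) = h x" for x and m :: int
    proof -
      have "exp (\<i> * of_int k * of_real (x + 2 * pi * of_int m)) = exp (\<i> * of_int k * of_real x)" for k :: int
        unfolding exp_eq by (rule exI[of _ "k * m"]) (simp add: algebra_simps)
      then have "g (of_real (x + 2 * pi * of_int m)) = g (of_real x)"
        unfolding g_def e_def by (simp only:)
      then show ?thesis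
        using per[OF real_S, of x m] by (simp add: h_def)
    qed
    show "integral {0..2*pi} (\<lambda>x. h x * exp (- \<i> * of_int k * of_real x)) = 0" for k
    proof -
      have "integral {0..2*pi} (\<lambda>x. h x * exp (- \<i> * of_int k * of_real x)) =
          integral {0..2*pi} (\<lambda>x. F x * exp (- \<i> * of_int k * of_real x)) -
          integral {0..2*pi} (\<lambda>x. g x * exp (- \<i> * of_int k * of_real x))"
        unfolding h_def left_diff_distrib
        by (intro integral_diff integrable_continuous_real continuous_intros cont_real F g_hol)
      then show ?thesis
        unfolding g_coeff by (simp add: c_def)
    qed
  qed
  \<comment> \<open>The identity theorem needs an accumulation point of the set on which
    \<open>F\<close> and \<open>g\<close> agree.\<close>
  have lim0: "(0::complex) islimpt \<real>"
    unfolding islimpt_approachable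
  proof (intro allI impI)
    fix r :: real
    assume "r > 0"
    then show "\<exists>x'\<in>\<real>. x' \<noteq> (0::complex) \<and> dist x' 0 < r"
      by (intro bexI[of _ "of_real (r / 2)"]) auto
  qed
  have sub: "\<real> \<subseteq> S"
    using real_S by (auto simp: Reals_def)
  have zero: "F x - g x = 0" if x: "x \<in> \<real>" for x
  proof -
    obtain y where "x = of_real y"
      using x by (rule Reals_cases)
    with h0[of y] show ?thesis
      by (simp add: h_def)
  qed
  have hol: "(\<lambda>z. F z - g z) holomorphic_on S"
    by (intro holomorphic_intros F g_hol)
  have "0 \<in> S"
    using real_S[of 0] by simp
  from analytic_continuation[OF hol S(1) convex_connected[OF S(2)] sub this lim0 zero z]
  have "F z - g z = 0" .
  then have F_eq: "F z = (\<Sum>\<^sub>\<infinity>k. e k z)"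
    by (simp add: g_def)
  have abs: "(\<lambda>k. norm (e k z)) summable_on UNIV"
    by (rule summable_on_comparison_test[OF summable]) (use e_le[OF z] in auto)
  have "norm (\<Sum>\<^sub>\<infinity>k. e k z) \<le> (\<Sum>\<^sub>\<infinity>k. norm (e k z))"
    by (rule norm_infsum_bound[OF abs])
  also have "\<dots> \<le> (\<Sum>\<^sub>\<infinity>k. M k * exp (\<bar>of_int k\<bar> * s))"
    by (rule infsum_mono[OF abs summable e_le[OF z]])
  finally show ?thesis
    unfolding F_eq .
qed

subsection \<open>Complex neighbourhoods and phase domains\<close>

lemma cnbhd_iff: "w \<in> cnbhd A r \<longleftrightarrow> (\<exists>x\<in>A. norm (w - of_real x) < r)"
  by (auto simp: cnbhd_def dist_norm norm_minus_commute)

lemma open_cnbhd: "open (cnbhd A r)"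
  by (auto simp: cnbhd_def)

text \<open>This is what lets all path integrals run along straight segments from the
  section.\<close>

lemma convex_cnbhd:
  assumes "convex A"
  shows "convex (cnbhd A r)"
  unfolding convex_def
proof (intro ballI allI impI)
  fix w w' and u v :: real
  assume "w \<in> cnbhd A r" "w' \<in> cnbhd A r" and uv: "0 \<le> u" "0 \<le> v" "u + v = 1"
  then obtain x x' where x: "x \<in> A" "norm (w - of_real x) < r" and x': "x' \<in> A" "norm (w' - of_real x') < r"
    by (auto simp: cnbhd_iff)
  have "u *\<^sub>R w + v *\<^sub>R w' - of_real (u * x + v * x') = u *\<^sub>R (w - of_real x) + v *\<^sub>R (w' - of_real x')"
    by (simp add: scaleR_conv_of_real algebra_simps)
  also have "norm \<dots> \<le> u * norm (w - of_real x) + v * norm (w' - of_real x')"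
    using uv by (metis abs_of_nonneg norm_scaleR norm_triangle_ineq)
  also have "\<dots> < r"
    using x x' uv by (intro convex_bound_lt) auto
  finally show "u *\<^sub>R w + v *\<^sub>R w' \<in> cnbhd A r"
    unfolding cnbhd_iff by (intro bexI[of _ "u * x + v * x'"]) (use convexD[OF assms x(1) x'(1) uv] in auto)
qed

lemma cnbhd_mono: "r \<le> r' \<Longrightarrow> cnbhd A r \<subseteq> cnbhd A r'"
  by (force simp: cnbhd_iff)

lemma cnbhd_add: "w \<in> cnbhd A r \<Longrightarrow> norm h \<le> e \<Longrightarrow> w + h \<in> cnbhd A (r + e)"
proof -
  assume "w \<in> cnbhd A r" and h: "norm h \<le> e"
  then obtain x where x: "x \<in> A" "norm (w - of_real x) < r"
    by (auto simp: cnbhd_iff)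
  have "norm (w + h - of_real x) \<le> norm (w - of_real x) + norm h"
    by (metis add_diff_eq diff_add_eq norm_triangle_ineq)
  with x h show ?thesis
    unfolding cnbhd_iff by (intro bexI[of _ x]) auto
qed

lemma of_real_in_cnbhd: "x \<in> A \<Longrightarrow> r > 0 \<Longrightarrow> of_real x \<in> cnbhd A r"
  by (auto simp: cnbhd_iff intro!: bexI[of _ x])

lemma vector_3_eq_axis: "(vector [a, b, c] :: complex^3) = axis 1 a + axis 2 b + axis 3 c"
  by (simp add: vec_eq_iff forall_3 axis_def)

lemma vector_3_eta [simp]: "vector [z$1, z$2, z$3] = (z :: complex^3)"
  by (simp add: vec_eq_iff forall_3)

lemma vector_3_add_axis:
  "(vector [a, b, c] + axis 1 \<zeta> :: complex^3) = vector [a + \<zeta>, b, c]"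
  "(vector [a, b, c] + axis 2 \<zeta> :: complex^3) = vector [a, b + \<zeta>, c]"
  "(vector [a, b, c] + axis 3 \<zeta> :: complex^3) = vector [a, b, c + \<zeta>]"
  by (simp_all add: vec_eq_iff forall_3 axis_def)

lemma mem_phase_dom:
  "z \<in> phase_dom II YY r \<sigma> s \<longleftrightarrow> z$1 \<in> cnbhd II r \<and> z$2 \<in> cnbhd YY \<sigma> \<and> \<bar>Im (z$3)\<bar> < s"
  by (simp add: phase_dom_def base_dom_def)

lemma open_phase_dom: "open (phase_dom II YY r \<sigma> s)"
proof -
  have "phase_dom II YY r \<sigma> s =
      (\<lambda>z. z$1) -` cnbhd II r \<inter> (\<lambda>z. z$2) -` cnbhd YY \<sigma> \<inter> (\<lambda>z. z$3) -` {w. \<bar>Im w\<bar> < s}"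
    by (auto simp: mem_phase_dom)
  then show ?thesis
    by (simp only:) (intro open_Int open_vimage open_cnbhd open_strip continuous_intros)
qed

lemma convex_phase_dom:
  assumes "convex II" "convex YY"
  shows "convex (phase_dom II YY r \<sigma> s)"
  unfolding convex_def
proof (intro ballI allI impI)
  fix x y u v
  assume xy: "x \<in> phase_dom II YY r \<sigma> s" "y \<in> phase_dom II YY r \<sigma> s"
    and uv: "0 \<le> u" "0 \<le> v" "u + v = (1::real)"
  have "u *\<^sub>R x$1 + v *\<^sub>R y$1 \<in> cnbhd II r" "u *\<^sub>R x$2 + v *\<^sub>R y$2 \<in> cnbhd YY \<sigma>"
    "u *\<^sub>R x$3 + v *\<^sub>R y$3 \<in> {w. \<bar>Im w\<bar> < s}"
    using xy uv by (intro convexD convex_cnbhd convex_strip assms; simp add: mem_phase_dom)+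
  then show "u *\<^sub>R x + v *\<^sub>R y \<in> phase_dom II YY r \<sigma> s"
    by (simp add: mem_phase_dom)
qed

text \<open>Bookkeeping of domain losses. For the angle only the imaginary part counts, since the
  strip is invariant under real translations.\<close>

lemma phase_dom_add:
  assumes "z \<in> phase_dom II YY r \<sigma> s" "norm (h$1) \<le> e1" "norm (h$2) \<le> e2" "\<bar>Im (h$3)\<bar> \<le> e3"
  shows "z + h \<in> phase_dom II YY (r + e1) (\<sigma> + e2) (s + e3)"
  using assms cnbhd_add[of "z$1" II r "h$1" e1] cnbhd_add[of "z$2" YY \<sigma> "h$2" e2]
  by (auto simp: mem_phase_dom)

lemma phase_dom_mono:
  "r \<le> r' \<Longrightarrow> \<sigma> \<le> \<sigma>' \<Longrightarrow> s \<le> s' \<Longrightarrow> phase_dom II YY r \<sigma> s \<subseteq> phase_dom II YY r' \<sigma>' s'"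
  using cnbhd_mono[of r r' II] cnbhd_mono[of \<sigma> \<sigma>' YY] by (auto simp: mem_phase_dom)

section \<open>Pointwise bounds from the sup norm and the Fourier norm\<close>

lemma sup_norm_upper:
  assumes "sup_bdd B g" "(a, y) \<in> B"
  shows "norm (g a y) \<le> sup_norm B g"
  using cSUP_upper[OF assms(2), of "\<lambda>(a, y). cmod (g a y)"] assms(1)
  by (simp add: sup_bdd_def sup_norm_def)

lemma base_dom_nonempty:
  assumes "II \<noteq> {}" "YY \<noteq> {}" "r > 0" "\<sigma> > 0"
  shows "base_dom II YY r \<sigma> \<noteq> {}"
  using assms of_real_in_cnbhd by (fastforce simp: base_dom_def)

lemma fourier_norm_nonneg:
  assumes "f \<in> O_space II YY r \<sigma> s" "base_dom II YY r \<sigma> \<noteq> {}"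
  shows "fourier_norm II YY r \<sigma> s f \<ge> 0"
proof -
  obtain a y where "(a, y) \<in> base_dom II YY r \<sigma>"
    using assms(2) by (metis ex_in_conv prod.exhaust)
  then have "sup_norm (base_dom II YY r \<sigma>) (fourier_coeff f k) \<ge> 0" for k
    using assms(1) sup_norm_upper[of "base_dom II YY r \<sigma>" "fourier_coeff f k" a y]
      norm_ge_zero[of "fourier_coeff f k a y"]
    by (auto simp: O_space_def simp del: norm_ge_zero)
  then show ?thesis
    unfolding fourier_norm_def by (intro infsum_nonneg) auto
qed

text \<open>Fourier series in the angle for fixed first two coordinates, with the sup norms of the
  coefficients as majorants.\<close>

lemma norm_le_fourier_norm:
  assumes f: "f \<in> O_space II YY r \<sigma> s" and z: "z \<in> phase_dom II YY r \<sigma> s"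
  shows "norm (f z) \<le> fourier_norm II YY r \<sigma> s f"
proof -
  define F where "F = (\<lambda>\<phi>. f (vector [z$1, z$2, \<phi>]))"
  let ?S = "{\<phi>. \<bar>Im \<phi>\<bar> < s}"
  have dom: "vector [z$1, z$2, \<phi>] \<in> phase_dom II YY r \<sigma> s" if "\<phi> \<in> ?S" for \<phi>
    using z that by (simp add: mem_phase_dom)
  have "norm (F (z$3)) \<le> (\<Sum>\<^sub>\<infinity>k. sup_norm (base_dom II YY r \<sigma>) (fourier_coeff f k) * exp (\<bar>of_int k\<bar> * s))"
  proof (rule fourier_series_bound[where F = F and z = "z$3"])
    have "sep_holo f (phase_dom II YY r \<sigma> s)"
      using f by (simp add: O_space_def holo3_iff_sep_holo open_phase_dom)
    then have "(\<lambda>\<phi>. f (vector [z$1, z$2, 0] + axis 3 \<phi>)) holomorphic_on ?S"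
      by (rule sep_holo_line_holomorphic) (use dom in \<open>simp add: vector_3_add_axis\<close>)
    then show "F holomorphic_on ?S"
      by (simp add: F_def vector_3_add_axis)
    show "F (\<phi> + of_real (2 * pi * of_int m)) = F \<phi>" if "\<phi> \<in> ?S" for \<phi> m
    proof -
      have "torus_eq (vector [z$1, z$2, \<phi> + of_real (2 * pi * of_int m)]) (vector [z$1, z$2, \<phi>])"
        unfolding torus_eq_def by (auto intro!: exI[of _ m])
      then show ?thesis
        using f dom[OF that] dom[of "\<phi> + of_real (2 * pi * of_int m)"] that
        by (auto simp: O_space_def F_def)
    qed
    show "norm (integral {0..2*pi} (\<lambda>x::real. F x * exp (- \<i> * of_int k * x)) / of_real (2 * pi))
        \<le> sup_norm (base_dom II YY r \<sigma>) (fourier_coeff f k)" for k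
      using f z sup_norm_upper[of "base_dom II YY r \<sigma>" "fourier_coeff f k" "z$1" "z$2"]
      by (simp add: O_space_def F_def fourier_coeff_def phase_dom_def)
    show "(\<lambda>k. sup_norm (base_dom II YY r \<sigma>) (fourier_coeff f k) * exp (\<bar>of_int k\<bar> * s)) summable_on UNIV"
      using f by (simp add: O_space_def)
    show "z$3 \<in> ?S"
      using z by (simp add: mem_phase_dom)
  qed
  then show ?thesis
    by (simp add: F_def fourier_norm_def)
qed

subsection \<open>Integration along the second coordinate\<close>

text \<open>The primitive of \<open>f\<close> in the second variable that vanishes at
  \<open>y0\<close>. Parametrising the segment by the fixed interval from 0 to 1 puts the whole
  dependence on \<open>z\<close> into the integrand.\<close>

definition path_int :: "complex \<Rightarrow> (complex^3 \<Rightarrow> complex) \<Rightarrow> complex^3 \<Rightarrow> complex" where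
  "path_int y0 f z =
     integral {0..1} (\<lambda>x. f (vector [z$1, linepath y0 (z$2) x, z$3]) * (z$2 - y0))"

lemma phase_dom_linepath:
  assumes "convex YY" "y0 \<in> cnbhd YY \<sigma>" "z \<in> phase_dom II YY r \<sigma> s" "x \<in> {0..1}"
  shows "vector [z$1, linepath y0 (z$2) x, z$3] \<in> phase_dom II YY r \<sigma> s"
  using assms convexD[OF convex_cnbhd[OF assms(1)], of y0 \<sigma> "z$2" "1 - x" x]
  by (simp add: mem_phase_dom linepath_def)

lemma continuous_on_vector_3 [continuous_intros]:
  "continuous_on S f \<Longrightarrow> continuous_on S g \<Longrightarrow> continuous_on S h \<Longrightarrow>
     continuous_on S (\<lambda>x. vector [f x, g x, h x] :: complex^3)"
  unfolding vector_3_eq_axis by (intro continuous_intros)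

lemma continuous_on_linepath_param [continuous_intros]:
  "continuous_on S f \<Longrightarrow> continuous_on S g \<Longrightarrow> continuous_on S h \<Longrightarrow>
     continuous_on S (\<lambda>x. linepath (f x) (g x :: complex) (h x))"
  unfolding linepath_def by (intro continuous_intros)

context
  fixes II YY :: "real set" and r \<sigma> s :: real and y0 :: complex and D :: "(complex^3) set"
  assumes YY: "convex YY" and y0: "y0 \<in> cnbhd YY \<sigma>"
  defines "D \<equiv> phase_dom II YY r \<sigma> s"
begin

lemma path_int_integrand:
  assumes "continuous_on D f" "z \<in> D"
  shows "continuous_on {0..1} (\<lambda>x. f (vector [z$1, linepath y0 (z$2) x, z$3]) * (z$2 - y0))"
  by (intro continuous_intros continuous_on_compose2[OF assms(1)])
    (use phase_dom_linepath[OF YY y0] assms(2) in \<open>auto simp: D_def\<close>)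

lemma path_int_diff:
  assumes "continuous_on D f" "continuous_on D g" "z \<in> D"
  shows "path_int y0 (\<lambda>z. f z - g z) z = path_int y0 f z - path_int y0 g z"
  unfolding path_int_def left_diff_distrib
  by (intro integral_diff integrable_continuous_real) (rule path_int_integrand assms)+

lemma path_int_const: "path_int y0 (\<lambda>z. c) z = c * (z$2 - y0)"
  by (simp add: path_int_def)

text \<open>\<open>b\<close> majorises \<open>f\<close> as a function of the distance from
  \<open>y0\<close>, and \<open>B\<close> is its primitive. A constant majorant would not do: the
  Gronwall estimate needs an exponential one, the Picard differences need powers.\<close>

lemma norm_path_int_le:
  assumes f: "continuous_on D f" and z: "z \<in> D"
    and B: "\<And>t. (B has_real_derivative b t) (at t)"
    and b: "\<And>x. x \<in> {0..1} \<Longrightarrow> norm (f (vector [z$1, linepath y0 (z$2) x, z$3])) \<le> b (x * norm (z$2 - y0))"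
  shows "norm (path_int y0 f z) \<le> B (norm (z$2 - y0)) - B 0"
proof -
  let ?l = "norm (z$2 - y0)"
  have "((\<lambda>x. B (x * ?l)) has_real_derivative b (x * ?l) * ?l) (at x within {0..1})" for x
    by (rule DERIV_chain'[OF _ B]) (auto intro!: derivative_eq_intros)
  then have I: "((\<lambda>x. b (x * ?l) * ?l) has_integral B (1 * ?l) - B (0 * ?l)) {0..1}"
    by (intro fundamental_theorem_of_calculus)
      (auto simp: has_real_derivative_iff_has_vector_derivative[symmetric])
  have "norm (path_int y0 f z) \<le> integral {0..1} (\<lambda>x. b (x * ?l) * ?l)"
    unfolding path_int_def
  proof (rule Henstock_Kurzweil_Integration.integral_norm_bound_integral)
    show "(\<lambda>x. b (x * ?l) * ?l) integrable_on {0..1}"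
      using I by blast
    show "norm (f (vector [z$1, linepath y0 (z$2) x, z$3]) * (z$2 - y0)) \<le> b (x * ?l) * ?l" if "x \<in> {0..1}" for x
      unfolding norm_mult using b[OF that] by (intro mult_right_mono) auto
  qed (intro integrable_continuous_real path_int_integrand f z)
  then show ?thesis
    using integral_unique[OF I] by simp
qed

text \<open>In this variable the path itself moves. By convexity the integrand has a holomorphic
  primitive \<open>G\<close>, and the path integral becomes a difference of two values of
  \<open>G\<close>.\<close>

lemma path_int_partial_2:
  assumes f: "holo3 f D" and z: "z \<in> D"
  shows "((\<lambda>\<zeta>. path_int y0 f (z + axis 2 \<zeta>)) has_field_derivative f z) (at 0)"
proof -
  let ?f = "\<lambda>\<eta>. f (vector [z$1, \<eta>, z$3])" and ?Y = "cnbhd YY \<sigma>"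
  have "sep_holo f D"
    using f by (simp add: D_def holo3_iff_sep_holo open_phase_dom)
  then have "(\<lambda>\<eta>. f (vector [z$1, 0, z$3] + axis 2 \<eta>)) holomorphic_on ?Y"
    by (rule sep_holo_line_holomorphic) (use z in \<open>simp add: vector_3_add_axis D_def mem_phase_dom\<close>)
  then have "?f holomorphic_on ?Y"
    by (simp add: vector_3_add_axis)
  from holomorphic_convex_primitive'[OF convex_cnbhd[OF YY] open_cnbhd this]
  obtain G where "\<And>\<eta>. \<eta> \<in> ?Y \<Longrightarrow> (G has_field_derivative ?f \<eta>) (at \<eta> within ?Y)"
    by blast
  then have G: "(G has_field_derivative ?f \<eta>) (at \<eta>)" if "\<eta> \<in> ?Y" for \<eta>
    using that by (metis at_within_open open_cnbhd)
  have eq: "path_int y0 f (z + axis 2 \<zeta>) = G (z$2 + \<zeta>) - G y0" if "z$2 + \<zeta> \<in> ?Y" for \<zeta>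
  proof -
    let ?\<gamma> = "linepath y0 (z$2 + \<zeta>)"
    have \<gamma>: "?\<gamma> x \<in> ?Y" if "x \<in> {0..1}" for x
      using convexD[OF convex_cnbhd[OF YY] y0 \<open>z$2 + \<zeta> \<in> ?Y\<close>, of "1 - x" x] that
      by (simp add: linepath_def)
    have "((G \<circ> ?\<gamma>) has_vector_derivative (z$2 + \<zeta> - y0) * ?f (?\<gamma> x)) (at x within {0..1})"
      if "x \<in> {0..1}" for x
      by (rule field_vector_diff_chain_within[OF has_vector_derivative_linepath_within
            has_field_derivative_at_within[OF G[OF \<gamma>[OF that]]]])
    then have "((\<lambda>x. (z$2 + \<zeta> - y0) * ?f (?\<gamma> x)) has_integral (G \<circ> ?\<gamma>) 1 - (G \<circ> ?\<gamma>) 0) {0..1}"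
      by (intro fundamental_theorem_of_calculus[OF zero_le_one])
    from integral_unique[OF this]
    have "integral {0..1} (\<lambda>x. (z$2 + \<zeta> - y0) * ?f (?\<gamma> x)) = G (z$2 + \<zeta>) - G y0"
      by (simp only: o_def linepath_0' linepath_1')
    moreover have "(z + axis 2 \<zeta>)$1 = z$1" "(z + axis 2 \<zeta>)$2 = z$2 + \<zeta>" "(z + axis 2 \<zeta>)$3 = z$3"
      by (simp_all add: axis_def)
    ultimately show ?thesis
      unfolding path_int_def by (simp only: mult.commute[of _ "z$2 + \<zeta> - y0"])
  qed
  have "(G has_field_derivative f z) (at (0 + z$2))"
    using G[of "z$2"] z by (simp add: D_def mem_phase_dom)
  then have "((\<lambda>\<zeta>. G (\<zeta> + z$2)) has_field_derivative f z) (at 0)"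
    by (simp only: DERIV_shift)
  then have "((\<lambda>\<zeta>. G (\<zeta> + z$2) - G y0) has_field_derivative f z - 0) (at 0)"
    by (intro DERIV_diff DERIV_const)
  then have der: "((\<lambda>\<zeta>. G (z$2 + \<zeta>) - G y0) has_field_derivative f z) (at 0)"
    by (simp add: add.commute)
  have "\<forall>\<^sub>F \<zeta> in nhds 0. z$2 + \<zeta> \<in> ?Y"
  proof -
    have "open ((\<lambda>\<zeta>. z$2 + \<zeta>) -` ?Y)"
      by (intro open_vimage open_cnbhd continuous_intros)
    from eventually_nhds_in_open[OF this, of 0] show ?thesis
      using z by (simp add: D_def mem_phase_dom)
  qed
  then have ev: "\<forall>\<^sub>F \<zeta> in nhds 0. path_int y0 f (z + axis 2 \<zeta>) = G (z$2 + \<zeta>) - G y0"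
    by (rule eventually_mono) (rule eq)
  show ?thesis
    by (rule DERIV_cong_ev[THEN iffD2, OF refl ev refl der])
qed

text \<open>In the other two variables the path stays fixed, so one differentiates under the
  integral.\<close>

lemma holo3_path_int:
  assumes f: "holo3 f D"
  shows "holo3 (path_int y0 f) D"
proof -
  have D: "open D"
    by (simp add: D_def open_phase_dom)
  have f': "sep_holo f D" "continuous_on D f"
    using f D holo3_iff_sep_holo holo3_imp_continuous_on by blast+
  have dom: "vector [z$1, linepath y0 (z$2) x, z$3] \<in> D" if "z \<in> D" "x \<in> {0..1}" for z x
    using phase_dom_linepath[OF YY y0] that by (simp add: D_def)
  have "continuous_on (D \<times> cbox 0 1) (\<lambda>(z, x). f (vector [z$1, linepath y0 (z$2) x, z$3]) * (z$2 - y0))"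
    unfolding case_prod_unfold
    by (intro continuous_intros continuous_on_compose2[OF f'(2)]) (use dom in auto)
  then have "continuous_on D (path_int y0 f)"
    unfolding path_int_def[abs_def] using integral_continuous_on_param by fastforce
  moreover have "(\<lambda>\<zeta>. path_int y0 f (z + axis i \<zeta>)) field_differentiable at 0" if z: "z \<in> D" for z i
  proof (cases "i = 2")
    case True
    then show ?thesis
      using path_int_partial_2[OF f z] by (auto simp: field_differentiable_def)
  next
    case False
    obtain e where e: "e > 0" "ball z e \<subseteq> D"
      using D z open_contains_ball by blast
    have dom': "vector [z$1, linepath y0 (z$2) x, z$3] + axis i \<zeta> \<in> D" if "\<zeta> \<in> ball 0 e" "x \<in> {0..1}" for \<zeta> x
    proof -
      have "z + axis i \<zeta> \<in> D"
        using e that by (auto simp: dist_norm)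
      moreover have "vector [(z + axis i \<zeta>)$1, linepath y0 ((z + axis i \<zeta>)$2) x, (z + axis i \<zeta>)$3] =
          vector [z$1, linepath y0 (z$2) x, z$3] + axis i \<zeta>"
        using False by (simp add: vec_eq_iff forall_3 axis_def)
      ultimately show ?thesis
        using dom that by metis
    qed
    have eq: "path_int y0 f (z + axis i \<zeta>) =
        integral (cbox 0 1) (\<lambda>x. f (vector [z$1, linepath y0 (z$2) x, z$3] + axis i \<zeta>) * (z$2 - y0))" for \<zeta>
    proof -
      have "vector [(z + axis i \<zeta>)$1, linepath y0 ((z + axis i \<zeta>)$2) x, (z + axis i \<zeta>)$3] =
          vector [z$1, linepath y0 (z$2) x, z$3] + axis i \<zeta>" for x
        using False by (simp add: vec_eq_iff forall_3 axis_def)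
      moreover have "(z + axis i \<zeta>)$2 = z$2"
        using False by (simp add: axis_def)
      ultimately show ?thesis
        unfolding path_int_def by simp
    qed
    have "(\<lambda>\<zeta>. path_int y0 f (z + axis i \<zeta>)) field_differentiable at 0 within ball 0 e"
      unfolding eq
    proof (rule leibniz_rule_field_differentiable[where U = "ball 0 e"])
      show "((\<lambda>\<zeta>. f (vector [z$1, linepath y0 (z$2) x, z$3] + axis i \<zeta>) * (z$2 - y0)) has_field_derivative
          partial i f (vector [z$1, linepath y0 (z$2) x, z$3] + axis i \<zeta>) * (z$2 - y0)) (at \<zeta> within ball 0 e)"
        if "\<zeta> \<in> ball 0 e" "x \<in> cbox 0 1" for \<zeta> x
        using that dom'
        by (intro DERIV_cmult_right has_field_derivative_at_within[OF sep_holo_has_field_derivative[OF f'(1)]]) auto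
      show "(\<lambda>x. f (vector [z$1, linepath y0 (z$2) x, z$3] + axis i \<zeta>) * (z$2 - y0)) integrable_on cbox 0 1"
        if "\<zeta> \<in> ball 0 e" for \<zeta>
        by (intro integrable_continuous continuous_intros continuous_on_compose2[OF f'(2)])
          (use dom'[OF that] in auto)
      show "continuous_on (ball 0 e \<times> cbox 0 1)
          (\<lambda>(\<zeta>, x). partial i f (vector [z$1, linepath y0 (z$2) x, z$3] + axis i \<zeta>) * (z$2 - y0))"
        unfolding case_prod_unfold
        by (intro continuous_intros continuous_on_compose2[OF continuous_on_partial[OF f'(1) D, of i]])
          (use dom' in auto)
    qed (use e in auto)
    then show ?thesis
      using e by (simp add: at_within_open[of 0 "ball 0 e"])
  qed
  ultimately show ?thesis
    using D by (auto simp: holo3_iff_sep_holo sep_holo_def)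
qed

lemma path_int_real:
  assumes f: "\<And>z. z \<in> D \<Longrightarrow> (\<And>i. z$i \<in> \<real>) \<Longrightarrow> f z \<in> \<real>" and "continuous_on D f"
    and z: "z \<in> D" "\<And>i. z$i \<in> \<real>" and "y0 \<in> \<real>"
  shows "path_int y0 f z \<in> \<real>"
proof -
  let ?g = "\<lambda>x. f (vector [z$1, linepath y0 (z$2) x, z$3]) * (z$2 - y0)"
  have "?g x \<in> \<real>" if "x \<in> {0..1}" for x
  proof -
    have "linepath y0 (z$2) x \<in> \<real>"
      using z \<open>y0 \<in> \<real>\<close> by (auto simp: linepath_def scaleR_conv_of_real)
    then have "\<forall>i. (vector [z$1, linepath y0 (z$2) x, z$3] :: complex^3)$i \<in> \<real>"
      using z by (simp add: forall_3)
    then show ?thesis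
      using f phase_dom_linepath[OF YY y0, of z II r s x] z that \<open>y0 \<in> \<real>\<close> by (auto simp: D_def)
  qed
  then have "Im (?g x) = 0" if "x \<in> {0..1}" for x
    using that complex_is_Real_iff by blast
  then have "integral {0..1} (\<lambda>x. Im (?g x)) = integral {0..1} (\<lambda>x::real. 0::real)"
    by (intro integral_cong) auto
  moreover have "integral {0..1} (\<lambda>x. Im (?g x)) = Im (integral {0..1} ?g)"
    using integral_linear[OF integrable_continuous_real[OF path_int_integrand[OF assms(2) z(1)]] bounded_linear_Im]
    by (simp add: o_def)
  ultimately show ?thesis
    by (simp add: path_int_def complex_is_Real_iff)
qed

lemma path_int_shift:
  assumes "\<And>z. z \<in> D \<Longrightarrow> f (z + axis 3 c) = f z" and z: "z \<in> D"
  shows "path_int y0 f (z + axis 3 c) = path_int y0 f z"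
proof -
  have c: "(z + axis 3 c)$1 = z$1" "(z + axis 3 c)$2 = z$2" "(z + axis 3 c)$3 = z$3 + c"
    by (simp_all add: axis_def)
  have "f (vector [z$1, linepath y0 (z$2) x, z$3 + c]) = f (vector [z$1, linepath y0 (z$2) x, z$3])"
    if "x \<in> {0..1}" for x
    using assms(1)[of "vector [z$1, linepath y0 (z$2) x, z$3]"] phase_dom_linepath[OF YY y0, of z II r s x] z that
    by (simp add: D_def vector_3_add_axis)
  then show ?thesis
    unfolding path_int_def c by (intro integral_cong) auto
qed

end

subsection \<open>Variation of the normal field along segments\<close>

lemma norm_exp_minus_one_le: "norm (exp w - 1) \<le> norm w * exp (norm w)" for w :: complex
proof -
  have "norm (exp w - exp 0) \<le> exp (norm w) * norm (w - 0)"
  proof (rule field_differentiable_bound[where S = "cball 0 (norm w)"])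
    show "norm (exp z) \<le> exp (norm w)" if "z \<in> cball 0 (norm w)" for z :: complex
      using norm_exp[of z] that by simp
  qed (auto intro: DERIV_exp has_field_derivative_at_within)
  then show ?thesis
    by (simp add: mult.commute)
qed

text \<open>On the convex set \<open>U\<close> the zero-free \<open>f\<close> has a holomorphic
  logarithm \<open>g\<close> with \<open>g' = f' / f\<close>, so ratios of values of
  \<open>f\<close> are exponentials of increments of \<open>g\<close>, which are at most
  \<open>E\<close> on the unit segment.\<close>

lemma log_deriv_bound:
  fixes f :: "complex \<Rightarrow> complex"
  assumes U: "convex U" "open U" "0 \<in> U" "1 \<in> U"
    and f: "\<And>\<zeta>. \<zeta> \<in> U \<Longrightarrow> (f has_field_derivative f' \<zeta>) (at \<zeta>)" and nz: "\<And>\<zeta>. \<zeta> \<in> U \<Longrightarrow> f \<zeta> \<noteq> 0"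
    and f': "\<And>\<zeta>. \<zeta> \<in> U \<Longrightarrow> norm (f' \<zeta> / f \<zeta>) \<le> E"
  shows "norm (f 1 / f 0 - 1) \<le> E * exp E"
    and "\<zeta> \<in> closed_segment 0 1 \<Longrightarrow> norm (f \<zeta>) \<le> exp E * norm (f 0)"
proof -
  have "f holomorphic_on U"
    using f U(2) by (auto simp: holomorphic_on_open)
  from holomorphic_logarithm_exists[OF U(1,2) this nz U(3)]
  obtain g where g: "g holomorphic_on U" "\<And>x. x \<in> U \<Longrightarrow> exp (g x) = f x"
    by metis
  have seg: "closed_segment 0 1 \<subseteq> U"
    using U by (simp add: closed_segment_subset)
  have dg: "(g has_field_derivative f' \<zeta> / f \<zeta>) (at \<zeta>)" if \<zeta>: "\<zeta> \<in> U" for \<zeta>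
  proof -
    have g': "(g has_field_derivative deriv g \<zeta>) (at \<zeta>)"
      using g(1) U(2) \<zeta> holomorphic_derivI by blast
    have "((\<lambda>x. exp (g x)) has_field_derivative exp (g \<zeta>) * deriv g \<zeta>) (at \<zeta>)"
      by (rule DERIV_chain2[OF DERIV_exp g'])
    then have "(f has_field_derivative exp (g \<zeta>) * deriv g \<zeta>) (at \<zeta>)"
      by (rule has_field_derivative_transform_within_open[OF _ U(2) \<zeta>]) (rule g(2))
    then have "exp (g \<zeta>) * deriv g \<zeta> = f' \<zeta>"
      using f[OF \<zeta>] DERIV_unique by blast
    then have "deriv g \<zeta> = f' \<zeta> / f \<zeta>"
      using g(2)[OF \<zeta>] nz[OF \<zeta>] by (simp add: field_simps)
    with g' show ?thesis
      by simp
  qed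
  have diff: "norm (g \<zeta> - g 0) \<le> E" if \<zeta>: "\<zeta> \<in> closed_segment 0 1" for \<zeta>
  proof -
    have "norm (g \<zeta> - g 0) \<le> E * norm (\<zeta> - 0)"
    proof (rule field_differentiable_bound[where S = "closed_segment 0 1"])
      show "(g has_field_derivative f' z / f z) (at z within closed_segment 0 1)" if "z \<in> closed_segment 0 1" for z
        using that seg by (intro has_field_derivative_at_within[OF dg]) auto
      show "norm (f' z / f z) \<le> E" if "z \<in> closed_segment 0 1" for z
        using that seg by (intro f') auto
    qed (use \<zeta> in auto)
    also have "\<dots> \<le> E * 1"
    proof (rule mult_left_mono)
      show "norm (\<zeta> - 0) \<le> 1"
        using segment_bound(1)[OF \<zeta>] by simp
      show "E \<ge> 0"
        using f'[OF U(3)] norm_ge_zero order_trans by blast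
    qed
    finally show ?thesis
      by simp
  qed
  have ratio: "f \<zeta> = exp (g \<zeta> - g 0) * f 0" if "\<zeta> \<in> closed_segment 0 1" for \<zeta>
    using that g(2) U(3) seg nz[OF U(3)] by (auto simp: exp_diff)
  have "norm (f 1 / f 0 - 1) = norm (exp (g 1 - g 0) - 1)"
    using ratio[of 1] nz[OF U(3)] by simp
  also have "\<dots> \<le> norm (g 1 - g 0) * exp (norm (g 1 - g 0))"
    by (rule norm_exp_minus_one_le)
  also have "\<dots> \<le> E * exp E"
    using diff[of 1] by (intro mult_mono) (auto intro: order_trans[OF norm_ge_zero])
  finally show "norm (f 1 / f 0 - 1) \<le> E * exp E" .
  show "norm (f \<zeta>) \<le> exp E * norm (f 0)" if \<zeta>: "\<zeta> \<in> closed_segment 0 1" for \<zeta>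
  proof -
    have "norm (exp (g \<zeta> - g 0)) \<le> exp E"
      using norm_exp[of "g \<zeta> - g 0"] diff[OF \<zeta>] by (meson exp_le_cancel_iff order_trans)
    then show ?thesis
      by (subst ratio[OF \<zeta>]) (simp add: norm_mult mult_right_mono)
  qed
qed

lemma deriv_shift: "deriv (\<lambda>\<zeta>. f (a + \<zeta>)) 0 = deriv f (a :: complex)"
  using DERIV_shift[of f _ 0 a] by (simp add: deriv_def add.commute)

lemma partial_base:
  fixes z :: "complex^3"
  shows
  "partial 1 (\<lambda>z. g (z$1) (z$2)) z = d_I g (z$1) (z$2)"
  "partial 2 (\<lambda>z. g (z$1) (z$2)) z = d_y g (z$1) (z$2)"
  "partial 3 (\<lambda>z. g (z$1) (z$2)) z = 0"
proof -
  have "partial 1 (\<lambda>z. g (z$1) (z$2)) z = deriv (\<lambda>\<zeta>. g (z$1 + \<zeta>) (z$2)) 0"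
    by (simp add: partial_def axis_def)
  then show "partial 1 (\<lambda>z. g (z$1) (z$2)) z = d_I g (z$1) (z$2)"
    unfolding d_I_def using deriv_shift[of "\<lambda>a. g a (z$2)"] by simp
  have "partial 2 (\<lambda>z. g (z$1) (z$2)) z = deriv (\<lambda>\<zeta>. g (z$1) (z$2 + \<zeta>)) 0"
    by (simp add: partial_def axis_def)
  then show "partial 2 (\<lambda>z. g (z$1) (z$2)) z = d_y g (z$1) (z$2)"
    unfolding d_y_def using deriv_shift[of "\<lambda>y. g (z$1) y"] by simp
  show "partial 3 (\<lambda>z. g (z$1) (z$2)) z = 0"
    by (simp add: partial_def axis_def)
qed

text \<open>The hypotheses divide by \<open>v\<close> at the point where the derivative is taken,
  whereas the orbit equation divides by \<open>v\<close> at the fixed point \<open>(a, y)\<close>.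
  Along the segment \<open>v\<close> grows at most by the factor \<open>exp E\<close>, which pays
  for the change of denominator.\<close>

lemma base_segment_bounds:
  assumes conv: "convex II" "convex YY"
    and v: "holo3 (\<lambda>z. v (z$1) (z$2)) (phase_dom II YY r \<sigma> s)"
    and \<omega>: "holo3 (\<lambda>z. \<omega> (z$1) (z$2)) (phase_dom II YY r \<sigma> s)" and "s > 0"
    and nz: "\<And>a y. (a, y) \<in> base_dom II YY r \<sigma> \<Longrightarrow> v a y \<noteq> 0"
    and vI: "\<And>a y. (a, y) \<in> base_dom II YY r \<sigma> \<Longrightarrow> norm (d_I v a y / v a y) \<le> \<alpha>"
    and vy: "\<And>a y. (a, y) \<in> base_dom II YY r \<sigma> \<Longrightarrow> norm (d_y v a y / v a y) \<le> \<beta>"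
    and \<omega>I: "\<And>a y. (a, y) \<in> base_dom II YY r \<sigma> \<Longrightarrow> norm (d_I \<omega> a y / v a y) \<le> \<alpha>'"
    and \<omega>y: "\<And>a y. (a, y) \<in> base_dom II YY r \<sigma> \<Longrightarrow> norm (d_y \<omega> a y / v a y) \<le> \<beta>'"
    and ay: "(a, y) \<in> base_dom II YY r \<sigma>" "(a', y') \<in> base_dom II YY r \<sigma>"
    and E: "E = \<beta> * norm (y' - y) + \<alpha> * norm (a' - a)"
  shows "norm (v a' y' / v a y - 1) \<le> E * exp E"
    and "norm ((\<omega> a' y' - \<omega> a y) / v a y) \<le> exp E * (\<beta>' * norm (y' - y) + \<alpha>' * norm (a' - a))"
proof -
  let ?D = "phase_dom II YY r \<sigma> s"
  \<comment> \<open>The third coordinate 0 is a dummy angle that places the segment in the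
    three-dimensional domain. \<open>U\<close> collects all complex parameters that keep the line in
    it.\<close>
  define z k where "z = (vector [a, y, 0] :: complex^3)" and "k = (vector [a' - a, y' - y, 0] :: complex^3)"
  define U where "U = (\<lambda>\<zeta>. z + \<zeta> *s k) -` ?D"
  have zk: "z$1 = a" "z$2 = y" "z$3 = 0" "k$1 = a' - a" "k$2 = y' - y" "k$3 = 0"
    by (simp_all add: z_def k_def)
  have base: "(a + \<zeta> * (a' - a), y + \<zeta> * (y' - y)) \<in> base_dom II YY r \<sigma>" if "\<zeta> \<in> U" for \<zeta>
    using that by (simp add: U_def phase_dom_def zk)
  have U: "open U" "convex U" "0 \<in> U" "1 \<in> U"
  proof -
    show "open U"
      unfolding U_def
      by (intro open_vimage open_phase_dom continuous_intros bounded_linear.continuous_on[OF bounded_linear_vector_smult])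
    show "convex U"
      unfolding convex_def
    proof (intro ballI allI impI)
      fix x x' and u u' :: real
      assume x: "x \<in> U" "x' \<in> U" and u: "0 \<le> u" "0 \<le> u'" "u + u' = 1"
      have "z + (u *\<^sub>R x + u' *\<^sub>R x') *s k = u *\<^sub>R (z + x *s k) + u' *\<^sub>R (z + x' *s k)"
      proof -
        have u': "u' = 1 - u"
          using u(3) by simp
        show ?thesis
          unfolding vec_eq_iff vector_add_component vector_scaleR_component vector_smult_component u'
          by (simp add: scaleR_conv_of_real algebra_simps)
      qed
      with convexD[OF convex_phase_dom[OF conv], of "z + x *s k" r \<sigma> s "z + x' *s k" u u'] x u
      show "u *\<^sub>R x + u' *\<^sub>R x' \<in> U"
        by (simp add: U_def)
    qed
    show "0 \<in> U" "1 \<in> U"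
      using ay \<open>s > 0\<close> by (simp_all add: U_def phase_dom_def zk)
  qed
  have seg: "closed_segment 0 1 \<subseteq> U"
    using U by (simp add: closed_segment_subset)
  have der: "((\<lambda>\<zeta>. g (a + \<zeta> * (a' - a)) (y + \<zeta> * (y' - y))) has_field_derivative
      d_I g (a + \<zeta> * (a' - a)) (y + \<zeta> * (y' - y)) * (a' - a) +
      d_y g (a + \<zeta> * (a' - a)) (y + \<zeta> * (y' - y)) * (y' - y)) (at \<zeta>)"
    if g: "holo3 (\<lambda>z. g (z$1) (z$2)) ?D" and \<zeta>: "\<zeta> \<in> U" for g \<zeta>
    using holo3_line[OF g open_phase_dom, of z \<zeta> k] \<zeta>
    by (simp add: U_def sum_3 partial_base zk)
  have split: "norm ((p * x + q * x') / c) \<le> B1 * norm x + B2 * norm x'"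
    if "norm (p / c) \<le> B1" "norm (q / c) \<le> B2" for p q x x' c :: complex and B1 B2
  proof -
    have "(p * x + q * x') / c = (p / c) * x + (q / c) * x'"
      by (simp add: add_divide_distrib)
    also have "norm \<dots> \<le> norm (p / c) * norm x + norm (q / c) * norm x'"
      by (metis norm_mult norm_triangle_ineq)
    finally show ?thesis
      using that by (smt (verit) mult_right_mono norm_ge_zero)
  qed
  have bd: "norm ((d_I v (a + \<zeta> * (a' - a)) (y + \<zeta> * (y' - y)) * (a' - a) +
      d_y v (a + \<zeta> * (a' - a)) (y + \<zeta> * (y' - y)) * (y' - y)) / v (a + \<zeta> * (a' - a)) (y + \<zeta> * (y' - y))) \<le> E"
    if "\<zeta> \<in> U" for \<zeta>
    using split[OF vI[OF base[OF that]] vy[OF base[OF that]]] by (simp add: E add.commute)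
  note log = log_deriv_bound[OF U(2,1,3,4) der[OF v] nz[OF base] bd]
  show "norm (v a' y' / v a y - 1) \<le> E * exp E"
    using log(1) by simp
  have v_le: "norm (v (a + \<zeta> * (a' - a)) (y + \<zeta> * (y' - y))) \<le> exp E * norm (v a y)"
    if "\<zeta> \<in> closed_segment 0 1" for \<zeta>
    using log(2)[OF _ _ _ that] by simp
  let ?C = "exp E * (\<beta>' * norm (y' - y) + \<alpha>' * norm (a' - a))"
  have "norm (\<omega> (a + 1 * (a' - a)) (y + 1 * (y' - y)) - \<omega> (a + 0 * (a' - a)) (y + 0 * (y' - y)))
      \<le> ?C * norm (v a y) * norm (1 - 0 :: complex)"
  proof (rule field_differentiable_bound[where S = "closed_segment 0 (1::complex)"])
    fix \<zeta> :: complex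
    assume \<zeta>: "\<zeta> \<in> closed_segment 0 1"
    then have "\<zeta> \<in> U"
      using seg by blast
    let ?a = "a + \<zeta> * (a' - a)" and ?y = "y + \<zeta> * (y' - y)"
    let ?d = "d_I \<omega> ?a ?y * (a' - a) + d_y \<omega> ?a ?y * (y' - y)"
    show "((\<lambda>\<zeta>. \<omega> (a + \<zeta> * (a' - a)) (y + \<zeta> * (y' - y))) has_field_derivative ?d) (at \<zeta> within closed_segment 0 1)"
      by (rule has_field_derivative_at_within[OF der[OF \<omega> \<open>\<zeta> \<in> U\<close>]])
    have d: "norm (?d / v ?a ?y) \<le> \<beta>' * norm (y' - y) + \<alpha>' * norm (a' - a)"
      using split[OF \<omega>I[OF base[OF \<open>\<zeta> \<in> U\<close>]] \<omega>y[OF base[OF \<open>\<zeta> \<in> U\<close>]]] by (simp add: add.commute)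
    have "norm ?d = norm (?d / v ?a ?y) * norm (v ?a ?y)"
      using nz[OF base[OF \<open>\<zeta> \<in> U\<close>]] by (simp add: norm_divide)
    also have "\<dots> \<le> (\<beta>' * norm (y' - y) + \<alpha>' * norm (a' - a)) * (exp E * norm (v a y))"
      using d v_le[OF \<zeta>] order_trans[OF norm_ge_zero d] by (intro mult_mono) auto
    finally show "norm ?d \<le> ?C * norm (v a y)"
      by (simp add: mult_ac)
  qed auto
  then show "norm ((\<omega> a' y' - \<omega> a y) / v a y) \<le> ?C"
    using nz[OF ay(1)] by (simp add: norm_divide divide_le_eq)
qed

subsection \<open>The orbits of the perturbed field\<close>

lemma torus_eq_iff: "torus_eq z z' \<longleftrightarrow> (\<exists>m::int. z = z' + axis 3 (of_real (2 * pi * of_int m)))"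
  unfolding torus_eq_def vec_eq_iff forall_3
  by (simp add: axis_def) (metis add_diff_cancel_left' diff_add_cancel add.commute)

lemma index_3_cases: "(i::3) = 1 \<or> i = 2 \<or> i = 3"
  using exhaust_3 by blast

lemma has_field_derivative_nth_axis: "((\<lambda>\<zeta>. (z + axis j \<zeta>) $ i) has_field_derivative (if i = j then 1 else 0)) (at (0::complex))"
  by (cases "i = j") (auto simp: axis_def intro!: derivative_eq_intros)

text \<open>Pointwise form of the hypotheses: \<open>d\<close> is the diameter, \<open>V\<close> the
  bound of \<open>1 / v\<close>, \<open>\<mu>\<close> the weighted norm of \<open>P\<close>. The
  five quotient bounds are the conditions on \<chi>, \<theta>_2, \<theta>_1, \<theta>_3 and \<eta>,
  in this order, solved for the norms. \<open>M\<close> is a crude bound of the normal field; it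
  governs the convergence of the iteration but not the closeness of the limit to the
  identity.\<close>

locale flow_box =
  fixes II YY :: "real set" and r \<sigma> s \<rho> \<tau> t s2 d \<mu> V M y0 :: real
    and v \<omega> :: "complex \<Rightarrow> complex \<Rightarrow> complex" and P :: "complex^3 \<Rightarrow> complex^3"
    and D :: "(complex^3) set" and B :: "(complex \<times> complex) set"
  defines "D \<equiv> phase_dom II YY r \<sigma> s" and "B \<equiv> base_dom II YY r \<sigma>"
  assumes II: "convex II" and YY: "convex YY" and y0: "y0 \<in> YY"
    and pos: "0 < \<rho>" "0 < \<tau>" "0 < t" "0 < s2" "0 < V" "0 \<le> \<mu>"
    and room: "8 * \<rho> < r" "8 * exp s2 * \<tau> < \<sigma>" "10 * t < s" "\<sigma> \<le> d"
    and diam: "\<And>y y'. y \<in> cnbhd YY \<sigma> \<Longrightarrow> y' \<in> cnbhd YY \<sigma> \<Longrightarrow> norm (y - y') \<le> d"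
    and v_holo: "holo3 (\<lambda>z. v (z$1) (z$2)) D" and \<omega>_holo: "holo3 (\<lambda>z. \<omega> (z$1) (z$2)) D"
    and P_holo: "\<And>i. holo3 (\<lambda>z. P z $ i) D"
    and P_periodic: "\<And>z m. z \<in> D \<Longrightarrow> P (z + axis 3 (of_real (2 * pi * of_int m))) = P z"
    and v_nonzero: "\<And>a y. (a, y) \<in> B \<Longrightarrow> v a y \<noteq> 0"
    and inv_v: "\<And>a y. (a, y) \<in> B \<Longrightarrow> norm (1 / v a y) \<le> V"
    and v_y: "\<And>a y. (a, y) \<in> B \<Longrightarrow> norm (d_y v a y / v a y) \<le> s2 / d"
    and v_I: "\<And>a y. (a, y) \<in> B \<Longrightarrow> norm (d_I v a y / v a y) \<le> \<tau> / (4 * d * \<rho>)"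
    and \<omega>_y: "\<And>a y. (a, y) \<in> B \<Longrightarrow> norm (d_y \<omega> a y / v a y) \<le> t / (2 * exp s2 * d * \<tau>)"
    and \<omega>_I: "\<And>a y. (a, y) \<in> B \<Longrightarrow> norm (d_I \<omega> a y / v a y) \<le> t / (8 * d * \<rho>)"
    and \<omega>_v: "\<And>a y. (a, y) \<in> B \<Longrightarrow> norm (\<omega> a y / v a y) \<le> t / d"
    and P_bound: "\<And>z. z \<in> D \<Longrightarrow> norm (P z $ 1) \<le> \<rho> * \<mu>"
      "\<And>z. z \<in> D \<Longrightarrow> norm (P z $ 2) \<le> \<tau> * \<mu>"
      "\<And>z. z \<in> D \<Longrightarrow> norm (P z $ 3) \<le> t * \<mu>"
    and N_bound: "\<And>a y. (a, y) \<in> B \<Longrightarrow> norm (v a y) \<le> M" "\<And>a y. (a, y) \<in> B \<Longrightarrow> norm (\<omega> a y) \<le> M"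
    and small: "33 * (exp s2 * d * V * \<mu>) \<le> 1"
begin

definition X :: "complex^3 \<Rightarrow> complex^3" where
  "X z = normal_field v \<omega> z + P z"

text \<open>
  \<open>W\<close> is the domain on which the orbits of \<open>X\<close> are computed. They stay in \<open>Wm\<close>, which still keeps
  the distances \<open>(\<rho>, \<tau>, t)\<close> from the boundary of \<open>D\<close>, so that Cauchy's estimate bounds the Lipschitz
  constant of \<open>X\<close> there.
\<close>

definition W :: "(complex^3) set" where
  "W = phase_dom II YY (r - 7 * \<rho>) (\<sigma> - 8 * exp s2 * \<tau> + \<tau>) (s - 8 * t)"

definition Wm :: "(complex^3) set" where
  "Wm = phase_dom II YY (r - 6 * \<rho>) (\<sigma> - 8 * exp s2 * \<tau> + 2 * \<tau>) (s - 6 * t)"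

abbreviation J :: "(complex^3 \<Rightarrow> complex) \<Rightarrow> complex^3 \<Rightarrow> complex" where
  "J \<equiv> path_int (of_real y0)"

definition vel :: "complex^3 \<Rightarrow> complex" where
  "vel z = v (z$1) (z$2)"

definition Om :: "complex^3 \<Rightarrow> complex" where
  "Om = J (\<lambda>z. \<omega> (z$1) (z$2) / vel z)"

definition wt :: "3 \<Rightarrow> real" where
  "wt i = (if i = 1 then \<rho> else if i = 2 then \<tau> else t)"

definition len :: "complex^3 \<Rightarrow> real" where
  "len z = norm (z$2 - of_real y0)"

text \<open>The margin \<open>1/16\<close> over \<open>s2\<close> absorbs the factor
  \<open>exp (E1 + E2)\<close> by which a logarithmic bound on \<open>v\<close> exceeds its
  linearisation.\<close>

definition rate :: real where
  "rate = (s2 + 1/16) / d"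

definition amp :: real where
  "amp = \<tau> * exp (- s2) / (25 * d)"

text \<open>
  The region kept invariant by the Picard iteration. The bound on the second component is the
  solution of the Gronwall comparison equation \<open>u' = rate * u + amp * exp (rate * x)\<close>, \<open>u 0 = 0\<close>,
  where \<open>rate\<close> comes from the bound on \<open>d_y v / v\<close>; this is where the factor \<open>exp s2\<close> enters.
\<close>

definition near :: "complex^3 \<Rightarrow> complex^3 \<Rightarrow> bool" where
  "near z x \<longleftrightarrow> norm (x$1 - z$1) \<le> \<rho> * exp (- s2) / 33 \<and>
     norm (x$2 - z$2) \<le> amp * len z * exp (rate * len z) \<and> norm (x$3 - z$3 - Om z) \<le> t / 16"

section \<open>Numerical consequences of the smallness conditions\<close>

lemma d_pos: "d > 0"
proof -
  have "0 < 8 * exp s2 * \<tau>"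
    using pos by simp
  then show ?thesis
    using room by linarith
qed

lemma exp_s2: "exp s2 * exp (- s2) = 1" "exp (- s2) \<le> 1" "exp s2 \<ge> 1"
  using pos by (auto simp: exp_add[symmetric])

text \<open>Makes the estimates uniform in \<open>s2\<close>: the factor \<open>exp (- s2)\<close>
  carried by the displacements outweighs both \<open>s2\<close> and its square.\<close>

lemma s2_exp: "s2 * exp (- s2) \<le> 1" "s2 * (s2 * exp (- s2)) \<le> 2"
proof -
  have "1 + s2 + s2\<^sup>2 / 2 \<le> exp s2"
    using exp_lower_Taylor_quadratic[of s2] pos by simp
  then have "s2 \<le> exp s2" "s2\<^sup>2 \<le> 2 * exp s2"
    using pos by (auto simp: power2_eq_square intro: order_trans[rotated] add_nonneg_nonneg)
  then show "s2 * exp (- s2) \<le> 1" "s2 * (s2 * exp (- s2)) \<le> 2"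
    by (auto simp: exp_minus field_simps power2_eq_square)
qed

lemma tau_le: "\<tau> \<le> exp (- s2) * d / 8" "\<tau> / d \<le> exp (- s2) / 8"
proof -
  have "8 * \<tau> = exp (- s2) * (8 * exp s2 * \<tau>)"
    using exp_s2(1) by (simp add: algebra_simps)
  also have "\<dots> \<le> exp (- s2) * d"
    using room by (intro mult_left_mono) auto
  finally show "\<tau> \<le> exp (- s2) * d / 8" "\<tau> / d \<le> exp (- s2) / 8"
    using d_pos by (auto simp: field_simps)
qed

lemma tau_exp: "\<tau> \<le> exp s2 * \<tau>"
  using exp_s2(3) pos(2) by simp

lemma open_doms: "open D" "open W" "open Wm"
  by (auto simp: D_def W_def Wm_def open_phase_dom)

lemma W_sub: "W \<subseteq> D" "W \<subseteq> Wm" "Wm \<subseteq> D"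
  unfolding W_def Wm_def D_def by (intro phase_dom_mono; use pos room tau_exp in linarith)+

lemma base_D: "z \<in> D \<Longrightarrow> (z$1, z$2) \<in> B"
  by (simp add: D_def B_def phase_dom_def)

lemma y0_W: "complex_of_real y0 \<in> cnbhd YY (\<sigma> - 8 * exp s2 * \<tau> + \<tau>)"
  by (rule of_real_in_cnbhd[OF y0]) (use room pos in linarith)

lemma y0_D: "complex_of_real y0 \<in> cnbhd YY \<sigma>"
  by (rule of_real_in_cnbhd[OF y0]) (use room pos tau_exp in linarith)

lemmas path_W = phase_dom_linepath[OF YY y0_W, where II = II and r = "r - 7 * \<rho>" and s = "s - 8 * t", folded W_def]
lemmas J_holo = holo3_path_int[OF YY y0_W, where II = II and r = "r - 7 * \<rho>" and s = "s - 8 * t", folded W_def]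
lemmas J_partial_2 = path_int_partial_2[OF YY y0_W, where II = II and r = "r - 7 * \<rho>" and s = "s - 8 * t", folded W_def]
lemmas J_bound = norm_path_int_le[OF YY y0_W, where II = II and r = "r - 7 * \<rho>" and s = "s - 8 * t", folded W_def]
lemmas J_diff = path_int_diff[OF YY y0_W, where II = II and r = "r - 7 * \<rho>" and s = "s - 8 * t", folded W_def]
lemmas J_real = path_int_real[OF YY y0_W, where II = II and r = "r - 7 * \<rho>" and s = "s - 8 * t", folded W_def]
lemmas J_shift = path_int_shift[OF YY y0_W, where II = II and r = "r - 7 * \<rho>" and s = "s - 8 * t", folded W_def]

lemma len_path: "x \<in> {0..1} \<Longrightarrow> len (vector [z$1, linepath (of_real y0) (z$2) x, z$3]) = x * len z"
proof -
  assume "x \<in> {0..1}"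
  have "linepath (of_real y0) (z$2) x - of_real y0 = of_real x * (z$2 - of_real y0)"
    by (simp add: linepath_def scaleR_conv_of_real algebra_simps)
  with \<open>x \<in> {0..1}\<close> show ?thesis
    by (simp add: len_def norm_mult)
qed

lemma len_le: "z \<in> D \<Longrightarrow> len z \<le> d" and len_nonneg: "0 \<le> len z"
  using diam[OF _ y0_D] by (auto simp: len_def D_def mem_phase_dom)

lemma J_le:
  assumes "continuous_on W f" "z \<in> W" "\<And>u. (b has_real_derivative b' u) (at u)"
    and "\<And>w. w \<in> W \<Longrightarrow> w$1 = z$1 \<Longrightarrow> w$3 = z$3 \<Longrightarrow> norm (f w) \<le> b' (len w)"
  shows "norm (J f z) \<le> b (len z) - b 0"
  unfolding len_def
proof (rule J_bound[OF assms(1-3)])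
  fix x :: real
  assume x: "x \<in> {0..1}"
  let ?w = "vector [z$1, linepath (of_real y0) (z$2) x, z$3]"
  have "norm (f ?w) \<le> b' (len ?w)"
    by (rule assms(4)) (use path_W[OF assms(2) x] in auto)
  then show "norm (f ?w) \<le> b' (x * norm (z$2 - of_real y0))"
    unfolding len_path[OF x] by (simp add: len_def)
qed

lemma vel_nonzero: "z \<in> D \<Longrightarrow> vel z \<noteq> 0"
  using v_nonzero base_D by (simp add: vel_def)

lemma inv_vel: "z \<in> D \<Longrightarrow> norm (c / vel z) \<le> V * norm c"
  using mult_right_mono[OF inv_v[OF base_D, of z], of "norm c"] by (simp add: vel_def norm_divide)

lemma vel_holo: "holo3 vel D"
  using v_holo by (simp add: vel_def[abs_def])

lemma quot_holo: "holo3 (\<lambda>z. \<omega> (z$1) (z$2) / vel z) D"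
  using open_doms \<omega>_holo vel_holo vel_nonzero by (intro holo3_divide)

lemma Om_holo: "holo3 Om W"
  unfolding Om_def by (intro J_holo holo3_subset[OF quot_holo] W_sub)

lemma Om_bound: "z \<in> W \<Longrightarrow> norm (Om z) \<le> t"
proof -
  assume z: "z \<in> W"
  have "norm (Om z) \<le> t / d * len z - t / d * 0"
    unfolding Om_def
  proof (rule J_le[OF _ z, where b' = "\<lambda>_. t / d"])
    show "continuous_on W (\<lambda>z. \<omega> (z$1) (z$2) / vel z)"
      using W_sub by (intro holo3_imp_continuous_on holo3_subset[OF quot_holo] open_doms)
    show "((\<lambda>x. t / d * x) has_real_derivative t / d) (at u)" for u
      by (rule DERIV_cmult_Id)
    show "norm (\<omega> (w$1) (w$2) / vel w) \<le> t / d" if "w \<in> W" for w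
      using \<omega>_v base_D that W_sub by (auto simp: vel_def)
  qed
  moreover have "t / d * len z \<le> t / d * d"
    using len_le[of z] z W_sub pos d_pos by (intro mult_left_mono) auto
  moreover have "t / d * d = t"
    using d_pos by simp
  ultimately show ?thesis
    by linarith
qed

lemma Om_shift: "Om (z + axis 3 \<zeta>) = Om z"
  by (simp add: Om_def path_int_def vel_def axis_def)

text \<open>Over a path of length at most \<open>d\<close> the exponential is at most e^(s2 + 1/16),
  hence at most 5/4 e^s2. The factor e^s2 cancels against \<open>amp\<close>, and 5/4 divided by 25
  is 1/20.\<close>

lemma near_y:
  assumes "z \<in> W" "near z x"
  shows "norm (x$2 - z$2) \<le> \<tau> / 20"
proof -
  have l: "0 \<le> len z" "len z \<le> d"
    using len_nonneg len_le assms W_sub by auto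
  have "rate * len z \<le> rate * d"
    using l pos d_pos by (intro mult_left_mono) (auto simp: rate_def)
  then have "rate * len z \<le> s2 + 1/16"
    using d_pos by (simp add: rate_def)
  then have "exp (rate * len z) \<le> exp s2 * exp (1/16)"
    by (simp flip: exp_add)
  moreover have "exp (1/16 :: real) \<le> 5/4"
    using exp_bound[of "1/16::real"] by (simp add: power2_eq_square)
  ultimately have e: "exp (rate * len z) \<le> exp s2 * (5/4)"
    by (meson exp_ge_zero mult_left_mono order_trans)
  have "norm (x$2 - z$2) \<le> amp * len z * exp (rate * len z)"
    using assms by (simp add: near_def)
  also have "\<dots> \<le> amp * d * (exp s2 * (5/4))"
    using l e pos d_pos by (intro mult_mono) (auto simp: amp_def)
  also have "\<dots> = \<tau> * (exp s2 * exp (- s2)) / 20"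
    using d_pos by (simp add: amp_def)
  finally show ?thesis
    using exp_s2 by simp
qed

lemma near_x: "near z x \<Longrightarrow> norm (x$1 - z$1) \<le> \<rho> / 33"
proof -
  have "\<rho> * exp (- s2) \<le> \<rho> * 1"
    using exp_s2(2) pos(1) by (intro mult_left_mono) auto
  then show "near z x \<Longrightarrow> ?thesis"
    unfolding near_def by linarith
qed

text \<open>The angle moves by at most \<open>t\<close> through \<open>Om\<close> and by
  \<open>t / 16\<close> beyond that, which fits into the allowance of \<open>2 * t\<close>.\<close>

lemma near_Wm:
  assumes "z \<in> W" "near z x"
  shows "x \<in> Wm"
proof -
  have "norm (x$3 - z$3) \<le> norm (x$3 - z$3 - Om z) + norm (Om z)"
    by (metis diff_add_cancel norm_triangle_ineq)
  then have "norm ((x - z)$3) \<le> 2 * t"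
    using assms Om_bound[OF assms(1)] pos by (simp add: near_def)
  then have "\<bar>Im ((x - z)$3)\<bar> \<le> 2 * t"
    using abs_Im_le_cmod order_trans by blast
  then have "z + (x - z) \<in> phase_dom II YY (r - 7 * \<rho> + \<rho>) (\<sigma> - 8 * exp s2 * \<tau> + \<tau> + \<tau>) (s - 8 * t + 2 * t)"
    using near_x[OF assms(2)] near_y[OF assms] assms(1) pos
    by (intro phase_dom_add) (auto simp: W_def)
  then show ?thesis
    by (simp add: Wm_def algebra_simps)
qed

text \<open>Starts the Picard differences: two maps in the tube differ by at most one unit of each
  weight.\<close>

lemma near_diff:
  assumes "z \<in> W" "near z x" "near z x'"
  shows "norm (x$i - x'$i) \<le> wt i"
proof -
  have tri: "norm (p - p') \<le> norm (p - q) + norm (p' - q)" for p p' q :: complex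
    by (metis dist_commute dist_norm dist_triangle2)
  consider "i = 1" | "i = 2" | "i = 3"
    using index_3_cases by blast
  then show ?thesis
  proof cases
    case 1
    then show ?thesis
      using tri[of "x$1" "x'$1" "z$1"] near_x[OF assms(2)] near_x[OF assms(3)] pos by (simp add: wt_def)
  next
    case 2
    then show ?thesis
      using tri[of "x$2" "x'$2" "z$2"] near_y[OF assms(1,2)] near_y[OF assms(1,3)] pos by (simp add: wt_def)
  next
    case 3
    then show ?thesis
      using tri[of "x$3" "x'$3" "z$3 + Om z"] assms pos by (simp add: wt_def near_def algebra_simps)
  qed
qed

section \<open>Size and Lipschitz constant of the perturbed field\<close>

lemma X_components: "X z $ 1 = P z $ 1" "X z $ 2 = vel z + P z $ 2" "X z $ 3 = \<omega> (z$1) (z$2) + P z $ 3"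
  by (simp_all add: X_def normal_field_def vel_def)

lemma X_holo: "holo3 (\<lambda>z. X z $ i) D"
proof -
  have "holo3 (\<lambda>z. P z $ 1) D" "holo3 (\<lambda>z. vel z + P z $ 2) D" "holo3 (\<lambda>z. \<omega> (z$1) (z$2) + P z $ 3) D"
    by (intro holo3_add open_doms vel_holo \<omega>_holo P_holo)+
  then show ?thesis
    using index_3_cases[of i] by (auto simp: X_components)
qed

definition Mx :: real where
  "Mx = M + (\<rho> + \<tau> + t) * \<mu>"

lemma X_bound: "z \<in> D \<Longrightarrow> norm (X z $ i) \<le> Mx"
proof -
  assume z: "z \<in> D"
  have M: "norm (vel z) \<le> M" "norm (\<omega> (z$1) (z$2)) \<le> M"
    using N_bound[OF base_D[OF z]] by (auto simp: vel_def)
  have M0: "0 \<le> M"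
    using M(1) norm_ge_zero[of "vel z"] by linarith
  have \<mu>: "0 \<le> \<rho> * \<mu>" "0 \<le> \<tau> * \<mu>" "0 \<le> t * \<mu>"
    using pos by auto
  have Mx: "Mx = M + \<rho> * \<mu> + \<tau> * \<mu> + t * \<mu>"
    by (simp add: Mx_def algebra_simps)
  have "norm (X z $ 1) \<le> Mx"
    using P_bound(1)[OF z] M0 \<mu> unfolding Mx X_components by linarith
  moreover have "norm (X z $ 2) \<le> Mx"
    using P_bound(2)[OF z] M \<mu> norm_triangle_ineq[of "vel z" "P z $ 2"]
    unfolding Mx X_components by linarith
  moreover have "norm (X z $ 3) \<le> Mx"
    using P_bound(3)[OF z] M \<mu> norm_triangle_ineq[of "\<omega> (z$1) (z$2)" "P z $ 3"]
    unfolding Mx X_components by linarith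
  ultimately show ?thesis
    using index_3_cases[of i] by auto
qed

lemma wt_nonneg: "wt i \<ge> 0" "wt i > 0"
  using pos by (auto simp: wt_def)

lemma polydisc_Wm: "z \<in> Wm \<Longrightarrow> (\<And>i. norm (h $ i) \<le> wt i) \<Longrightarrow> z + h \<in> D"
proof -
  assume z: "z \<in> Wm" and h: "\<And>i. norm (h $ i) \<le> wt i"
  have "\<bar>Im (h$3)\<bar> \<le> t"
    using h[of 3] abs_Im_le_cmod[of "h$3"] by (simp add: wt_def)
  then have "z + h \<in> phase_dom II YY (r - 6 * \<rho> + \<rho>) (\<sigma> - 8 * exp s2 * \<tau> + 2 * \<tau> + \<tau>) (s - 6 * t + t)"
    using z h[of 1] h[of 2] by (intro phase_dom_add) (auto simp: Wm_def wt_def)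
  also have "\<dots> \<subseteq> D"
    unfolding D_def by (intro phase_dom_mono; use pos tau_exp in linarith)
  finally show ?thesis .
qed

text \<open>Cauchy's estimate with one unit of each weight to spare. \<open>Mx\<close> may be large,
  so this serves convergence only.\<close>

lemma X_lipschitz:
  assumes "x \<in> Wm" "x' \<in> Wm" "\<And>i. norm (x' $ i - x $ i) \<le> c * wt i" "c \<ge> 0"
  shows "norm (X x' $ i - X x $ i) \<le> Mx * c"
  by (rule holo3_lipschitz[OF X_holo open_doms(1) X_bound _ wt_nonneg(1) polydisc_Wm assms])
    (auto simp: Wm_def intro!: convex_phase_dom II YY)

lemma V_mu_d_le: "V * \<mu> * d \<le> exp (- s2) / 33"
proof -
  have "33 * (V * \<mu> * d) = exp (- s2) * (33 * (exp s2 * d * V * \<mu>))"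
    using exp_s2(1) by (simp add: algebra_simps)
  also have "\<dots> \<le> exp (- s2) * 1"
    using small by (intro mult_left_mono) auto
  finally show ?thesis
    by simp
qed

lemma V_mult_le: "c > 0 \<Longrightarrow> V * (c * \<mu>) \<le> c / d * (exp (- s2) / 33)"
proof -
  assume "c > 0"
  have "V * (c * \<mu>) = c / d * (V * \<mu> * d)"
    using d_pos by simp
  also have "\<dots> \<le> c / d * (exp (- s2) / 33)"
    using V_mu_d_le \<open>c > 0\<close> d_pos by (intro mult_left_mono) auto
  finally show ?thesis .
qed

text \<open>The source terms for the tube. The field at \<open>x\<close>, run with the clock of the
  normal field at \<open>z\<close>, differs from the latter by the variation of \<open>v\<close> and
  \<omega> between the two points and by \<open>P\<close>. The first bound is the derivative of the
  function that bounds the \<open>y\<close>-displacement in \<open>near\<close>, which makes the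
  tube invariant.\<close>

lemma field_estimates:
  assumes z: "z \<in> W" and x: "near z x"
  shows "norm (X x $ 2 / vel z - 1) \<le> amp * (rate * len z + 1) * exp (rate * len z)"
    and "norm (X x $ 3 / vel z - \<omega> (z$1) (z$2) / vel z) \<le> t / (16 * d)"
proof -
  define q e \<delta> where "q = exp (- s2)" and "e = norm (x$2 - z$2)" and "\<delta> = norm (x$1 - z$1)"
  \<comment> \<open>\<open>T\<close> and \<open>S\<close> are the natural units of error per unit of
    path in \<open>y\<close> and in the angle. \<open>E1\<close> and \<open>E2\<close> bound the
    change of log \<open>v\<close> caused by the displacement in \<open>y\<close> and in the first
    coordinate.\<close>
  define T S where "T = \<tau> / d * q" and "S = t / d * q"
  define E1 E2 where "E1 = s2 / d * e" and "E2 = \<tau> / (4 * d * \<rho>) * \<delta>"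
  have q: "0 < q" "q \<le> 1" "s2 * q \<le> 1" "s2 * (s2 * q) \<le> 2"
    using exp_s2 s2_exp by (auto simp: q_def)
  have e: "0 \<le> e" "e \<le> \<tau> / 20" "e \<le> amp * len z * exp (rate * len z)"
    using near_y[OF z x] x by (auto simp: e_def near_def)
  have \<delta>: "0 \<le> \<delta>" "\<delta> \<le> \<rho> * q / 33"
    using x by (auto simp: \<delta>_def near_def q_def)
  have zD: "z \<in> D" and xD: "x \<in> D"
    using z W_sub near_Wm[OF z x] by auto
  have \<tau>d: "\<tau> / d \<le> q / 8" "0 < \<tau> / d"
    using tau_le(2) pos d_pos by (auto simp: q_def)
  have "E1 \<le> s2 / d * (\<tau> / 20)"
    unfolding E1_def using e pos d_pos by (intro mult_left_mono) auto
  also have "\<dots> = s2 * (\<tau> / d) / 20"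
    by simp
  also have "\<dots> \<le> s2 * (q / 8) / 20"
    using \<tau>d pos by (intro divide_right_mono mult_left_mono) auto
  finally have E1: "E1 \<le> s2 * q / 160"
    by simp
  have "E2 \<le> \<tau> / (4 * d * \<rho>) * (\<rho> * q / 33)"
    unfolding E2_def using \<delta> pos d_pos by (intro mult_left_mono) auto
  also have "\<dots> = T / 132"
    using pos by (simp add: T_def)
  finally have E2: "E2 \<le> T / 132" .
  have T: "T \<le> q / 8 * 1" "0 < T"
    unfolding T_def using mult_mono[of "\<tau> / d" "q / 8" q 1] mult_pos_pos[OF \<tau>d(2) q(1)] \<tau>d q by auto
  from E2 T have E2': "E2 \<le> q / 1056"
    by linarith
  have E_nonneg: "0 \<le> E1" "0 \<le> E2"
    using e \<delta> pos d_pos by (auto simp: E1_def E2_def)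
  have E_le: "E1 + E2 \<le> 1 / 100"
    using E1 E2' q by linarith
  \<comment> \<open>The product with \<open>s2\<close> has to be small as well, although
    \<open>s2\<close> may be large; \<open>E1\<close> already contains one factor \<open>s2\<close>,
    so the square of \<open>s2\<close> appears against \<open>q\<close>.\<close>
  have "s2 * (E1 + E2) \<le> s2 * (s2 * q / 160 + q / 1056)"
    using E1 E2' pos by (intro mult_left_mono) auto
  also have "\<dots> = s2 * (s2 * q) / 160 + s2 * q / 1056"
    by (simp add: algebra_simps)
  finally have s2E: "s2 * (E1 + E2) \<le> 1 / 50"
    using q by linarith
  have "exp (E1 + E2) \<le> 1 + (E1 + E2) + (E1 + E2)\<^sup>2"
    using E_nonneg E_le by (intro exp_bound) auto
  also have "(E1 + E2)\<^sup>2 \<le> (E1 + E2) * 1"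
    unfolding power2_eq_square using E_nonneg E_le by (intro mult_left_mono) auto
  finally have expE: "exp (E1 + E2) \<le> 1 + 2 * (E1 + E2)"
    by simp
  moreover have "1 + 2 * (E1 + E2) \<le> 51 / 50"
    using E_le by simp
  ultimately have expE': "exp (E1 + E2) \<le> 51 / 50"
    by (rule order_trans)
  have "s2 * exp (E1 + E2) \<le> s2 * (1 + 2 * (E1 + E2))"
    using expE pos by (intro mult_left_mono) auto
  also have "\<dots> = s2 + 2 * (s2 * (E1 + E2))"
    by (simp add: algebra_simps)
  \<comment> \<open>Twice 1/50 is below 1/16: the margin built into \<open>rate\<close>.\<close>
  finally have s2exp: "s2 * exp (E1 + E2) \<le> s2 + 1 / 16"
    using s2E by linarith
  note seg = base_segment_bounds[OF II YY v_holo[unfolded D_def] \<omega>_holo[unfolded D_def] _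
      v_nonzero[unfolded B_def] v_I[unfolded B_def] v_y[unfolded B_def] \<omega>_I[unfolded B_def] \<omega>_y[unfolded B_def]
      base_D[OF zD, unfolded B_def] base_D[OF xD, unfolded B_def] refl, folded e_def \<delta>_def, folded E1_def E2_def]
  have "s > 0"
    using room pos by linarith
  note seg = seg[OF this]
  have "norm (vel x / vel z - 1) \<le> (E1 + E2) * exp (E1 + E2)"
    using seg(1) by (simp add: vel_def)
  also have "\<dots> = e / d * (s2 * exp (E1 + E2)) + E2 * exp (E1 + E2)"
    by (simp add: E1_def algebra_simps)
  also have "\<dots> \<le> e / d * (s2 + 1 / 16) + T / 132 * (51 / 50)"
    using s2exp E2 expE' E_nonneg e d_pos pos by (intro add_mono mult_mono) auto
  finally have vel_ratio: "norm (vel x / vel z - 1) \<le> rate * e + T / 132 * (51 / 50)"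
    by (simp add: rate_def mult.commute)
  have P: "norm (P x $ 2 / vel z) \<le> T / 33" "norm (P x $ 3 / vel z) \<le> S / 33"
  proof -
    have "norm (P x $ 2 / vel z) \<le> V * (\<tau> * \<mu>)" "norm (P x $ 3 / vel z) \<le> V * (t * \<mu>)"
      using inv_vel[OF zD] P_bound[OF xD] pos by (meson less_imp_le mult_left_mono order_trans)+
    then show "norm (P x $ 2 / vel z) \<le> T / 33" "norm (P x $ 3 / vel z) \<le> S / 33"
      using V_mult_le[of \<tau>] V_mult_le[of t] pos by (auto simp: q_def T_def S_def)
  qed
  have "X x $ 2 / vel z - 1 = (vel x / vel z - 1) + P x $ 2 / vel z"
    by (simp add: X_components add_divide_distrib)
  then have "norm (X x $ 2 / vel z - 1) \<le> norm (vel x / vel z - 1) + norm (P x $ 2 / vel z)"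
    by (metis norm_triangle_ineq)
  \<comment> \<open>51/50 of 1/132 comes from the first coordinate and 1/33 from \<open>P\<close>;
    together they stay below 1/25, the constant in \<open>amp\<close>.\<close>
  also have "\<dots> \<le> rate * e + T / 25"
    using vel_ratio P(1) T(2) by linarith
  also have "T / 25 = amp * 1"
    by (simp add: amp_def q_def T_def)
  \<comment> \<open>Inserting the tube bound for \<open>e\<close> yields the derivative of
    \<open>amp * u * exp (rate * u)\<close> at \<open>u = len z\<close>.\<close>
  also have "rate * e + amp * 1 \<le> rate * (amp * len z * exp (rate * len z)) + amp * exp (rate * len z)"
  proof -
    have "0 \<le> rate" "0 \<le> amp"
      using pos d_pos by (auto simp: rate_def amp_def)
    then show ?thesis
      using e len_nonneg[of z] by (intro add_mono mult_left_mono) auto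
  qed
  also have "\<dots> = amp * (rate * len z + 1) * exp (rate * len z)"
    by (simp add: algebra_simps)
  finally show "norm (X x $ 2 / vel z - 1) \<le> amp * (rate * len z + 1) * exp (rate * len z)" .
  have "t / (2 * exp s2 * d * \<tau>) * e \<le> t / (2 * exp s2 * d * \<tau>) * (\<tau> / 20)"
    using e pos d_pos by (intro mult_left_mono) auto
  also have "\<dots> = S / 40"
    using pos by (simp add: q_def S_def exp_minus field_simps)
  finally have A1: "t / (2 * exp s2 * d * \<tau>) * e \<le> S / 40" .
  have "t / (8 * d * \<rho>) * \<delta> \<le> t / (8 * d * \<rho>) * (\<rho> * q / 33)"
    using \<delta> pos d_pos by (intro mult_left_mono) auto
  also have "\<dots> = S / 264"
    using pos by (simp add: S_def)
  finally have A2: "t / (8 * d * \<rho>) * \<delta> \<le> S / 264" .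
  have td: "0 < t / d"
    using pos d_pos by simp
  have "t / d * q \<le> t / d * 1"
    by (rule mult_left_mono) (use q td in auto)
  then have S: "S \<le> t / d" "0 < S"
    using mult_pos_pos[OF td q(1)] by (auto simp: S_def)
  have "norm ((\<omega> (x$1) (x$2) - \<omega> (z$1) (z$2)) / vel z)
      \<le> exp (E1 + E2) * (t / (2 * exp s2 * d * \<tau>) * e + t / (8 * d * \<rho>) * \<delta>)"
    using seg(2) by (simp add: vel_def)
  also have "\<dots> \<le> 51 / 50 * (S / 40 + S / 264)"
    using expE' A1 A2 e \<delta> pos d_pos by (intro mult_mono add_mono) auto
  finally have \<omega>_diff: "norm ((\<omega> (x$1) (x$2) - \<omega> (z$1) (z$2)) / vel z) \<le> 51 / 50 * (S / 40 + S / 264)" .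
  have "X x $ 3 / vel z - \<omega> (z$1) (z$2) / vel z = (\<omega> (x$1) (x$2) - \<omega> (z$1) (z$2)) / vel z + P x $ 3 / vel z"
    by (simp add: X_components add_divide_distrib diff_divide_distrib)
  then have "norm (X x $ 3 / vel z - \<omega> (z$1) (z$2) / vel z)
      \<le> norm ((\<omega> (x$1) (x$2) - \<omega> (z$1) (z$2)) / vel z) + norm (P x $ 3 / vel z)"
    by (metis norm_triangle_ineq)
  also have "\<dots> \<le> 51 / 50 * (S / 40 + S / 264) + S / 33"
    by (rule add_mono[OF \<omega>_diff P(2)])
  \<comment> \<open>51/50 of 1/40 + 1/264, plus 1/33, is slightly below 1/16.\<close>
  also have "\<dots> \<le> S / 16"
    using S(2) by simp
  also have "S / 16 \<le> t / (16 * d)"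
    using S(1) by simp
  finally show "norm (X x $ 3 / vel z - \<omega> (z$1) (z$2) / vel z) \<le> t / (16 * d)" .
qed

text \<open>The Picard operator of the orbit equation in the independent variable \<open>y\<close>.
  The initial value on the section has second coordinate \<open>y0\<close>, the other two being
  parameters.\<close>

definition step :: "(complex^3 \<Rightarrow> complex^3) \<Rightarrow> complex^3 \<Rightarrow> complex^3" where
  "step \<Psi> z = (\<chi> i. (if i = 2 then of_real y0 else z$i) + J (\<lambda>w. X (\<Psi> w) $ i / vel w) z)"

definition admissible :: "(complex^3 \<Rightarrow> complex^3) \<Rightarrow> bool" where
  "admissible \<Psi> \<longleftrightarrow> (\<forall>i. holo3 (\<lambda>z. \<Psi> z $ i) W) \<and> (\<forall>z\<in>W. near z (\<Psi> z))"

lemma admissible_maps: "admissible \<Psi> \<Longrightarrow> z \<in> W \<Longrightarrow> \<Psi> z \<in> Wm"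
  using near_Wm by (simp add: admissible_def)

lemma integrand_holo:
  assumes "admissible \<Psi>"
  shows "holo3 (\<lambda>w. X (\<Psi> w) $ i / vel w) W"
proof (intro holo3_divide open_doms)
  show "holo3 (\<lambda>w. X (\<Psi> w) $ i) W"
  proof (rule holo3_compose[OF _ open_doms(2) _ X_holo open_doms(1)])
    show "\<Psi> ` W \<subseteq> D"
      using admissible_maps[OF assms] W_sub by auto
  qed (use assms in \<open>auto simp: admissible_def\<close>)
  show "holo3 vel W"
    by (rule holo3_subset[OF vel_holo]) (use W_sub in auto)
  show "vel z \<noteq> 0" if "z \<in> W" for z
    using that W_sub vel_nonzero by auto
qed

lemma integrand_cont:
  assumes "admissible \<Psi>"
  shows "continuous_on W (\<lambda>w. X (\<Psi> w) $ i / vel w)"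
  by (rule holo3_imp_continuous_on[OF integrand_holo[OF assms] open_doms(2)])

lemma quot_cont: "continuous_on W (\<lambda>z. \<omega> (z$1) (z$2) / vel z)"
  by (rule holo3_imp_continuous_on[OF holo3_subset[OF quot_holo] open_doms(2)]) (use W_sub in auto)

text \<open>Each component is compared with the orbit of the normal field by subtracting 0, 1 and
  \<omega>/v under the integral. For the second component the majorant integrates exactly to the
  tube bound, so the tube reproduces itself.\<close>

lemma step_admissible:
  assumes "admissible \<Psi>"
  shows "admissible (step \<Psi>)"
proof -
  have "holo3 (\<lambda>z. step \<Psi> z $ i) W" for i
  proof -
    have "holo3 (\<lambda>z. if i = 2 then of_real y0 else z$i) W"
      by (cases "i = 2") (auto intro: holo3_const holo3_nth open_doms)
    then show ?thesis
      unfolding step_def vec_lambda_beta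
      by (intro holo3_add open_doms J_holo integrand_holo assms)
  qed
  moreover have "near z (step \<Psi> z)" if z: "z \<in> W" for z
    unfolding near_def
  proof (intro conjI)
    have near: "near w (\<Psi> w)" if "w \<in> W" for w
      using assms that by (simp add: admissible_def)
    have l: "0 \<le> len z" "len z \<le> d"
      using len_nonneg len_le z W_sub by auto
    have "norm (J (\<lambda>w. X (\<Psi> w) $ 1 / vel w) z) \<le> V * (\<rho> * \<mu>) * len z - V * (\<rho> * \<mu>) * 0"
    proof (rule J_le[OF integrand_cont[OF assms] z, where b' = "\<lambda>_. V * (\<rho> * \<mu>)"])
      show "((\<lambda>x. V * (\<rho> * \<mu>) * x) has_real_derivative V * (\<rho> * \<mu>)) (at u)" for u
        by (auto intro!: derivative_eq_intros)
      show "norm (X (\<Psi> w) $ 1 / vel w) \<le> V * (\<rho> * \<mu>)" if w: "w \<in> W" for w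
      proof -
        have "w \<in> D" "\<Psi> w \<in> D"
          using w admissible_maps[OF assms w] W_sub by auto
        then show ?thesis
          using inv_vel[of w "P (\<Psi> w) $ 1"] P_bound(1)[of "\<Psi> w"] pos
          unfolding X_components by (meson less_imp_le mult_left_mono order_trans)
      qed
    qed
    moreover have "V * (\<rho> * \<mu>) * len z \<le> \<rho> / d * (exp (- s2) / 33) * d"
      by (rule mult_mono[OF V_mult_le[OF pos(1)] l(2)]) (use l pos d_pos in auto)
    moreover have "\<rho> / d * (exp (- s2) / 33) * d = \<rho> * exp (- s2) / 33"
      using d_pos by simp
    ultimately show "norm (step \<Psi> z $ 1 - z $ 1) \<le> \<rho> * exp (- s2) / 33"
      by (simp add: step_def)
    have "norm (J (\<lambda>w. X (\<Psi> w) $ 2 / vel w - 1) z)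
        \<le> amp * len z * exp (rate * len z) - amp * 0 * exp (rate * 0)"
    proof (rule J_le[OF _ z, where b' = "\<lambda>u. amp * (rate * u + 1) * exp (rate * u)"])
      show "((\<lambda>u. amp * u * exp (rate * u)) has_real_derivative amp * (rate * u + 1) * exp (rate * u)) (at u)" for u
        by (auto intro!: derivative_eq_intros simp: algebra_simps)
      show "norm (X (\<Psi> w) $ 2 / vel w - 1) \<le> amp * (rate * len w + 1) * exp (rate * len w)" if "w \<in> W" for w
        by (rule field_estimates(1)[OF that near[OF that]])
    qed (intro continuous_intros integrand_cont assms)
    \<comment> \<open>The constant 1 integrates to \<open>z$2 - y0\<close>, which replaces the
      initial value \<open>y0\<close> by \<open>z$2\<close>.\<close>
    moreover have "J (\<lambda>w. X (\<Psi> w) $ 2 / vel w - 1) z = step \<Psi> z $ 2 - z$2"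
      by (subst J_diff[OF integrand_cont[OF assms] continuous_on_const z])
        (simp add: step_def path_int_const[OF YY y0_W])
    ultimately show "norm (step \<Psi> z $ 2 - z $ 2) \<le> amp * len z * exp (rate * len z)"
      by simp
    have "norm (J (\<lambda>w. X (\<Psi> w) $ 3 / vel w - \<omega> (w$1) (w$2) / vel w) z) \<le> t / (16 * d) * len z - t / (16 * d) * 0"
    proof (rule J_le[OF _ z, where b' = "\<lambda>_. t / (16 * d)"])
      show "((\<lambda>x. t / (16 * d) * x) has_real_derivative t / (16 * d)) (at u)" for u
        by (rule DERIV_cmult_Id)
      show "norm (X (\<Psi> w) $ 3 / vel w - \<omega> (w$1) (w$2) / vel w) \<le> t / (16 * d)" if "w \<in> W" for w
        by (rule field_estimates(2)[OF that near[OF that]])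
    qed (intro continuous_intros integrand_cont assms quot_cont)
    moreover have "J (\<lambda>w. X (\<Psi> w) $ 3 / vel w - \<omega> (w$1) (w$2) / vel w) z = step \<Psi> z $ 3 - z$3 - Om z"
      by (subst J_diff[OF integrand_cont[OF assms] quot_cont z]) (simp add: step_def Om_def)
    moreover have "t / (16 * d) * len z \<le> t / (16 * d) * d"
      using l pos d_pos by (intro mult_left_mono) auto
    moreover have "t / (16 * d) * d = t / 16"
      using d_pos by simp
    ultimately show "norm (step \<Psi> z $ 3 - z $ 3 - Om z) \<le> t / 16"
      by simp
  qed
  ultimately show ?thesis
    by (simp add: admissible_def)
qed

text \<open>The orbit of the normal field, that is, the solution for \<open>P = 0\<close>.\<close>

definition \<Psi>0 :: "complex^3 \<Rightarrow> complex^3" where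
  "\<Psi>0 z = vector [z$1, z$2, z$3 + Om z]"

lemma \<Psi>0_admissible: "admissible \<Psi>0"
proof -
  have "holo3 (\<lambda>z. z $ 1) W" "holo3 (\<lambda>z. z $ 2) W" "holo3 (\<lambda>z. z $ 3 + Om z) W"
    by (intro holo3_add holo3_nth Om_holo open_doms)+
  then have "holo3 (\<lambda>z. \<Psi>0 z $ i) W" for i
    using index_3_cases[of i] by (auto simp: \<Psi>0_def)
  moreover have "amp * len z * exp (rate * len z) \<ge> 0" for z
    using pos d_pos len_nonneg by (simp add: amp_def)
  then have "near z (\<Psi>0 z)" for z
    using pos by (simp add: near_def \<Psi>0_def)
  ultimately show ?thesis
    by (simp add: admissible_def)
qed

text \<open>The distance is measured by a function of the path length, so that the lemma serves both
  for the factorial decay (\<open>b\<close> a power) and for passing to the limit (\<open>b\<close>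
  linear).\<close>

lemma step_contraction:
  assumes adm: "admissible \<Psi>" "admissible \<Psi>'" and z: "z \<in> W"
    and b: "\<And>u. (b has_real_derivative b' u) (at u)" "\<And>u. u \<ge> 0 \<Longrightarrow> b' u \<ge> 0"
    and diff: "\<And>w i. w \<in> W \<Longrightarrow> norm (\<Psi> w $ i - \<Psi>' w $ i) \<le> b' (len w) * wt i"
  shows "norm (step \<Psi> z $ i - step \<Psi>' z $ i) \<le> V * Mx * (b (len z) - b 0)"
proof -
  have "step \<Psi> z $ i - step \<Psi>' z $ i = J (\<lambda>w. X (\<Psi> w) $ i / vel w - X (\<Psi>' w) $ i / vel w) z"
    by (subst J_diff[OF integrand_cont integrand_cont z]) (auto simp: step_def adm)
  also have "norm \<dots> \<le> V * Mx * b (len z) - V * Mx * b 0"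
  proof (rule J_le[OF _ z, where b' = "\<lambda>u. V * Mx * b' u"])
    show "((\<lambda>u. V * Mx * b u) has_real_derivative V * Mx * b' u) (at u)" for u
      by (intro DERIV_cmult b)
    show "norm (X (\<Psi> w) $ i / vel w - X (\<Psi>' w) $ i / vel w) \<le> V * Mx * b' (len w)" if w: "w \<in> W" for w
    proof -
      have "norm (X (\<Psi> w) $ i - X (\<Psi>' w) $ i) \<le> Mx * b' (len w)"
        by (rule X_lipschitz[OF admissible_maps[OF adm(2) w] admissible_maps[OF adm(1) w] diff[OF w] b(2)[OF len_nonneg]])
      then have "V * norm (X (\<Psi> w) $ i - X (\<Psi>' w) $ i) \<le> V * (Mx * b' (len w))"
        using pos by (intro mult_left_mono) auto
      moreover have "norm ((X (\<Psi> w) $ i - X (\<Psi>' w) $ i) / vel w) \<le> V * norm (X (\<Psi> w) $ i - X (\<Psi>' w) $ i)"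
        using w W_sub by (intro inv_vel) auto
      ultimately show ?thesis
        by (simp add: diff_divide_distrib mult.assoc)
    qed
  qed (intro continuous_intros integrand_cont adm)
  finally show ?thesis
    by (simp add: algebra_simps)
qed

subsection \<open>Picard iteration\<close>

definition iter :: "nat \<Rightarrow> complex^3 \<Rightarrow> complex^3" where
  "iter n = (step ^^ n) \<Psi>0"

lemma iter_simps: "iter 0 = \<Psi>0" "iter (Suc n) = step (iter n)"
  by (simp_all add: iter_def)

lemma iter_admissible: "admissible (iter n)"
  by (induction n) (auto simp: iter_simps \<Psi>0_admissible step_admissible)

text \<open>The constant \<open>V * Mx\<close> in units of the smallest weight, or more; the
  \<open>+ 1\<close> makes it positive, as it is divided by.\<close>

definition K :: real where
  "K = V * \<bar>Mx\<bar> * (1 / \<rho> + 1 / \<tau> + 1 / t) + 1"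

lemma K: "K > 0" "V * Mx \<le> K * wt i"
proof -
  have nonneg: "0 \<le> V * \<bar>Mx\<bar> * (1 / \<rho>)" "0 \<le> V * \<bar>Mx\<bar> * (1 / \<tau>)" "0 \<le> V * \<bar>Mx\<bar> * (1 / t)"
    using pos by auto
  have K_eq: "K = V * \<bar>Mx\<bar> * (1 / \<rho>) + V * \<bar>Mx\<bar> * (1 / \<tau>) + V * \<bar>Mx\<bar> * (1 / t) + 1"
    by (simp add: K_def algebra_simps)
  show "K > 0"
    unfolding K_eq using nonneg by linarith
  have "V * \<bar>Mx\<bar> * (1 / wt i) \<le> K"
    unfolding K_eq using nonneg by (auto simp: wt_def)
  then have "V * \<bar>Mx\<bar> * (1 / wt i) * wt i \<le> K * wt i"
    by (rule mult_right_mono) (rule wt_nonneg)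
  moreover have "V * \<bar>Mx\<bar> * (1 / wt i) * wt i = V * \<bar>Mx\<bar>"
    using wt_nonneg(2)[of i] by simp
  moreover have "V * Mx \<le> V * \<bar>Mx\<bar>"
    using pos by (intro mult_left_mono) auto
  ultimately show "V * Mx \<le> K * wt i"
    by linarith
qed

text \<open>Each application of \<open>step\<close> integrates a power of the path length, which
  raises the exponent and the factorial by one. Hence the iteration converges however large
  \<open>K * d\<close> is.\<close>

lemma iter_diff:
  assumes "z \<in> W"
  shows "norm (iter (Suc n) z $ i - iter n z $ i) \<le> (K * len z) ^ n / fact n * wt i"
  using assms
proof (induction n arbitrary: z i)
  case 0
  have "near z (iter (Suc 0) z)" "near z (iter 0 z)"
    using iter_admissible 0 by (auto simp: admissible_def)
  with near_diff[OF 0] show ?case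
    by simp
next
  case (Suc n)
  let ?b = "\<lambda>u. (K * u) ^ Suc n / (K * fact (Suc n))"
  have "norm (iter (Suc (Suc n)) z $ i - iter (Suc n) z $ i) \<le> V * Mx * (?b (len z) - ?b 0)"
    unfolding iter_simps(2)[of "Suc n"] iter_simps(2)[of n]
  proof (rule step_contraction[where b' = "\<lambda>u. (K * u) ^ n / fact n"])
    show "admissible (step (iter n))" "admissible (iter n)"
      by (simp_all add: iter_admissible step_admissible)
    show "(?b has_real_derivative (K * u) ^ n / fact n) (at u)" for u
    proof -
      have "(?b has_real_derivative ((1 + of_nat n) * (K * (K * u) ^ n)) / (K * fact (Suc n))) (at u)"
        by (rule DERIV_cdivide[OF DERIV_power_Suc[OF DERIV_cmult_Id]])
      moreover have "((1 + of_nat n) * (K * (K * u) ^ n)) / (K * fact (Suc n)) = (K * u) ^ n / fact n"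
        using K(1) by (simp add: add_pos_nonneg divide_simps)
      ultimately show ?thesis
        by simp
    qed
    show "0 \<le> (K * u) ^ n / fact n" if "0 \<le> u" for u
      using K(1) that by simp
    show "norm (step (iter n) w $ j - iter n w $ j) \<le> (K * len w) ^ n / fact n * wt j" if "w \<in> W" for w j
      using Suc.IH[OF that] by (simp add: iter_simps)
  qed (rule Suc.prems)
  also have "\<dots> = V * Mx * ?b (len z)"
    by simp
  also have "\<dots> \<le> K * wt i * ?b (len z)"
    using K len_nonneg by (intro mult_right_mono) auto
  also have "\<dots> = (K * len z) ^ Suc n / fact (Suc n) * wt i"
    using K(1) by simp
  finally show ?case .
qed

text \<open>The limit of the iterates, written as a telescoping series so that the M-test gives
  uniform convergence.\<close>

definition \<Psi> :: "complex^3 \<Rightarrow> complex^3" where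
  "\<Psi> z = (\<chi> i. \<Psi>0 z $ i + (\<Sum>n. iter (Suc n) z $ i - iter n z $ i))"

lemma iter_uniform_limit: "uniform_limit W (\<lambda>n z. iter n z $ i) (\<lambda>z. \<Psi> z $ i) sequentially"
proof -
  have "summable (\<lambda>n. wt i * (inverse (fact n) * (K * d) ^ n))"
    by (intro summable_mult summable_exp)
  moreover have "norm (iter (Suc n) z $ i - iter n z $ i) \<le> wt i * (inverse (fact n) * (K * d) ^ n)"
    if z: "z \<in> W" for n z
  proof -
    have "K * len z \<le> K * d"
      using K(1) len_le z W_sub by (intro mult_left_mono) auto
    then have "(K * len z) ^ n \<le> (K * d) ^ n"
      using K(1) len_nonneg by (intro power_mono) auto
    then have "(K * len z) ^ n / fact n * wt i \<le> (K * d) ^ n / fact n * wt i"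
      by (intro mult_right_mono divide_right_mono wt_nonneg) auto
    with iter_diff[OF z, of n i] show ?thesis
      by (simp add: field_simps)
  qed
  ultimately have "uniform_limit W (\<lambda>N z. \<Sum>n<N. iter (Suc n) z $ i - iter n z $ i)
      (\<lambda>z. \<Sum>n. iter (Suc n) z $ i - iter n z $ i) sequentially"
    by (intro Weierstrass_m_test)
  then have "uniform_limit W (\<lambda>N z. \<Psi>0 z $ i + (\<Sum>n<N. iter (Suc n) z $ i - iter n z $ i))
      (\<lambda>z. \<Psi>0 z $ i + (\<Sum>n. iter (Suc n) z $ i - iter n z $ i)) sequentially"
    by (intro uniform_limit_add uniform_limit_const)
  moreover have "\<Psi>0 z $ i + (\<Sum>n<N. iter (Suc n) z $ i - iter n z $ i) = iter N z $ i" for N z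
    by (subst sum_lessThan_telescope) (simp add: iter_simps)
  ultimately show ?thesis
    by (simp add: \<Psi>_def)
qed

lemma iter_tendsto: "z \<in> W \<Longrightarrow> (\<lambda>n. iter n z $ i) \<longlonglongrightarrow> \<Psi> z $ i"
  by (rule tendsto_uniform_limitI[OF iter_uniform_limit])

lemma \<Psi>_admissible: "admissible \<Psi>"
  unfolding admissible_def
proof (intro conjI allI ballI)
  show "holo3 (\<lambda>z. \<Psi> z $ i) W" for i
    by (rule holo3_uniform_limit[OF _ open_doms(2) iter_uniform_limit])
      (use iter_admissible in \<open>auto simp: admissible_def\<close>)
  show "near z (\<Psi> z)" if z: "z \<in> W" for z
  proof -
    have near: "near z (iter n z)" for n
      using iter_admissible z by (auto simp: admissible_def)
    have lim: "(\<lambda>n. norm (iter n z $ 1 - z $ 1)) \<longlonglongrightarrow> norm (\<Psi> z $ 1 - z $ 1)"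
      "(\<lambda>n. norm (iter n z $ 2 - z $ 2)) \<longlonglongrightarrow> norm (\<Psi> z $ 2 - z $ 2)"
      "(\<lambda>n. norm (iter n z $ 3 - z $ 3 - Om z)) \<longlonglongrightarrow> norm (\<Psi> z $ 3 - z $ 3 - Om z)"
      by (intro tendsto_intros iter_tendsto z)+
    show ?thesis
      unfolding near_def
      by (intro conjI Lim_bounded[OF lim(1)] Lim_bounded[OF lim(2)] Lim_bounded[OF lim(3)])
        (use near[unfolded near_def] in blast)+
  qed
qed

text \<open>\<open>step\<close> is continuous for uniform convergence of admissible maps, so the
  shifted sequence of iterates has both sides as its limit.\<close>

lemma \<Psi>_fixpoint:
  assumes z: "z \<in> W"
  shows "step \<Psi> z = \<Psi> z"
proof -
  have "step \<Psi> z $ i = \<Psi> z $ i" for i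
  proof (rule LIMSEQ_unique)
    show "(\<lambda>n. iter (Suc n) z $ i) \<longlonglongrightarrow> \<Psi> z $ i"
      using iter_tendsto[OF z] by (rule LIMSEQ_Suc)
    show "(\<lambda>n. iter (Suc n) z $ i) \<longlonglongrightarrow> step \<Psi> z $ i"
    proof (rule tendstoI)
      fix e :: real
      assume "e > 0"
      \<comment> \<open>A weighted uniform error \<open>\<epsilon>\<close> changes
        \<open>step\<close> by at most \<open>V * \<bar>Mx\<bar> * d * \<epsilon>\<close>, which is
        then below \<open>e\<close>.\<close>
      define \<epsilon> where "\<epsilon> = e / (V * \<bar>Mx\<bar> * d + 1)"
      have Vd: "V * \<bar>Mx\<bar> * d \<ge> 0"
        using pos d_pos by simp
      have "\<epsilon> > 0"
        using \<open>e > 0\<close> Vd by (simp add: \<epsilon>_def)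
      have "\<forall>\<^sub>F n in sequentially. \<forall>w\<in>W. dist (iter n w $ j) (\<Psi> w $ j) < \<epsilon> * wt j" for j
        using uniform_limitD[OF iter_uniform_limit] wt_nonneg(2)[of j] \<open>\<epsilon> > 0\<close> by simp
      then have "\<forall>\<^sub>F n in sequentially. \<forall>j. \<forall>w\<in>W. dist (iter n w $ j) (\<Psi> w $ j) < \<epsilon> * wt j"
        by (rule eventually_all_finite)
      then show "\<forall>\<^sub>F n in sequentially. dist (iter (Suc n) z $ i) (step \<Psi> z $ i) < e"
      proof eventually_elim
        case (elim n)
        have "norm (step (iter n) z $ i - step \<Psi> z $ i) \<le> V * Mx * (\<epsilon> * len z - \<epsilon> * 0)"
        proof (rule step_contraction[OF iter_admissible \<Psi>_admissible z, where b' = "\<lambda>_. \<epsilon>"])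
          show "((\<lambda>u. \<epsilon> * u) has_real_derivative \<epsilon>) (at u)" for u
            by (rule DERIV_cmult_Id)
          show "norm (iter n w $ j - \<Psi> w $ j) \<le> \<epsilon> * wt j" if "w \<in> W" for w j
            using elim that by (auto simp: dist_norm less_imp_le)
        qed (use \<open>\<epsilon> > 0\<close> in auto)
        also have "\<dots> \<le> V * \<bar>Mx\<bar> * (\<epsilon> * d)"
        proof -
          have "len z \<le> d"
            using z W_sub len_le by auto
          moreover have "V * Mx \<le> V * \<bar>Mx\<bar>"
            using pos by (intro mult_left_mono) auto
          ultimately show ?thesis
            using pos \<open>\<epsilon> > 0\<close> len_nonneg[of z] mult_mono[of "V * Mx" "V * \<bar>Mx\<bar>" "\<epsilon> * len z" "\<epsilon> * d"]
            by simp
        qed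
        also have "\<dots> = e * (V * \<bar>Mx\<bar> * d / (V * \<bar>Mx\<bar> * d + 1))"
          by (simp add: \<epsilon>_def)
        also have "\<dots> < e * 1"
          using Vd \<open>e > 0\<close> by (intro mult_strict_left_mono) auto
        finally show ?case
          by (simp add: iter_simps dist_norm)
      qed
    qed
  qed
  then show ?thesis
    by (simp add: vec_eq_iff)
qed

section \<open>The orbit equation, periodicity in the angle and reality\<close>

lemma \<Psi>_partial_2:
  assumes z: "z \<in> W"
  shows "partial 2 (\<lambda>z. \<Psi> z $ i) z = X (\<Psi> z) $ i / vel z"
proof -
  let ?S = "(\<lambda>\<zeta>. z + axis 2 \<zeta>) -` W"
  have S: "open ?S"
    by (intro open_vimage open_doms continuous_intros)
  have "((\<lambda>\<zeta>. if i = 2 then of_real y0 else (z + axis 2 \<zeta>) $ i) has_field_derivative 0) (at 0)"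
    using has_field_derivative_nth_axis[of z 2 i] by (cases "i = 2") simp_all
  then have "((\<lambda>\<zeta>. step \<Psi> (z + axis 2 \<zeta>) $ i) has_field_derivative 0 + X (\<Psi> z) $ i / vel z) (at 0)"
    unfolding step_def vec_lambda_beta
    by (rule DERIV_add) (rule J_partial_2[OF integrand_holo[OF \<Psi>_admissible] z])
  then have "((\<lambda>\<zeta>. \<Psi> (z + axis 2 \<zeta>) $ i) has_field_derivative 0 + X (\<Psi> z) $ i / vel z) (at 0)"
    by (rule has_field_derivative_transform_within_open[OF _ S]) (use z \<Psi>_fixpoint in auto)
  then show ?thesis
    by (simp add: partial_def DERIV_imp_deriv)
qed

lemma X_shift: "x \<in> D \<Longrightarrow> X (x + axis 3 (of_real (2 * pi * of_int m))) = X x"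
  using P_periodic[of x m] by (simp add: X_def normal_field_def axis_def)

lemma W_shift: "z \<in> W \<Longrightarrow> z + axis 3 (of_real a) \<in> W"
  by (simp add: W_def mem_phase_dom axis_def)

text \<open>\<open>X\<close> is periodic in the angle and the clock \<open>vel\<close> does not
  depend on it, so the Picard operator preserves maps that commute with the translations by
  multiples of 2 \<pi>.\<close>

lemma iter_shift:
  assumes "z \<in> W"
  shows "iter n (z + axis 3 (of_real (2 * pi * of_int m))) = iter n z + axis 3 (of_real (2 * pi * of_int m))"
  using assms
proof (induction n arbitrary: z)
  case 0
  then show ?case
    using Om_shift[of z] by (simp add: iter_simps \<Psi>0_def vec_eq_iff forall_3 axis_def)
next
  case (Suc n)
  let ?c = "complex_of_real (2 * pi * of_int m)"
  have "J (\<lambda>w. X (iter n w) $ i / vel w) (z + axis 3 ?c) = J (\<lambda>w. X (iter n w) $ i / vel w) z" for i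
  proof (rule J_shift[OF _ Suc.prems])
    fix w
    assume w: "w \<in> W"
    have "iter n w \<in> D"
      using admissible_maps[OF iter_admissible w] W_sub by auto
    moreover have "vel (w + axis 3 ?c) = vel w"
      by (simp add: vel_def axis_def)
    ultimately show "X (iter n (w + axis 3 ?c)) $ i / vel (w + axis 3 ?c) = X (iter n w) $ i / vel w"
      by (simp only: Suc.IH[OF w] X_shift)
  qed
  then show ?case
    by (simp add: iter_simps step_def vec_eq_iff forall_3 axis_def)
qed

lemma \<Psi>_shift:
  assumes z: "z \<in> W"
  shows "\<Psi> (z + axis 3 (of_real (2 * pi * of_int m))) = \<Psi> z + axis 3 (of_real (2 * pi * of_int m))"
proof -
  let ?c = "axis 3 (complex_of_real (2 * pi * of_int m)) :: complex^3"
  have "\<Psi> (z + ?c) $ i = (\<Psi> z + ?c) $ i" for i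
  proof (rule LIMSEQ_unique)
    show "(\<lambda>n. iter n (z + ?c) $ i) \<longlonglongrightarrow> \<Psi> (z + ?c) $ i"
      by (rule iter_tendsto[OF W_shift[OF z]])
    show "(\<lambda>n. iter n (z + ?c) $ i) \<longlonglongrightarrow> (\<Psi> z + ?c) $ i"
      unfolding iter_shift[OF z] vector_add_component by (intro tendsto_intros iter_tendsto z)
  qed
  then show ?thesis
    by (simp add: vec_eq_iff)
qed

lemma \<Psi>_real:
  assumes real: "real_on_reals D (normal_field v \<omega>)" "real_on_reals D P"
    and z: "z \<in> W" "\<And>i. z $ i \<in> \<real>"
  shows "\<Psi> z $ i \<in> \<real>"
proof -
  have vel: "vel w \<in> \<real>" and \<omega>: "\<omega> (w$1) (w$2) \<in> \<real>" if "w \<in> D" "\<And>i. w $ i \<in> \<real>" for w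
  proof -
    have "normal_field v \<omega> w $ 2 \<in> \<real>" "normal_field v \<omega> w $ 3 \<in> \<real>"
      using real(1) that by (auto simp: real_on_reals_def)
    then show "vel w \<in> \<real>" "\<omega> (w$1) (w$2) \<in> \<real>"
      by (simp_all add: normal_field_def vel_def)
  qed
  have X: "X w $ i \<in> \<real>" if "w \<in> D" "\<And>i. w $ i \<in> \<real>" for w i
    using real that by (auto simp: real_on_reals_def X_def)
  have Om: "Om w \<in> \<real>" if w: "w \<in> W" "\<And>i. w $ i \<in> \<real>" for w
    unfolding Om_def
    by (rule J_real[OF _ quot_cont w]) (use vel \<omega> W_sub in auto)
  have "iter n w $ i \<in> \<real>" if "w \<in> W" "\<And>i. w $ i \<in> \<real>" for n w i
    using that
  proof (induction n arbitrary: w i)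
    case 0
    then show ?case
      using index_3_cases[of i] Om[OF 0] by (auto simp: iter_simps \<Psi>0_def)
  next
    case (Suc n)
    have "J (\<lambda>w. X (iter n w) $ i / vel w) w \<in> \<real>"
    proof (rule J_real[OF _ integrand_cont[OF iter_admissible] Suc.prems])
      fix u
      assume u: "u \<in> W" "\<And>i. u $ i \<in> \<real>"
      have "iter n u \<in> D" "u \<in> D"
        using admissible_maps[OF iter_admissible u(1)] W_sub u by auto
      then show "X (iter n u) $ i / vel u \<in> \<real>"
        using Suc.IH[OF u] u by (intro Reals_divide X vel)
    qed simp
    then show ?case
      using Suc.prems by (simp add: iter_simps step_def)
  qed
  from this[OF z] show ?thesis
    by (intro Lim_in_closed_set[OF closed_complex_Reals _ _ iter_tendsto[OF z(1)]]) auto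
qed

subsection \<open>The conjugating map\<close>

text \<open>On \<open>D1\<close> one more \<open>t\<close> of the strip is kept for the angle shift
  by \<open>Om\<close>. \<open>D2\<close> is the target domain and leaves a full polydisc of radii
  (\<rho>, \<tau>, t) for Cauchy's estimate.\<close>

definition D1 :: "(complex^3) set" where
  "D1 = phase_dom II YY (r - 7 * \<rho>) (\<sigma> - 8 * exp s2 * \<tau> + \<tau>) (s - 9 * t)"

definition D2 :: "(complex^3) set" where
  "D2 = phase_dom II YY (r - 8 * \<rho>) (\<sigma> - 8 * exp s2 * \<tau>) (s - 10 * t)"

text \<open>Undoes the angle drift of the normal field: in these coordinates the orbits of
  \<open>N\<close> have constant angle.\<close>

definition straighten :: "complex^3 \<Rightarrow> complex^3" where
  "straighten z = z + axis 3 (- Om z)"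

definition \<Phi> :: "complex^3 \<Rightarrow> complex^3" where
  "\<Phi> z = \<Psi> (straighten z)"

lemma open_D12: "open D1" "open D2"
  by (auto simp: D1_def D2_def open_phase_dom)

lemma D12_sub: "D1 \<subseteq> W" "D2 \<subseteq> D1" "D2 \<subseteq> D"
proof -
  show *: "D1 \<subseteq> W" "D2 \<subseteq> D1"
    unfolding D1_def D2_def W_def by (intro phase_dom_mono; use pos in linarith)+
  then show "D2 \<subseteq> D"
    using W_sub by auto
qed

lemma straighten_W: "z \<in> D1 \<Longrightarrow> straighten z \<in> W"
proof -
  assume z: "z \<in> D1"
  have "norm (Om z) \<le> t"
    using Om_bound z D12_sub by auto
  then have "\<bar>Im (- Om z)\<bar> \<le> t"
    using abs_Im_le_cmod[of "- Om z"] by simp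
  then have "z + axis 3 (- Om z) \<in> phase_dom II YY (r - 7 * \<rho> + 0) (\<sigma> - 8 * exp s2 * \<tau> + \<tau> + 0) (s - 9 * t + t)"
    using z by (intro phase_dom_add) (auto simp: D1_def axis_def)
  then show ?thesis
    by (simp add: straighten_def W_def)
qed

lemma straighten_components: "straighten z $ 1 = z$1" "straighten z $ 2 = z$2" "straighten z $ 3 = z$3 - Om z"
  by (simp_all add: straighten_def axis_def)

text \<open>\<open>Om\<close> does not depend on the angle, so the shift by \<open>- Om\<close>
  cancels exactly the drift \<open>Om\<close> around which \<open>near\<close> measures the third
  component.\<close>

lemma \<Phi>_near: "z \<in> D1 \<Longrightarrow> norm (\<Phi> z $ i - z $ i) \<le> wt i / 16"
proof -
  assume z: "z \<in> D1"
  have n: "near (straighten z) (\<Phi> z)"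
    using \<Psi>_admissible straighten_W[OF z] by (simp add: admissible_def \<Phi>_def)
  have "Om (straighten z) = Om z"
    by (simp add: straighten_def Om_shift)
  then have "norm (\<Phi> z $ 3 - z $ 3) \<le> t / 16"
    using n by (simp add: near_def straighten_components)
  moreover have "norm (\<Phi> z $ 1 - z $ 1) \<le> \<rho> / 16"
    using near_x[OF n] pos by (simp add: straighten_components)
  moreover have "norm (\<Phi> z $ 2 - z $ 2) \<le> \<tau> / 16"
    using near_y[OF straighten_W[OF z] n] pos by (simp add: straighten_components)
  ultimately show ?thesis
    using index_3_cases[of i] by (auto simp: wt_def)
qed

lemma straighten_holo: "holo3 (\<lambda>z. straighten z $ i) D1"
proof -
  have "holo3 (\<lambda>z. z $ 1) D1" "holo3 (\<lambda>z. z $ 2) D1" "holo3 (\<lambda>z. z $ 3 - Om z) D1"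
    by (intro holo3_diff holo3_nth holo3_subset[OF Om_holo] D12_sub open_D12)+
  then show ?thesis
    using index_3_cases[of i] by (auto simp: straighten_components)
qed

lemma \<Phi>_holo: "holo3 (\<lambda>z. \<Phi> z $ i) D1"
  unfolding \<Phi>_def
  by (rule holo3_compose[OF straighten_holo open_D12(1) _ _ open_doms(2)])
    (use straighten_W \<Psi>_admissible in \<open>auto simp: admissible_def\<close>)

lemma polydisc_D2: "z \<in> D2 \<Longrightarrow> (\<And>i. norm (h $ i) \<le> wt i) \<Longrightarrow> z + h \<in> D1"
proof -
  assume z: "z \<in> D2" and h: "\<And>i. norm (h $ i) \<le> wt i"
  have "\<bar>Im (h$3)\<bar> \<le> t"
    using h[of 3] abs_Im_le_cmod[of "h$3"] by (simp add: wt_def)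
  then have "z + h \<in> phase_dom II YY (r - 8 * \<rho> + \<rho>) (\<sigma> - 8 * exp s2 * \<tau> + \<tau>) (s - 10 * t + t)"
    using z h[of 1] h[of 2] by (intro phase_dom_add) (auto simp: D2_def wt_def)
  then show ?thesis
    by (simp add: D1_def)
qed

lemma displacement_holo: "holo3 (\<lambda>z. \<Phi> z $ i - z $ i) D1"
  by (intro holo3_diff \<Phi>_holo holo3_nth open_D12)

text \<open>\<open>c\<close> is the weighted maximum norm of \<open>h\<close>, attained at
  \<open>j\<close>. Looking at coordinate \<open>j\<close> alone then suffices to contradict a
  contraction.\<close>

lemma weighted_max:
  fixes h :: "complex^3"
  obtains c j where "c \<ge> 0" "\<And>i. norm (h $ i) \<le> c * wt i" "norm (h $ j) = c * wt j"
proof -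
  define c where "c = Max (range (\<lambda>i. norm (h $ i) / wt i))"
  have le: "norm (h $ i) / wt i \<le> c" for i
    unfolding c_def by (intro Max_ge) auto
  have "c \<in> range (\<lambda>i. norm (h $ i) / wt i)"
    unfolding c_def by (intro Max_in) auto
  then obtain j where j: "c = norm (h $ j) / wt j"
    by auto
  show ?thesis
  proof (rule that)
    show "norm (h $ i) \<le> c * wt i" for i
      using le[of i] wt_nonneg(2)[of i] by (simp add: pos_divide_le_eq)
    show "c \<ge> 0" "norm (h $ j) = c * wt j"
      using j wt_nonneg(2)[of j] by simp_all
  qed
qed

text \<open>If the images agree, the displacements differ by \<open>z' - z\<close>. At the index
  \<open>j\<close> where the weighted norm \<open>c\<close> is attained this gives
  \<open>c * wt j \<le> c * wt j / 16\<close>.\<close>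

lemma \<Phi>_inj:
  assumes z: "z \<in> D2" "z' \<in> D2" and eq: "\<Phi> z = \<Phi> z'"
  shows "z = z'"
proof -
  obtain c j where c: "c \<ge> 0" "\<And>i. norm ((z' - z) $ i) \<le> c * wt i" "norm ((z' - z) $ j) = c * wt j"
    using weighted_max by blast
  have "norm ((\<Phi> z' $ j - z' $ j) - (\<Phi> z $ j - z $ j)) \<le> wt j / 16 * c"
  proof (rule holo3_lipschitz[OF displacement_holo open_D12(1) \<Phi>_near _ wt_nonneg(1) polydisc_D2 z _ c(1)])
    show "convex D2"
      unfolding D2_def by (intro convex_phase_dom II YY)
    show "norm (z' $ i - z $ i) \<le> c * wt i" for i
      using c(2)[of i] by simp
  qed
  then have "norm ((z' - z) $ j) \<le> wt j / 16 * c"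
    using eq by (simp add: norm_minus_commute)
  then have "c * wt j \<le> 0"
    using c(3) by simp
  then have "c = 0"
    using c(1) wt_nonneg(2)[of j] by (simp add: mult_le_0_iff)
  then show ?thesis
    using c(2) by (simp add: vec_eq_iff)
qed

lemma \<Phi>_has_derivative: "z \<in> D1 \<Longrightarrow> (\<Phi> has_derivative (\<lambda>h. jac \<Phi> z *v h)) (at z)"
  by (rule has_derivative_jac[OF \<Phi>_holo open_D12(1)])

lemma \<Phi>_jacobian: "z \<in> D1 \<Longrightarrow> jacobian \<Phi> (at z) = jac \<Phi> z"
  by (rule jacobian_eq_jac[OF \<Phi>_holo open_D12(1)])

text \<open>Infinitesimal version of injectivity: on a kernel vector the derivative of the
  displacement acts as \<open>- h\<close>, but its weighted norm is at most 1/16.\<close>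

lemma \<Phi>_invertible:
  assumes z: "z \<in> D2"
  shows "invertible (jac \<Phi> z)"
proof -
  have "h = 0" if h: "jac \<Phi> z *v h = 0" for h
  proof -
    obtain c j where c: "c \<ge> 0" "\<And>i. norm (h $ i) \<le> c * wt i" "norm (h $ j) = c * wt j"
      using weighted_max by blast
    show ?thesis
    proof (cases "c = 0")
      case True
      then show ?thesis
        using c(2) by (simp add: vec_eq_iff)
    next
      case False
      let ?g = "\<lambda>z. \<Phi> z $ j - z $ j"
      have "z \<in> D1"
        using z D12_sub by auto
      have "((\<lambda>z. \<Phi> z $ j) has_derivative (\<lambda>h. (jac \<Phi> z *v h) $ j)) (at z)"
        by (rule bounded_linear.has_derivative[OF bounded_linear_vec_nth \<Phi>_has_derivative[OF \<open>z \<in> D1\<close>]])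
      then have "(?g has_derivative (\<lambda>h. (jac \<Phi> z *v h) $ j - h $ j)) (at z)"
        by (rule has_derivative_diff[OF _ bounded_linear.has_derivative[OF bounded_linear_vec_nth has_derivative_ident]])
      moreover have "(?g has_derivative (\<lambda>h. \<Sum>i\<in>UNIV. partial i ?g z * h $ i)) (at z)"
        by (rule holo3_has_derivative[OF displacement_holo open_D12(1) \<open>z \<in> D1\<close>])
      ultimately have "(\<lambda>h. (jac \<Phi> z *v h) $ j - h $ j) = (\<lambda>h. \<Sum>i\<in>UNIV. partial i ?g z * h $ i)"
        by (rule has_derivative_unique)
      then have "(jac \<Phi> z *v h) $ j - h $ j = (\<Sum>i\<in>UNIV. partial i ?g z * h $ i)"
        by (rule fun_cong)
      then have "norm (h $ j) = norm (\<Sum>i\<in>UNIV. partial i ?g z * h $ i)"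
        using h by (metis diff_0 norm_minus_cancel zero_index)
      moreover have "norm (\<Sum>i\<in>UNIV. partial i ?g z * h $ i) \<le> wt j / 16 * c"
        by (rule holo3_directional_bound[OF displacement_holo open_D12(1) \<Phi>_near polydisc_D2[OF z] c(2)])
          (use c(1) False in auto)
      ultimately have "norm (h $ j) \<le> wt j / 16 * c"
        by (simp only:)
      then have "c * wt j \<le> 0"
        using c(3) by simp
      then show ?thesis
        using c(1) False wt_nonneg(2)[of j] by (simp add: mult_le_0_iff)
    qed
  qed
  then show ?thesis
    unfolding invertible_left_inverse matrix_left_invertible_ker by blast
qed

text \<open>The derivative of \<open>straighten\<close> maps \<open>N\<close> to \<open>v\<close>
  times the second unit vector: \<open>N\<close> has no first component, and \<partial>_y \<Omega> =
  \<omega> / v cancels the angle component. The orbit equation then gives \<open>X\<close>, the two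
  factors \<open>v\<close> cancelling since \<open>straighten\<close> fixes the first two
  coordinates.\<close>

lemma \<Phi>_conjugates:
  assumes z: "z \<in> D1"
  shows "jac \<Phi> z *v normal_field v \<omega> z = X (\<Phi> z)"
proof -
  let ?N = "normal_field v \<omega> z" and ?w = "straighten z"
  have w: "?w \<in> W" and zD: "z \<in> D"
    using straighten_W z D12_sub W_sub by auto
  let ?L = "\<lambda>h::complex^3. h + axis 3 (- (\<Sum>i\<in>UNIV. partial i Om z * h $ i))"
  have "(Om has_derivative (\<lambda>h. \<Sum>i\<in>UNIV. partial i Om z * h $ i)) (at z)"
    using z D12_sub by (intro holo3_has_derivative[OF Om_holo open_doms(2)]) auto
  then have st: "(straighten has_derivative ?L) (at z)"
    unfolding straighten_def
    by (intro has_derivative_add has_derivative_ident bounded_linear.has_derivative[OF bounded_linear_axis]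
        has_derivative_minus)
  have "(\<Psi> has_derivative (\<lambda>h. jac \<Psi> ?w *v h)) (at ?w)"
    by (rule has_derivative_jac[OF _ open_doms(2) w]) (use \<Psi>_admissible in \<open>simp add: admissible_def\<close>)
  from has_derivative_compose[OF st this]
  have "(\<Phi> has_derivative (\<lambda>h. jac \<Psi> ?w *v ?L h)) (at z)"
    by (simp only: \<Phi>_def[abs_def])
  then have "(\<lambda>h. jac \<Phi> z *v h) = (\<lambda>h. jac \<Psi> ?w *v ?L h)"
    using \<Phi>_has_derivative[OF z] has_derivative_unique by blast
  then have "jac \<Phi> z *v ?N = jac \<Psi> ?w *v ?L ?N"
    by (rule fun_cong)
  also have "?L ?N = axis 2 (vel z)"
  proof -
    have "partial 2 Om z = \<omega> (z$1) (z$2) / vel z"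
      using J_partial_2[OF holo3_subset[OF quot_holo], of z] W_sub z D12_sub
      by (auto simp: partial_def Om_def DERIV_imp_deriv)
    moreover have "partial 3 Om z = 0"
      by (simp add: partial_def Om_shift)
    ultimately have "(\<Sum>i\<in>UNIV. partial i Om z * ?N $ i) = \<omega> (z$1) (z$2)"
      using vel_nonzero[OF zD] by (simp add: sum_3 normal_field_def) (simp add: vel_def)
    then show ?thesis
      by (simp add: vec_eq_iff forall_3 axis_def) (simp add: normal_field_def vel_def)
  qed
  also have "jac \<Psi> ?w *v axis 2 (vel z) = X (\<Phi> z)"
  proof -
    have "(jac \<Psi> ?w *v axis 2 (vel z)) $ i = X (\<Psi> ?w) $ i / vel ?w * vel z" for i
      using \<Psi>_partial_2[OF w, of i] by (simp add: jac_def matrix_vector_mult_def sum_3 axis_def)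
    moreover have "vel ?w = vel z"
      by (simp add: vel_def straighten_components)
    ultimately show ?thesis
      using vel_nonzero[OF zD] by (simp add: vec_eq_iff \<Phi>_def)
  qed
  finally show ?thesis .
qed

lemma transform_eq:
  assumes z: "z \<in> D2"
  shows "transform_field \<Phi> (\<lambda>z. normal_field v \<omega> z + P z) z = normal_field v \<omega> z"
proof -
  have "z \<in> D1"
    using z D12_sub by auto
  have "matrix_inv (jac \<Phi> z) ** jac \<Phi> z = mat 1"
    using \<Phi>_invertible[OF z] unfolding invertible_def matrix_inv_def by (rule someI2_ex) blast
  then have "matrix_inv (jac \<Phi> z) *v (jac \<Phi> z *v normal_field v \<omega> z) = normal_field v \<omega> z"
    by (simp add: matrix_vector_mul_assoc)
  then show ?thesis
    by (simp add: transform_field_def \<Phi>_jacobian[OF \<open>z \<in> D1\<close>] \<Phi>_conjugates[OF \<open>z \<in> D1\<close>] X_def)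
qed

lemma \<Phi>_shift:
  assumes "z \<in> D1"
  shows "\<Phi> (z + axis 3 (of_real (2 * pi * of_int m))) = \<Phi> z + axis 3 (of_real (2 * pi * of_int m))"
proof -
  have "straighten (z + axis 3 (of_real (2 * pi * of_int m))) = straighten z + axis 3 (of_real (2 * pi * of_int m))"
    by (simp add: straighten_def Om_shift)
  then show ?thesis
    using \<Psi>_shift[OF straighten_W[OF assms], of m] by (simp add: \<Phi>_def)
qed

lemma coord_change_\<Phi>: "coord_change \<Phi> D2 D"
  unfolding coord_change_def
proof (intro conjI allI ballI)
  show "holo3 (\<lambda>z. \<Phi> z $ i) D2" for i
    by (rule holo3_subset[OF \<Phi>_holo D12_sub(2)])
  show "\<Phi> ` D2 \<subseteq> D"
  proof
    fix x
    assume "x \<in> \<Phi> ` D2"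
    then obtain z where "z \<in> D1" "x = \<Phi> z"
      using D12_sub by auto
    then show "x \<in> D"
      using admissible_maps[OF \<Psi>_admissible straighten_W] W_sub by (auto simp: \<Phi>_def)
  qed
  show "invertible (jacobian \<Phi> (at z))" if "z \<in> D2" for z
    using \<Phi>_invertible[OF that] \<Phi>_jacobian that D12_sub by auto
  show "torus_eq (\<Phi> z) (\<Phi> z') \<longleftrightarrow> torus_eq z z'" if z: "z \<in> D2" "z' \<in> D2" for z z'
  proof -
    have D1: "z' \<in> D1"
      using z D12_sub by auto
    \<comment> \<open>Translating \<open>z'\<close> by the period that separates the images turns
      equality on the torus into equality on the cover, where injectivity applies.\<close>
    have D2: "z' + axis 3 (of_real (2 * pi * of_int m)) \<in> D2" for m
      using z by (simp add: D2_def mem_phase_dom axis_def)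
    show ?thesis
      unfolding torus_eq_iff \<Phi>_shift[OF D1, symmetric] using \<Phi>_inj[OF z(1) D2] by metis
  qed
qed

lemma \<Phi>_real:
  assumes real: "real_on_reals D (normal_field v \<omega>)" "real_on_reals D P"
  shows "real_on_reals D2 \<Phi>"
  unfolding real_on_reals_def
proof (intro ballI impI allI)
  fix z i
  assume z: "z \<in> D2" "\<forall>i. z $ i \<in> \<real>"
  have zD: "z \<in> D1" "z \<in> W"
    using z D12_sub by auto
  have "normal_field v \<omega> w $ 2 \<in> \<real>" "normal_field v \<omega> w $ 3 \<in> \<real>" if "w \<in> W" "\<And>i. w $ i \<in> \<real>" for w
    using real(1) that W_sub by (auto simp: real_on_reals_def)
  then have "\<omega> (w$1) (w$2) / vel w \<in> \<real>" if "w \<in> W" "\<And>i. w $ i \<in> \<real>" for w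
    using that by (auto simp: normal_field_def vel_def)
  then have "Om z \<in> \<real>"
    unfolding Om_def using z zD by (intro J_real[OF _ quot_cont]) auto
  then have "straighten z $ i \<in> \<real>" for i
    using z index_3_cases[of i] by (auto simp: straighten_components)
  then show "\<Phi> z $ i \<in> \<real>"
    unfolding \<Phi>_def by (rule \<Psi>_real[OF real straighten_W[OF zD(1)]])
qed

end

subsection \<open>The normal form theorem\<close>

lemma convex_of_connected_real: "connected (A :: real set) \<Longrightarrow> convex A"
  using is_interval_connected_1 is_interval_convex_1 by blast

text \<open>Supplies \<sigma> \<le> d, by which the smallness of \<tau> against \<sigma> becomes
  smallness against \<open>d\<close>.\<close>

lemma le_diameter_cnbhd:
  assumes "bounded (cnbhd A r)" "A \<noteq> {}" "r > 0"
  shows "r \<le> diameter (cnbhd A r)"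
proof -
  obtain x where x: "x \<in> A"
    using assms(2) by blast
  have "dist (of_real x + of_real (r / 2)) (of_real x - of_real (r / 2) :: complex) \<le> diameter (cnbhd A r)"
    using x assms by (intro diameter_bounded_bound) (auto simp: cnbhd_iff intro!: bexI[of _ x])
  moreover have "dist (of_real x + of_real (r / 2)) (of_real x - of_real (r / 2) :: complex) = r"
    using \<open>r > 0\<close> by (simp add: dist_norm)
  ultimately show ?thesis
    by simp
qed

section \<open>Membership in the function spaces on the target domain\<close>

lemma fourier_coeff_base:
  "fourier_coeff (\<lambda>z. g (z$1) (z$2)) k a y = (if k = 0 then g a y else 0)"
proof -
  have "integral {0..2*pi} (\<lambda>x. exp (- \<i> * of_int k * complex_of_real x)) = (if k = 0 then of_real (2 * pi) else 0)"
    using integral_exp_int[of "- k"] by simp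
  then show ?thesis
    by (simp add: fourier_coeff_def)
qed

lemma base_in_O_space:
  assumes holo: "holo3 (\<lambda>z. g (z$1) (z$2)) (phase_dom II YY r \<sigma> s)" and bdd: "sup_bdd (base_dom II YY r \<sigma>) g"
    and ne: "base_dom II YY r \<sigma> \<noteq> {}"
  shows "(\<lambda>z. g (z$1) (z$2)) \<in> O_space II YY r \<sigma> s"
proof -
  let ?B = "base_dom II YY r \<sigma>"
  have coeff: "fourier_coeff (\<lambda>z. g (z$1) (z$2)) k = (if k = 0 then g else (\<lambda>a y. 0))" for k
    by (intro ext) (simp add: fourier_coeff_base)
  have zero: "sup_bdd ?B (\<lambda>a y. 0)" "sup_norm ?B (\<lambda>a y. 0) = 0"
    using ne by (auto simp: sup_bdd_def sup_norm_def case_prod_unfold)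
  have "(\<lambda>k::int. sup_norm ?B (fourier_coeff (\<lambda>z. g (z$1) (z$2)) k) * exp (\<bar>of_int k\<bar> * s)) summable_on UNIV"
  proof (rule finite_nonzero_values_imp_summable_on)
    have "{k \<in> UNIV. sup_norm ?B (fourier_coeff (\<lambda>z. g (z$1) (z$2)) k) * exp (\<bar>of_int k\<bar> * s) \<noteq> 0} \<subseteq> {0::int}"
      by (auto simp: coeff zero split: if_splits)
    then show "finite {k \<in> UNIV. sup_norm ?B (fourier_coeff (\<lambda>z. g (z$1) (z$2)) k) * exp (\<bar>of_int k\<bar> * s) \<noteq> (0::real)}"
      by (rule finite_subset) simp
  qed
  then show ?thesis
    using holo bdd zero by (auto simp: O_space_def torus_eq_def coeff)
qed

text \<open>The transformed field is known to equal \<open>N\<close> only on the target domain.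
  Membership sees no other values: the domain is open, and the coefficients sample real angles,
  which lie in the strip.\<close>

lemma O_space_cong:
  assumes f: "f \<in> O_space II YY r \<sigma> s" and eq: "\<And>z. z \<in> phase_dom II YY r \<sigma> s \<Longrightarrow> g z = f z" and "s > 0"
  shows "g \<in> O_space II YY r \<sigma> s"
proof -
  let ?D = "phase_dom II YY r \<sigma> s" and ?B = "base_dom II YY r \<sigma>"
  have "holo3 g ?D"
    unfolding holo3_def
  proof
    fix z
    assume z: "z \<in> ?D"
    then obtain a where "(f has_derivative (\<lambda>h. \<Sum>i\<in>UNIV. a$i * h$i)) (at z)"
      using f unfolding O_space_def holo3_def by fast
    then have "(g has_derivative (\<lambda>h. \<Sum>i\<in>UNIV. a$i * h$i)) (at z)"
      by (rule has_derivative_transform_within_open[OF _ open_phase_dom z]) (simp add: eq)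
    then show "\<exists>a. (g has_derivative (\<lambda>h. \<Sum>i\<in>UNIV. a$i * h$i)) (at z)"
      by blast
  qed
  moreover have coeff: "fourier_coeff g k a y = fourier_coeff f k a y" if "(a, y) \<in> ?B" for k a y
  proof -
    have "g (vector [a, y, of_real x]) = f (vector [a, y, of_real x])" for x :: real
      using that \<open>s > 0\<close> by (intro eq) (simp add: phase_dom_def)
    then show ?thesis
      by (simp add: fourier_coeff_def)
  qed
  have "sup_bdd ?B (fourier_coeff g k) = sup_bdd ?B (fourier_coeff f k)" for k
    unfolding sup_bdd_def by (intro arg_cong[where f = bdd_above] image_cong) (auto simp: coeff)
  moreover have "sup_norm ?B (fourier_coeff g k) = sup_norm ?B (fourier_coeff f k)" for k
    unfolding sup_norm_def by (intro SUP_cong) (auto simp: coeff)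
  ultimately show ?thesis
    using f eq by (simp add: O_space_def)
qed

lemma fourier_norm_zero:
  assumes "base_dom II YY r \<sigma> \<noteq> {}"
  shows "fourier_norm II YY r \<sigma> s (\<lambda>z. 0) = 0"
proof -
  have "fourier_coeff (\<lambda>z. 0) k = (\<lambda>a y. 0)" for k
    by (intro ext) (simp add: fourier_coeff_def)
  moreover have "sup_norm (base_dom II YY r \<sigma>) (\<lambda>a y. 0) = 0"
    using assms by (simp add: sup_norm_def case_prod_unfold)
  ultimately show ?thesis
    by (simp add: fourier_norm_def)
qed

lemma O3_spaceD: "F \<in> O3_space II YY r \<sigma> s \<Longrightarrow> (\<lambda>z. F z $ i) \<in> O_space II YY r \<sigma> s"
  by (simp add: O3_space_def)

lemma O_space_holo3: "f \<in> O_space II YY r \<sigma> s \<Longrightarrow> holo3 f (phase_dom II YY r \<sigma> s)"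
  by (simp add: O_space_def)

theorem theoremB:
  fixes II YY :: "real set" and r \<sigma> s \<rho> \<tau> t s2 :: real and p :: nat
    and v \<omega> :: "complex \<Rightarrow> complex \<Rightarrow> complex"
    and N P X :: "complex^3 \<Rightarrow> complex^3"
  defines "B \<equiv> base_dom II YY r \<sigma>"
    and "d \<equiv> diameter (cnbhd YY \<sigma>)"
    and "normP \<equiv> weighted_norm II YY r \<sigma> s \<rho> \<tau> t P"
  defines "Q \<equiv> 3 * d * sup_norm B (\<lambda>a y. 1 / v a y)"
    and "r' \<equiv> r - 8 * \<rho>" and "\<sigma>' \<equiv> \<sigma> - 8 * exp s2 * \<tau>" and "s' \<equiv> s - 10 * t"
  assumes II: "open II" "connected II" "II \<noteq> {}"
    and YY: "open YY" "connected YY" "YY \<noteq> {}"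
    and u: "r > 0" "\<sigma> > 0" "s > 0"
    and N: "N = normal_field v \<omega>"
    and X: "X = (\<lambda>z. N z + P z)" "X \<in> O3_space II YY r \<sigma> s"
    and finite_quantities:
      "P \<in> O3_space II YY r \<sigma> s"
      "bounded (cnbhd YY \<sigma>)"
      "\<And>a y. (a, y) \<in> B \<Longrightarrow> v a y \<noteq> 0"
      "sup_bdd B (\<lambda>a y. 1 / v a y)"
      "sup_bdd B (\<lambda>a y. d_y v a y / v a y)"
      "sup_bdd B (\<lambda>a y. d_y \<omega> a y / v a y)"
      "sup_bdd B (\<lambda>a y. d_I v a y / v a y)"
      "sup_bdd B (\<lambda>a y. d_I \<omega> a y / v a y)"
      "sup_bdd B (\<lambda>a y. \<omega> a y / v a y)"
    and p: "p \<ge> 1" and s2: "s2 > 0"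
    and \<rho>: "0 < \<rho>" "\<rho> < r / 8"
    and \<tau>: "0 < \<tau>" "\<tau> < exp (- s2) * (\<sigma> / 8)"
    and t: "0 < t" "t < s / 10"
    and \<chi>: "d / s2 * sup_norm B (\<lambda>a y. d_y v a y / v a y) \<le> 1"
    and \<theta>1: "2 * exp s2 * d * sup_norm B (\<lambda>a y. d_y \<omega> a y / v a y) * (\<tau> / t) \<le> 1"
    and \<theta>2: "4 * d * sup_norm B (\<lambda>a y. d_I v a y / v a y) * (\<rho> / \<tau>) \<le> 1"
    and \<theta>3: "8 * d * sup_norm B (\<lambda>a y. d_I \<omega> a y / v a y) * (\<rho> / t) \<le> 1"
    and \<eta>: "max (d / t * sup_norm B (\<lambda>a y. \<omega> a y / v a y))
                (2 ^ 7 * exp (2 * s2) * Q\<^sup>2 * normP\<^sup>2) < 1 / real p"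
  shows "\<exists>\<Phi> P'.
    coord_change \<Phi> (phase_dom II YY r' \<sigma>' s') (phase_dom II YY r \<sigma> s) \<and>
    (real_on_reals (phase_dom II YY r \<sigma> s) N \<and> real_on_reals (phase_dom II YY r \<sigma> s) P
       \<longrightarrow> real_on_reals (phase_dom II YY r' \<sigma>' s') \<Phi>) \<and>
    transform_field \<Phi> X \<in> O3_space II YY r' \<sigma>' s' \<and>
    P' \<in> O3_space II YY r' \<sigma>' s' \<and>
    (\<forall>z\<in>phase_dom II YY r' \<sigma>' s'. transform_field \<Phi> X z = N z + P' z) \<and>
    (normP \<noteq> 0 \<longrightarrow> weighted_norm II YY r' \<sigma>' s' \<rho> \<tau> t P' < (1 / 2) ^ (p + 1) * normP) \<and>
    (normP = 0 \<longrightarrow> weighted_norm II YY r' \<sigma>' s' \<rho> \<tau> t P' = 0)"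
proof -
  let ?D = "phase_dom II YY r \<sigma> s" and ?D' = "phase_dom II YY r' \<sigma>' s'"
  have conv: "convex II" "convex YY"
    using II YY by (auto intro: convex_of_connected_real)
  have B_ne: "B \<noteq> {}"
    unfolding B_def by (rule base_dom_nonempty) (use II YY u in auto)
  obtain y0 where y0: "y0 \<in> YY"
    using YY by blast
  have d: "\<sigma> \<le> d" "d > 0"
    using le_diameter_cnbhd[OF finite_quantities(2) YY(3) u(2)] u by (auto simp: d_def)
  have "1 / real p \<le> 1"
    using p by simp
  define V where "V = sup_norm B (\<lambda>a y. 1 / v a y)"
  have V: "norm (1 / v a y) \<le> V" if "(a, y) \<in> B" for a y
    unfolding V_def by (rule sup_norm_upper[OF finite_quantities(4) that])
  have "V > 0"
  proof -
    obtain a y where ay: "(a, y) \<in> B"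
      using B_ne by auto
    then have "0 < norm (1 / v a y)"
      using finite_quantities(3) by simp
    also have "\<dots> \<le> V"
      by (rule V[OF ay])
    finally show ?thesis .
  qed
  let ?n = "\<lambda>i. fourier_norm II YY r \<sigma> s (\<lambda>z. P z $ i)"
  have n: "?n i \<ge> 0" for i
    using fourier_norm_nonneg[OF O3_spaceD[OF finite_quantities(1)]] B_ne by (simp add: B_def)
  have normP: "normP = ?n 1 / \<rho> + ?n 2 / \<tau> + ?n 3 / t"
    by (simp add: normP_def weighted_norm_def divide_inverse mult.commute)
  have n_div: "0 \<le> ?n 1 / \<rho>" "0 \<le> ?n 2 / \<tau>" "0 \<le> ?n 3 / t"
    using n[of 1] n[of 2] n[of 3] \<rho> \<tau> t by simp_all
  then have normP_nonneg: "normP \<ge> 0"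
    unfolding normP by linarith
  have n_le: "?n 1 \<le> \<rho> * normP" "?n 2 \<le> \<tau> * normP" "?n 3 \<le> t * normP"
  proof -
    have "?n 1 / \<rho> \<le> normP" "?n 2 / \<tau> \<le> normP" "?n 3 / t \<le> normP"
      using n_div unfolding normP by linarith+
    then show "?n 1 \<le> \<rho> * normP" "?n 2 \<le> \<tau> * normP" "?n 3 \<le> t * normP"
      using \<rho> \<tau> t by (simp_all add: divide_le_eq mult.commute)
  qed
  have P_le: "norm (P z $ i) \<le> ?n i" if "z \<in> ?D" for z i
    by (rule norm_le_fourier_norm[OF O3_spaceD[OF finite_quantities(1)] that])
  have N_eq: "N z $ i = X z $ i - P z $ i" for z i
    using X(1) by simp
  have X_holo: "holo3 (\<lambda>z. X z $ i) ?D" and P_holo: "holo3 (\<lambda>z. P z $ i) ?D" for i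
    using O3_spaceD[OF X(2)] O3_spaceD[OF finite_quantities(1)] O_space_holo3 by blast+
  have N_holo: "holo3 (\<lambda>z. N z $ i) ?D" for i
    unfolding N_eq by (intro holo3_diff X_holo P_holo open_phase_dom)
  have N_components: "N z $ 1 = 0" "N z $ 2 = v (z$1) (z$2)" "N z $ 3 = \<omega> (z$1) (z$2)" for z
    by (simp_all add: N normal_field_def)
  \<comment> \<open>Holomorphy and boundedness of \<open>N\<close> are obtained from
    \<open>N = X - P\<close>, both terms having finite Fourier norms.\<close>
  define M where "M = Max (range (\<lambda>i. fourier_norm II YY r \<sigma> s (\<lambda>z. X z $ i) + ?n i))"
  have N_le: "norm (N z $ i) \<le> M" if z: "z \<in> ?D" for z i
  proof -
    have "norm (N z $ i) \<le> norm (X z $ i) + norm (P z $ i)"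
      unfolding N_eq by (rule norm_triangle_ineq4)
    also have "\<dots> \<le> fourier_norm II YY r \<sigma> s (\<lambda>z. X z $ i) + ?n i"
      using P_le[OF z] norm_le_fourier_norm[OF O3_spaceD[OF X(2)] z] by (intro add_mono) auto
    also have "\<dots> \<le> M"
      unfolding M_def by (intro Max_ge) auto
    finally show ?thesis .
  qed
  have base: "norm (v a y) \<le> M" "norm (\<omega> a y) \<le> M" if "(a, y) \<in> B" for a y
  proof -
    have "vector [a, y, 0] \<in> ?D"
      using that u by (simp add: phase_dom_def B_def)
    from N_le[OF this, of 2] N_le[OF this, of 3] show "norm (v a y) \<le> M" "norm (\<omega> a y) \<le> M"
      by (simp_all add: N_components)
  qed
  \<comment> \<open>With \<open>Q = 3 * d * V\<close> the numerical factor is 128 times 9, that is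
    1152, and 33 squared is 1089.\<close>
  have small: "33 * (exp s2 * d * V * normP) \<le> 1"
  proof -
    have "2 ^ 7 * exp (2 * s2) * Q\<^sup>2 * normP\<^sup>2 \<le> 1"
      using \<eta> \<open>1 / real p \<le> 1\<close> by simp
    moreover have "exp (2 * s2) = (exp s2)\<^sup>2"
      by (simp add: exp_double)
    ultimately have "1152 * (exp s2 * d * V * normP)\<^sup>2 \<le> 1"
      by (simp add: Q_def V_def power_mult_distrib)
    then have "(33 * (exp s2 * d * V * normP))\<^sup>2 \<le> 1\<^sup>2"
      using zero_le_power2[of "exp s2 * d * V * normP"]
      unfolding power_mult_distrib[of 33] by simp
    then show ?thesis
      by (rule power2_le_imp_le) simp
  qed
  have flow: "flow_box II YY r \<sigma> s \<rho> \<tau> t s2 d normP V M y0 v \<omega> P"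
  proof
    show "8 * exp s2 * \<tau> < \<sigma>"
      using \<tau> by (simp add: exp_minus field_simps)
    show "norm (y - y') \<le> d" if "y \<in> cnbhd YY \<sigma>" "y' \<in> cnbhd YY \<sigma>" for y y'
      using diameter_bounded_bound[OF finite_quantities(2) that] by (simp add: d_def dist_norm)
    show "holo3 (\<lambda>z. v (z$1) (z$2)) ?D" "holo3 (\<lambda>z. \<omega> (z$1) (z$2)) ?D"
      using N_holo[of 2] N_holo[of 3] by (simp_all add: N_components)
    show "P (z + axis 3 (of_real (2 * pi * of_int m))) = P z" if z: "z \<in> ?D" for z m
    proof -
      have "z + axis 3 (of_real (2 * pi * of_int m)) \<in> ?D"
        using z by (simp add: mem_phase_dom axis_def)
      moreover have "torus_eq (z + axis 3 (of_real (2 * pi * of_int m))) z"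
        unfolding torus_eq_iff by blast
      ultimately show ?thesis
        using O3_spaceD[OF finite_quantities(1)] z by (simp add: O_space_def vec_eq_iff)
    qed
    fix a y
    assume "(a, y) \<in> base_dom II YY r \<sigma>"
    then have ay: "(a, y) \<in> B"
      by (simp add: B_def)
    show "v a y \<noteq> 0"
      using finite_quantities(3) ay by blast
    note sup = sup_norm_upper[OF finite_quantities(5) ay] sup_norm_upper[OF finite_quantities(6) ay]
      sup_norm_upper[OF finite_quantities(7) ay] sup_norm_upper[OF finite_quantities(8) ay]
      sup_norm_upper[OF finite_quantities(9) ay]
    show "norm (d_y v a y / v a y) \<le> s2 / d"
      by (rule order_trans[OF sup(1)]) (use \<chi> d s2 in \<open>simp add: field_simps\<close>)
    show "norm (d_I v a y / v a y) \<le> \<tau> / (4 * d * \<rho>)"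
      by (rule order_trans[OF sup(3)]) (use \<theta>2 d \<rho> \<tau> in \<open>simp add: field_simps\<close>)
    show "norm (d_y \<omega> a y / v a y) \<le> t / (2 * exp s2 * d * \<tau>)"
      by (rule order_trans[OF sup(2)]) (use \<theta>1 d \<tau> t in \<open>simp add: field_simps\<close>)
    show "norm (d_I \<omega> a y / v a y) \<le> t / (8 * d * \<rho>)"
      by (rule order_trans[OF sup(4)]) (use \<theta>3 d \<rho> t in \<open>simp add: field_simps\<close>)
    have "d / t * sup_norm B (\<lambda>a y. \<omega> a y / v a y) \<le> 1"
      using \<eta> \<open>1 / real p \<le> 1\<close> by simp
    then show "norm (\<omega> a y / v a y) \<le> t / d"
      by (intro order_trans[OF sup(5)]) (use d t in \<open>simp add: field_simps\<close>)
  next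
    fix z
    assume z: "z \<in> ?D"
    show "norm (P z $ 1) \<le> \<rho> * normP" "norm (P z $ 2) \<le> \<tau> * normP" "norm (P z $ 3) \<le> t * normP"
      using P_le[OF z, of 1] P_le[OF z, of 2] P_le[OF z, of 3] n_le by linarith+
  qed (use conv y0 \<rho> \<tau> t s2 \<open>V > 0\<close> normP_nonneg d P_holo V base small in \<open>auto simp: B_def\<close>)
  interpret fb: flow_box II YY r \<sigma> s \<rho> \<tau> t s2 d normP V M y0 v \<omega> P ?D "base_dom II YY r \<sigma>"
    by (rule flow reflexive)+
  have D2: "fb.D2 = ?D'"
    by (simp add: fb.D2_def r'_def \<sigma>'_def s'_def)
  have pos': "r' > 0" "\<sigma>' > 0" "s' > 0"
    using fb.room by (auto simp: r'_def \<sigma>'_def s'_def)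
  have ne': "base_dom II YY r' \<sigma>' \<noteq> {}"
    by (rule base_dom_nonempty) (use II YY pos' in auto)
  have sub: "?D' \<subseteq> ?D"
    using fb.D12_sub D2 by simp
  have sub_base: "base_dom II YY r' \<sigma>' \<subseteq> B"
    using cnbhd_mono[of r' r II] cnbhd_mono[of \<sigma>' \<sigma> YY] fb.pos fb.tau_exp
    by (auto simp: B_def base_dom_def r'_def \<sigma>'_def)
  have transform: "transform_field fb.\<Phi> X z = N z" if "z \<in> ?D'" for z
    using fb.transform_eq[of z] that by (simp add: D2 X(1) N)
  have "(\<lambda>z. N z $ i) \<in> O_space II YY r' \<sigma>' s'" for i
  proof -
    have bdd: "sup_bdd (base_dom II YY r' \<sigma>') v" "sup_bdd (base_dom II YY r' \<sigma>') \<omega>"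
      unfolding sup_bdd_def using base sub_base by (auto intro!: bdd_aboveI[of _ M])
    have bdd0: "sup_bdd (base_dom II YY r' \<sigma>') (\<lambda>a y. 0)"
      unfolding sup_bdd_def by (rule bdd_aboveI[of _ 0]) auto
    have "(\<lambda>z. N z $ 1) \<in> O_space II YY r' \<sigma>' s'" "(\<lambda>z. N z $ 2) \<in> O_space II YY r' \<sigma>' s'"
      "(\<lambda>z. N z $ 3) \<in> O_space II YY r' \<sigma>' s'"
      using base_in_O_space[OF _ bdd0 ne', of s'] base_in_O_space[OF _ bdd(1) ne', of s']
        base_in_O_space[OF _ bdd(2) ne', of s'] holo3_subset[OF N_holo[of 1] sub]
        holo3_subset[OF N_holo[of 2] sub] holo3_subset[OF N_holo[of 3] sub]
      by (simp_all add: N_components)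
    then show ?thesis
      using index_3_cases[of i] by auto
  qed
  then have "(\<lambda>z. transform_field fb.\<Phi> X z $ i) \<in> O_space II YY r' \<sigma>' s'" for i
    by (rule O_space_cong) (simp_all add: transform pos')
  then have "transform_field fb.\<Phi> X \<in> O3_space II YY r' \<sigma>' s'"
    by (simp add: O3_space_def)
  moreover have "sup_bdd (base_dom II YY r' \<sigma>') (\<lambda>a y. 0)"
    unfolding sup_bdd_def by (rule bdd_aboveI[of _ 0]) auto
  from base_in_O_space[OF holo3_const[OF open_phase_dom] this ne']
  have "(\<lambda>z. 0) \<in> O3_space II YY r' \<sigma>' s'"
    by (simp add: O3_space_def)
  moreover have "weighted_norm II YY r' \<sigma>' s' \<rho> \<tau> t (\<lambda>z. 0) = 0"
    by (simp add: weighted_norm_def fourier_norm_zero[OF ne'])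
  \<comment> \<open>The new perturbation has norm 0, so the strict inequality is positivity of its
    right-hand side; this is why vanishing \<open>normP\<close> is a case of its own.\<close>
  moreover have "0 < (1 / 2) ^ (p + 1) * normP" if "normP \<noteq> 0"
    using that normP_nonneg by simp
  moreover have "coord_change fb.\<Phi> ?D' ?D"
    using fb.coord_change_\<Phi> by (simp add: D2)
  moreover have "real_on_reals ?D' fb.\<Phi>" if "real_on_reals ?D N" "real_on_reals ?D P"
    using fb.\<Phi>_real that by (simp add: D2 N)
  ultimately show ?thesis
    using transform
    by (intro exI[of _ fb.\<Phi>] exI[of _ "\<lambda>z. 0"] conjI impI ballI) (simp_all only: add_0_right simp_thms)
qed

end
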